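(* Let $q\in(0,1)$. If $\nu>-1$, then the function $h_\nu(\cdot;q)=h_\nu^{(2)}(\cdot;q)$ is starlike in $\mathbb{D}$ and all of its derivatives are close-to-convex in $\mathbb{D}$ if and only if $\nu\ge\max\{\nu_0(q),\nu^{*}(q)\}$, where $\nu_0(q)$ is the unique root (in the variable $\nu$) of the equation $h_\nu'(1;q)=\left.\frac{d}{dz}h_\nu^{(2)}(z;q)\right|_{z=1}=0$, and $\nu^{*}(q)$ is the unique root (in the variable $\nu$) of the equation $j_{\nu,1}(q)=1$.
   Context: $\mathbb{D}=\{z\in\mathbb{C}:|z|<1\}$; the variable $\nu$ ranges over $(-1,\infty)$. For $q\in(0,1)$ let $(a;q)_0=1$, $(a;q)_n=\prod_{k=1}^n(1-aq^{k-1})$, $(a;q)_\infty=\prod_{k\ge1}(1-aq^{k-1})$. The Jackson $q$-Bessel function is $$J_{\nu}^{(2)}(z;q)=\frac{(q^{\nu+1};q)_{\infty}}{(q;q)_{\infty}}\sum_{n\geq0}\frac{(-1)^n(z/2)^{2n+\nu}}{(q;q)_n(q^{\nu+1};q)_n}q^{n(n+\nu)},$$ and $j_{\nu,1}(q)$ is its first positive zero. With $c_\nu(q)=(q;q)_\infty/(q^{\nu+1};q)_\infty$, $$h_\nu^{(2)}(z;q)=2^\nu c_\nu(q)z^{1-\nu/2}J_\nu^{(2)}(\sqrt z;q)=\sum_{n\ge0}\frac{(-1)^nq^{n(n+\nu)}}{4^n(q;q)_n(q^{\nu+1};q)_n}z^{n+1},$$ an entire function. A function $f$ analytic in $\mathbb{D}$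 with $f(0)=0$, $f'(0)=1$ is starlike in $\mathbb{D}$ if it is univalent in $\mathbb{D}$ and $\operatorname{Re}(zf'(z)/f(z))>0$ for all $z\in\mathbb{D}$. An analytic function $f$ on $\mathbb{D}$ (not necessarily normalized) is close-to-convex in $\mathbb{D}$ if there is a convex univalent function $\varphi$ on $\mathbb{D}$ (not necessarily normalized) with $\operatorname{Re}(f'(z)/\varphi'(z))>0$ for all $z\in\mathbb{D}$.
   Formalization: The equation h_ν'(1;q)=0 can have several roots ν>-1 (two for q=0.8), so ν_0(q) is taken as its unique root in [ν*(q),∞); uniqueness on all of (-1,∞) is not claimed. The equivalence is stated for all q in (0,1) and ν>-1. *)

theory Defs
  imports "HOL-Complex_Analysis.Complex_Analysis"
begin

definition qpoch :: "real \<Rightarrow> real \<Rightarrow> nat \<Rightarrow> real" where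
  "qpoch a q n = (\<Prod>k<n. 1 - a * q ^ k)"

definition qpoch_inf :: "real \<Rightarrow> real \<Rightarrow> real" where
  "qpoch_inf a q = (\<Prod>k. 1 - a * q ^ k)"

(* The principal branch of the complex power is used. The value at z = 0 is a junk value when
   nu \<le> 0 (Isabelle has 0 powr a = 0); it is never used below. *)
definition jackson_J2 :: "real \<Rightarrow> real \<Rightarrow> complex \<Rightarrow> complex" where
  "jackson_J2 \<nu> q z =
     of_real (qpoch_inf (q powr (\<nu> + 1)) q / qpoch_inf q q) *
     (\<Sum>n. (-1) ^ n * (z / 2) powr of_real (2 * real n + \<nu>)
            / of_real (qpoch q q n * qpoch (q powr (\<nu> + 1)) q n)
            * of_real (q powr (real n * (real n + \<nu>))))"

definition jackson_j1 :: "real \<Rightarrow> real \<Rightarrow> real" where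
  "jackson_j1 \<nu> q = (LEAST x. 0 < x \<and> jackson_J2 \<nu> q (of_real x) = 0)"

definition h2 :: "real \<Rightarrow> real \<Rightarrow> complex \<Rightarrow> complex" where
  "h2 \<nu> q z =
     of_real (2 powr \<nu> * (qpoch_inf q q / qpoch_inf (q powr (\<nu> + 1)) q)) *
     z powr of_real (1 - \<nu> / 2) * jackson_J2 \<nu> q (csqrt z)"

(* For fixed q, the equation deriv (h2 nu q) 1 = 0 need not have just one root nu > -1: for q = 0.8
   there are two, near 0.0811 and 3.5381, while jackson_j1 nu q = 1 holds near nu = 1.5787. On the
   half-line from the root of jackson_j1 nu q = 1 upwards, where h2 nu q has no zero in the
   punctured disc, the root is unique. *)

(* At z = 0 the quotient z f'(z) / f(z) is understood as its limit 1; as Isabelle evaluates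
   0 / 0 to 0, that point is left out. *)
definition starlike_in_disc :: "(complex \<Rightarrow> complex) \<Rightarrow> bool" where
  "starlike_in_disc f \<longleftrightarrow>
     f holomorphic_on ball 0 1 \<and> f 0 = 0 \<and> deriv f 0 = 1 \<and> inj_on f (ball 0 1) \<and>
     (\<forall>z \<in> ball 0 1 - {0}. 0 < Re (z * deriv f z / f z))"

definition convex_univalent_in_disc :: "(complex \<Rightarrow> complex) \<Rightarrow> bool" where
  "convex_univalent_in_disc \<phi> \<longleftrightarrow>
     \<phi> holomorphic_on ball 0 1 \<and> inj_on \<phi> (ball 0 1) \<and> convex (\<phi> ` ball 0 1)"

definition close_to_convex_in_disc :: "(complex \<Rightarrow> complex) \<Rightarrow> bool" where
  "close_to_convex_in_disc f \<longleftrightarrow>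
     f holomorphic_on ball 0 1 \<and>
     (\<exists>\<phi>. convex_univalent_in_disc \<phi> \<and> (\<forall>z \<in> ball 0 1. 0 < Re (deriv f z / deriv \<phi> z)))"

lemma qpoch_inf_pos:
  assumes "0 < q" "q < 1" "0 \<le> a" "a < 1"
  shows "qpoch_inf a q > 0"
proof -
  have lt: "a * q ^ k < 1" for k
  proof -
    have "a * q ^ k \<le> a * 1"
      using assms by (intro mult_left_mono) (auto intro: power_le_one)
    thus ?thesis using assms by simp
  qed
  have "summable (\<lambda>k. norm (- (a * q ^ k)))"
    using assms by (auto simp: abs_mult power_abs intro!: summable_mult summable_geometric)
  hence "abs_convergent_prod (\<lambda>k. 1 + - (a * q ^ k))"
    using summable_imp_abs_convergent_prod[of "\<lambda>k. 1 - a * q ^ k"] by simp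
  hence "convergent_prod (\<lambda>k. 1 - a * q ^ k)"
    using abs_convergent_prod_imp_convergent_prod by fastforce
  thus ?thesis
    unfolding qpoch_inf_def using lt by (intro less_0_prodinf) auto
qed

lemma qpoch_pos:
  assumes "0 < q" "q < 1" "0 \<le> a" "a < 1"
  shows "qpoch a q n > 0"
  unfolding qpoch_def
proof (rule prod_pos)
  fix k
  have "a * q ^ k \<le> a * 1"
    using assms by (intro mult_left_mono) (auto intro: power_le_one)
  thus "0 < 1 - a * q ^ k" using assms by simp
qed

definition h2_coeff :: "real \<Rightarrow> real \<Rightarrow> nat \<Rightarrow> real" where
  "h2_coeff \<nu> q n = (-1) ^ n * q powr (real n * (real n + \<nu>)) /
     (4 ^ n * qpoch q q n * qpoch (q powr (\<nu> + 1)) q n)"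

lemma h2_coeff_Suc:
  assumes "0 < q"
  shows "h2_coeff \<nu> q (Suc n) = h2_coeff \<nu> q n *
     (- (q powr (2 * real n + 1 + \<nu>) / (4 * (1 - q ^ Suc n) * (1 - q powr (\<nu> + 1) * q ^ n))))"
proof -
  have "real (Suc n) * (real (Suc n) + \<nu>) = real n * (real n + \<nu>) + (2 * real n + 1 + \<nu>)"
    by (simp add: algebra_simps)
  hence "q powr (real (Suc n) * (real (Suc n) + \<nu>)) =
      q powr (real n * (real n + \<nu>)) * q powr (2 * real n + 1 + \<nu>)"
    by (simp only: powr_add)
  thus ?thesis
    unfolding h2_coeff_def qpoch_def prod.lessThan_Suc power_Suc by (simp add: algebra_simps)
qed

lemma summable_h2:
  fixes z :: complex
  assumes q: "0 < q" "q < 1" and \<nu>: "\<nu> > -1"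
  shows "summable (\<lambda>n. of_real (h2_coeff \<nu> q n) * z ^ n)"
proof -
  define r where "r n = q powr (2 * real n + 1 + \<nu>) /
      (4 * (1 - q ^ Suc n) * (1 - q powr (\<nu> + 1) * q ^ n)) * norm z" for n
  have a: "0 < q powr (\<nu> + 1)" "q powr (\<nu> + 1) < 1"
    using q \<nu> by (auto simp: powr_def mult_less_0_iff)
  have qn: "(\<lambda>n. q ^ n) \<longlonglongrightarrow> 0"
    using q by (intro LIMSEQ_power_zero) auto
  have qSn: "(\<lambda>n. q ^ Suc n) \<longlonglongrightarrow> 0"
    using qn by (rule LIMSEQ_Suc)
  have e: "q powr (2 * real n + 1 + \<nu>) = q powr (\<nu> + 1) * (q ^ n * q ^ n)" for n
  proof -
    have "q powr (2 * real n + 1 + \<nu>) = q powr ((\<nu> + 1) + (real n + real n))"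
      by (simp add: algebra_simps)
    thus ?thesis using q by (simp only: powr_add powr_realpow)
  qed
  have "r \<longlonglongrightarrow> q powr (\<nu> + 1) * (0 * 0) / (4 * (1 - 0) * (1 - q powr (\<nu> + 1) * 0)) * norm z"
    unfolding r_def e by (intro tendsto_intros qn qSn) auto
  hence "r \<longlonglongrightarrow> 0" by simp
  hence "eventually (\<lambda>n. r n < 1 / 2) sequentially"
    by (rule order_tendstoD) simp
  then obtain N where N: "\<And>n. n \<ge> N \<Longrightarrow> r n < 1 / 2"
    by (auto simp: eventually_sequentially)
  show ?thesis
  proof (rule summable_ratio_test[of "1 / 2" N])
    fix n assume n: "n \<ge> N"
    have 1: "0 < 1 - q ^ Suc n"
      using q power_Suc_less_one[of q n] by simp
    have "q powr (\<nu> + 1) * q ^ n \<le> q powr (\<nu> + 1) * 1"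
      using q by (intro mult_left_mono) (auto intro: power_le_one)
    hence 2: "0 < 1 - q powr (\<nu> + 1) * q ^ n" using a by linarith
    have pos: "0 \<le> q powr (2 * real n + 1 + \<nu>) /
      (4 * (1 - q ^ Suc n) * (1 - q powr (\<nu> + 1) * q ^ n))"
      by (intro divide_nonneg_nonneg mult_nonneg_nonneg less_imp_le[OF 1] less_imp_le[OF 2]) auto
    have "norm (of_real (h2_coeff \<nu> q (Suc n)) * z ^ Suc n) =
        norm (of_real (h2_coeff \<nu> q n) * z ^ n) * r n"
      unfolding h2_coeff_Suc[OF q(1)] r_def
      by (simp only: norm_mult norm_of_real abs_mult abs_minus_cancel abs_of_nonneg[OF pos, unfolded power_Suc]
            norm_power power_Suc) (simp only: mult_ac)
    also have "\<dots> \<le> norm (of_real (h2_coeff \<nu> q n) * z ^ n) * (1 / 2)"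
      using N[OF n] by (intro mult_left_mono) auto
    finally show "norm (of_real (h2_coeff \<nu> q (Suc n)) * z ^ Suc n)
        \<le> 1 / 2 * norm (of_real (h2_coeff \<nu> q n) * z ^ n)" by (simp add: mult_ac)
  qed simp
qed

lemma h2_series:
  assumes q: "0 < q" "q < 1" and \<nu>: "\<nu> > -1"
  shows "(\<lambda>n. of_real (h2_coeff \<nu> q n) * z ^ (n + 1)) sums h2 \<nu> q z"
proof (cases "z = 0")
  case True
  thus ?thesis by (simp add: h2_def)
next
  case False
  have pow: "(csqrt z / 2) powr of_real (2 * real n + \<nu>) =
      of_real (1 / (4 ^ n * 2 powr \<nu>)) * (z ^ n * z powr of_real (\<nu> / 2))" for n
  proof -
    have "Ln (csqrt z / 2) = Ln z / 2 - of_real (ln 2)"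
    proof -
      have "Ln (csqrt z / of_real 2) = Ln (csqrt z) - of_real (ln 2)"
        using False by (intro Ln_divide_of_real) auto
      moreover have "Ln (csqrt z) = Ln z / 2"
      proof -
        have "csqrt z = exp (Ln z / 2)" using False by (rule csqrt_exp_Ln)
        moreover have "Ln (exp (Ln z / 2)) = Ln z / 2"
          using Im_Ln_le_pi[OF False] mpi_less_Im_Ln[OF False] pi_gt_zero
          by (intro Ln_exp) auto
        ultimately show ?thesis by simp
      qed
      ultimately show ?thesis by simp
    qed
    hence "(csqrt z / 2) powr of_real (2 * real n + \<nu>) =
        exp (of_real (2 * real n + \<nu>) * (Ln z / 2 - of_real (ln 2)))"
      using False by (simp only: powr_def) simp
    also have "\<dots> = exp (of_nat n * Ln z + of_real (\<nu> / 2) * Ln z + of_real (- (2 * real n + \<nu>) * ln 2))"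
      by (simp add: algebra_simps add_divide_distrib)
    also have "\<dots> = z ^ n * z powr of_real (\<nu> / 2) * of_real (exp (- (2 * real n + \<nu>) * ln 2))"
      using False by (simp only: exp_add exp_of_real exp_of_nat_mult exp_Ln[OF False] powr_def if_False)
    also have "exp (- (2 * real n + \<nu>) * ln 2) = 1 / (4 ^ n * 2 powr \<nu>)"
    proof -
      have "exp (- (2 * real n + \<nu>) * ln 2) = 2 powr (- (real (2 * n) + \<nu>))"
        by (simp add: powr_def)
      also have "\<dots> = 1 / (2 powr real (2 * n) * 2 powr \<nu>)"
        by (simp only: powr_minus_divide powr_add)
      also have "(2::real) powr real (2 * n) = 4 ^ n"
        by (simp only: powr_realpow zero_less_numeral power_mult) simp
      finally show ?thesis .
    qed
    finally show ?thesis by (simp only: mult_ac)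
  qed
  define S where "S = (\<Sum>n. of_real (h2_coeff \<nu> q n) * z ^ n)"
  have S: "(\<lambda>n. of_real (h2_coeff \<nu> q n) * z ^ n) sums S"
    unfolding S_def using summable_h2[OF q \<nu>] by (rule summable_sums)
  have "(\<lambda>n. of_real (1 / 2 powr \<nu>) * z powr of_real (\<nu> / 2) *
      (of_real (h2_coeff \<nu> q n) * z ^ n)) sums
      (of_real (1 / 2 powr \<nu>) * z powr of_real (\<nu> / 2) * S)"
    by (rule sums_mult[OF S])
  also have "(\<lambda>n. of_real (1 / 2 powr \<nu>) * z powr of_real (\<nu> / 2) *
      (of_real (h2_coeff \<nu> q n) * z ^ n)) =
      (\<lambda>n. (-1) ^ n * (csqrt z / 2) powr of_real (2 * real n + \<nu>)
            / of_real (qpoch q q n * qpoch (q powr (\<nu> + 1)) q n)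
            * of_real (q powr (real n * (real n + \<nu>))))"
    unfolding pow h2_coeff_def by (rule ext) (simp add: field_simps)
  finally have J: "jackson_J2 \<nu> q (csqrt z) =
      of_real (qpoch_inf (q powr (\<nu> + 1)) q / qpoch_inf q q) *
      (of_real (1 / 2 powr \<nu>) * z powr of_real (\<nu> / 2) * S)"
    unfolding jackson_J2_def by (simp add: sums_iff)
  have a: "0 < q powr (\<nu> + 1)" "q powr (\<nu> + 1) < 1"
    using q \<nu> by (auto simp: powr_def mult_less_0_iff)
  have nz: "qpoch_inf q q \<noteq> 0" "qpoch_inf (q powr (\<nu> + 1)) q \<noteq> 0"
    using qpoch_inf_pos[of q q] qpoch_inf_pos[of q "q powr (\<nu> + 1)"] q a by auto
  have zz: "z powr of_real (1 - \<nu> / 2) * z powr of_real (\<nu> / 2) = z"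
    using False by (simp flip: powr_add)
  have "h2 \<nu> q z = (z powr of_real (1 - \<nu> / 2) * z powr of_real (\<nu> / 2)) * S"
    unfolding h2_def J using nz by (simp add: field_simps)
  hence "h2 \<nu> q z = z * S" by (simp only: zz)
  thus ?thesis using sums_mult[OF S, of z] by (simp add: mult_ac)
qed

end

theory Submission
  imports Defs "HOL-Computational_Algebra.Fundamental_Theorem_Algebra"
begin

text \<open>
  Write \<open>h2 \<nu> q z = z * F \<nu> z\<close>. The contiguous relation
  \<open>F \<nu> z = F (\<nu> + 1) z - c \<nu> * z * F (\<nu> + 2) z\<close> with \<open>c \<nu> > 0\<close> expands
  \<open>F \<nu> / F (\<nu> + 1)\<close> into a Stieltjes continued fraction. As long as its convergents are positive at a
  real \<open>x\<close>, they bound from below, in modulus, the convergents with smaller coefficients at all \<open>z\<close>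
  with \<open>|z| \<le> x\<close>. Since
  \<open>c\<close> decreases, this gives both the monotonicity in \<open>\<nu>\<close> of the first zero and of \<open>- F' / F\<close> at 1, hence the
  two thresholds, and the bound \<open>|F' / F| \<le> 1\<close> on the disc, hence starlikeness; univalence follows by
  writing \<open>z = exp w\<close>.

  The denominators of the convergents are polynomials with positive zeros only, so the derivatives
  of \<open>h2 \<nu> q\<close> are limits of polynomials with positive zeros. For the second derivative the power sums
  of the reciprocal zeros are read off from the coefficients; they are small enough to
  bound the argument by \<open>\<pi> / 2\<close> on the disc. By Gauss--Lucas the higher derivatives inherit the lower bound
  for the zeros. So \<open>\<plusminus>z\<close> serves as the convex function in the definition of close-to-convexity.
\<close>

section \<open>Convergents of a Stieltjes fraction\<close>

text \<open>Every comparison is an induction over finite convergents, and Gauss--Lucas and Newton's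
  identities are applied to polynomials; the functions enter only as limits. Strictness is lost in
  the limit. It is recovered from the factor \<open>q powr (\<nu>' - \<nu>)\<close> for the
  thresholds and from the maximum principle for close-to-convexity.

  The tight case is the second derivative. Its reciprocal zeros x have sum at most 3/2, close to
  pi/2 = 1.5707..., while a factor 1 - x z can turn by arcsin x, which exceeds x. The excess is
  controlled by the sum of squares, which stays below 4/9: each x is then at most 2/3, where arcsin
  x <= x + 3/20 x^2, and the total argument is at most 3/2 + (3/20)(4/9) = 47/30 < pi/2. From the
  third derivative on the sum is at most 4/3, which leaves room.\<close>

fun sfrac :: "(nat \<Rightarrow> real) \<Rightarrow> nat \<Rightarrow> nat \<Rightarrow> 'a::real_normed_field \<Rightarrow> 'a" where
  "sfrac c 0 k z = 1"
| "sfrac c (Suc n) k z = 1 - of_real (c k) * z / sfrac c n (Suc k) z"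

text \<open>Minus the derivative of \<open>sfrac\<close> in z, by the quotient rule. With this sign
  both summands are nonnegative at a real point where the convergents are positive.\<close>

fun sfrac_neg_deriv :: "(nat \<Rightarrow> real) \<Rightarrow> nat \<Rightarrow> nat \<Rightarrow> 'a::real_normed_field \<Rightarrow> 'a" where
  "sfrac_neg_deriv c 0 k z = 0"
| "sfrac_neg_deriv c (Suc n) k z = of_real (c k) / sfrac c n (Suc k) z
     + of_real (c k) * z * sfrac_neg_deriv c n (Suc k) z / sfrac c n (Suc k) z ^ 2"

text \<open>Euler's continuants: the convergent \<open>sfrac c n k\<close> is the quotient of
  \<open>sden c (Suc n) k\<close> by \<open>sden c n (Suc k)\<close>, so the index runs one ahead of
  that of \<open>sfrac\<close>.\<close>

fun sden :: "(nat \<Rightarrow> real) \<Rightarrow> nat \<Rightarrow> nat \<Rightarrow> 'a::real_normed_field \<Rightarrow> 'a" where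
  "sden c 0 k z = 1"
| "sden c (Suc 0) k z = 1"
| "sden c (Suc (Suc n)) k z = sden c (Suc n) (Suc k) z - of_real (c k) * z * sden c n (Suc (Suc k)) z"

fun sden_deriv :: "(nat \<Rightarrow> real) \<Rightarrow> nat \<Rightarrow> nat \<Rightarrow> 'a::real_normed_field \<Rightarrow> 'a" where
  "sden_deriv c 0 k z = 0"
| "sden_deriv c (Suc 0) k z = 0"
| "sden_deriv c (Suc (Suc n)) k z = sden_deriv c (Suc n) (Suc k) z
     - of_real (c k) * sden c n (Suc (Suc k)) z
     - of_real (c k) * z * sden_deriv c n (Suc (Suc k)) z"

fun sden_poly :: "(nat \<Rightarrow> real) \<Rightarrow> nat \<Rightarrow> nat \<Rightarrow> complex poly" where
  "sden_poly c 0 k = 1"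
| "sden_poly c (Suc 0) k = 1"
| "sden_poly c (Suc (Suc n)) k = sden_poly c (Suc n) (Suc k)
     - smult (of_real (c k)) (pCons 0 (sden_poly c n (Suc (Suc k))))"

lemma poly_sden_poly: "poly (sden_poly c n k) z = sden c n k z"
  by (induction c n k rule: sden_poly.induct) auto

lemma has_field_derivative_sden:
  "(sden c n k has_field_derivative sden_deriv c n k z) (at z)"
proof (induction c n k z rule: sden_deriv.induct)
  case (3 c n k z)
  show ?case
    by (subst sden.simps(3)[abs_def]) (rule derivative_eq_intros 3 refl | simp add: algebra_simps)+
qed (simp_all add: sden.simps[abs_def])

lemma of_real_sden: "of_real (sden c n k x) = sden c n k (of_real x)"
  by (induction c n k x rule: sden.induct) auto

lemma of_real_sden_deriv: "of_real (sden_deriv c n k x) = sden_deriv c n k (of_real x)"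
  by (induction c n k x rule: sden_deriv.induct) (auto simp: of_real_sden)

text \<open>Dividing the three-term recursion by its first term turns it into the recursion of the
  fraction. Iterated, this writes \<open>sden\<close> as a product of convergents, so that bounds
  multiply.\<close>

lemma sden_Suc:
  assumes "\<And>n k. sfrac c n k z \<noteq> 0"
  shows "sden c (Suc n) k z = sfrac c n k z * sden c n (Suc k) z"
proof (induction n arbitrary: k)
  case (Suc n)
  show ?case using assms[of n "Suc k"] by (simp add: Suc field_simps)
qed simp

lemma sden_deriv_Suc:
  assumes "\<And>n k. sfrac c n k z \<noteq> 0"
  shows "sden_deriv c (Suc n) k z =
    sfrac c n k z * sden_deriv c n (Suc k) z - sfrac_neg_deriv c n k z * sden c n (Suc k) z"
proof (induction n arbitrary: k)
  case (Suc n)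
  show ?case
    using assms[of n "Suc k"] by (simp add: Suc sden_Suc[OF assms] field_simps power2_eq_square)
qed simp

text \<open>The dominating fraction \<open>c'\<close> is evaluated at the real point
  \<open>x\<close>, the smaller one \<open>c\<close> anywhere in the disc of radius
  \<open>x\<close>. The factor \<open>\<sigma>\<close> records how much smaller \<open>c\<close> is;
  it appears in the bounds for derivatives, where it later gives strict monotonicity in the
  order.\<close>

locale sfrac_comparison =
  fixes c c' :: "nat \<Rightarrow> real" and \<sigma> x :: real and z :: complex
  assumes c: "\<And>k. 0 \<le> c k" "\<And>k. c k \<le> \<sigma> * c' k" and c': "\<And>k. 0 \<le> c' k"
    and \<sigma>: "0 \<le> \<sigma>" "\<sigma> \<le> 1" and z: "norm z \<le> x"
    and pos: "\<And>n k. 0 < sfrac c' n k x"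
begin

lemma cz_le: "c k * norm z \<le> \<sigma> * (c' k * x)"
  using mult_mono[OF c(2) z] c(1)[of k] c'[of k] \<sigma> by (simp add: mult_ac)

lemma cz_le': "c k * norm z \<le> c' k * x"
proof -
  have "0 \<le> c' k * x" using c'[of k] z norm_ge_zero[of z] by (intro mult_nonneg_nonneg) linarith+
  thus ?thesis using cz_le[of k] mult_right_mono[OF \<sigma>(2), of "c' k * x"] by simp
qed

text \<open>Reverse triangle inequality at each level: the subtracted term has a smaller numerator
  and, by induction, a larger denominator in modulus.\<close>

lemma sfrac_le: "sfrac c' n k x \<le> norm (sfrac c n k z)"
proof (induction n arbitrary: k)
  case (Suc n)
  have "norm (of_real (c k) * z / sfrac c n (Suc k) z) = c k * norm z / norm (sfrac c n (Suc k) z)"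
    using c(1)[of k] by (simp add: norm_mult norm_divide)
  also have "\<dots> \<le> c' k * x / sfrac c' n (Suc k) x"
    using cz_le'[of k] Suc[of "Suc k"] pos[of n "Suc k"] c(1)[of k]
    by (intro frac_le) (auto intro: order_trans[OF _ cz_le'])
  finally show ?case
    using norm_triangle_ineq2[of 1 "of_real (c k) * z / sfrac c n (Suc k) z"] by simp
qed simp

lemma sfrac_nz: "sfrac c n k z \<noteq> 0"
  using sfrac_le[of n k] pos[of n k] by auto

lemma sfrac_nz': "sfrac c' n k x \<noteq> 0"
  using pos[of n k] by simp

text \<open>Each summand has to yield exactly one factor \<open>\<sigma>\<close>: the first takes it
  from \<open>c k \<le> \<sigma> * c' k\<close>, the second from the induction hypothesis, with
  \<open>cz_le'\<close> for its coefficient.\<close>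

lemma sfrac_neg_deriv_le: "norm (sfrac_neg_deriv c n k z) \<le> \<sigma> * sfrac_neg_deriv c' n k x"
proof (induction n arbitrary: k)
  case (Suc n)
  let ?r = "sfrac c n (Suc k) z" and ?r' = "sfrac c' n (Suc k) x"
  have D0: "0 \<le> \<sigma> * sfrac_neg_deriv c' n (Suc k) x"
    using Suc[of "Suc k"] norm_ge_zero order_trans by blast
  have "norm (sfrac_neg_deriv c (Suc n) k z) \<le> c k / norm ?r +
      c k * norm z * norm (sfrac_neg_deriv c n (Suc k) z) / norm ?r ^ 2"
    using c(1)[of k] unfolding sfrac_neg_deriv.simps
    by (intro order_trans[OF norm_triangle_ineq]) (simp add: norm_mult norm_divide norm_power)
  also have "c k / norm ?r \<le> (\<sigma> * c' k) / ?r'"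
    using c[of k] sfrac_le[of n "Suc k"] pos[of n "Suc k"] by (intro frac_le) auto
  also have "c k * norm z * norm (sfrac_neg_deriv c n (Suc k) z) / norm ?r ^ 2 \<le>
      (c' k * x) * (\<sigma> * sfrac_neg_deriv c' n (Suc k) x) / ?r' ^ 2"
  proof (rule frac_le)
    have cz0: "0 \<le> c' k * x"
      by (rule order_trans[OF mult_nonneg_nonneg[OF c(1) norm_ge_zero] cz_le'])
    show "0 \<le> (c' k * x) * (\<sigma> * sfrac_neg_deriv c' n (Suc k) x)"
      by (rule mult_nonneg_nonneg[OF cz0 D0])
    show "c k * norm z * norm (sfrac_neg_deriv c n (Suc k) z) \<le>
        (c' k * x) * (\<sigma> * sfrac_neg_deriv c' n (Suc k) x)"
      by (rule mult_mono[OF cz_le' Suc cz0]) simp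
  qed (use sfrac_le[of n "Suc k"] pos[of n "Suc k"] in \<open>auto intro!: power_mono\<close>)
  finally show ?case by (simp add: algebra_simps)
qed simp

lemma sden_pos: "0 < sden c' n k x"
proof (induction n arbitrary: k)
  case (Suc n)
  thus ?case using pos by (simp add: sden_Suc[OF sfrac_nz'])
qed simp

lemma sden_le: "sden c' n k x \<le> norm (sden c n k z)"
proof (induction n arbitrary: k)
  case (Suc n)
  show ?case unfolding sden_Suc[OF sfrac_nz'] sden_Suc[OF sfrac_nz] norm_mult
    using sfrac_le Suc pos sden_pos by (intro mult_mono) (auto intro: less_imp_le)
qed simp

lemma sden_ratio_le:
  "sden c' (Suc n) k x * norm (sden c n (Suc k) z) \<le> norm (sden c (Suc n) k z) * sden c' n (Suc k) x"
  using mult_right_mono[OF sfrac_le[of n k], of "norm (sden c n (Suc k) z) * sden c' n (Suc k) x"]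
    sden_pos[of n "Suc k"]
  by (simp add: sden_Suc[OF sfrac_nz] sden_Suc[OF sfrac_nz'] norm_mult mult_ac)

text \<open>The logarithmic derivative of \<open>sden\<close> is the sum of those of the convergents
  whose product it is, and these are compared one by one. Cross-multiplication keeps quotients out
  of the induction.\<close>

lemma sden_deriv_le:
  "norm (sden_deriv c n k z) * sden c' n k x \<le> \<sigma> * (- sden_deriv c' n k x) * norm (sden c n k z)"
proof (induction n arbitrary: k)
  case (Suc n)
  let ?r = "norm (sfrac c n k z)" and ?r' = "sfrac c' n k x"
  let ?K = "norm (sden c n (Suc k) z)" and ?K' = "sden c' n (Suc k) x"
  let ?D = "norm (sfrac_neg_deriv c n k z)" and ?D' = "sfrac_neg_deriv c' n k x"
  let ?E = "norm (sden_deriv c n (Suc k) z)" and ?E' = "sden_deriv c' n (Suc k) x"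
  have pos': "0 < ?r'" "0 < ?K'" "0 \<le> ?K" "?r' \<le> ?r" "0 \<le> \<sigma> * ?D'"
    using pos sden_pos sfrac_le order_trans[OF norm_ge_zero sfrac_neg_deriv_le] by auto
  have "norm (sden_deriv c (Suc n) k z) \<le> ?r * ?E + ?D * ?K"
    unfolding sden_deriv_Suc[OF sfrac_nz]
    by (rule order_trans[OF norm_triangle_ineq4]) (simp add: norm_mult)
  hence "norm (sden_deriv c (Suc n) k z) * sden c' (Suc n) k x \<le> (?r * ?E + ?D * ?K) * (?r' * ?K')"
    using pos' by (simp add: sden_Suc[OF sfrac_nz'] mult_right_mono)
  also have "\<dots> = (?E * ?K') * (?r * ?r') + ?D * (?K * ?K') * ?r'"
    by (simp add: algebra_simps)
  also have "\<dots> \<le> (\<sigma> * (- ?E') * ?K) * (?r * ?r') + (\<sigma> * ?D') * (?K * ?K') * ?r"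
  proof (rule add_mono)
    show "(?E * ?K') * (?r * ?r') \<le> (\<sigma> * (- ?E') * ?K) * (?r * ?r')"
      using pos' by (intro mult_right_mono[OF Suc]) auto
    have "?D * (?K * ?K') \<le> (\<sigma> * ?D') * (?K * ?K')"
      using pos' by (intro mult_right_mono[OF sfrac_neg_deriv_le]) auto
    thus "?D * (?K * ?K') * ?r' \<le> (\<sigma> * ?D') * (?K * ?K') * ?r"
      using pos' by (intro mult_mono[of "?D * (?K * ?K')"]) auto
  qed
  also have "\<dots> = \<sigma> * (- sden_deriv c' (Suc n) k x) * norm (sden c (Suc n) k z)"
    by (simp add: sden_deriv_Suc[OF sfrac_nz'] sden_Suc[OF sfrac_nz] norm_mult algebra_simps)
  finally show ?case .
qed simp

end

lemma sden_nz:
  assumes c: "\<And>k. 0 < c k" and z: "\<not> (\<exists>x\<ge>0. z = of_real x)"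
  shows "sden c n k z \<noteq> (0::complex)"
proof -
  \<comment> \<open>With z = -u^2 and Re u > 0, every convergent r satisfies Re (r / u) > 0.\<close>
  define u where "u = csqrt (- z)"
  have zu: "z = - (u ^ 2)" by (simp add: u_def)
  have "Re u \<noteq> 0"
  proof
    assume "Re u = 0"
    hence "u = \<i> * of_real (Im u)" by (simp add: complex_eq_iff)
    hence "z = of_real (Im u ^ 2)" unfolding zu
      by (metis minus_minus mult_minus_left mult_1 of_real_power power2_i power_mult_distrib)
    thus False using z by (metis zero_le_power2)
  qed
  hence u: "Re u > 0" using csqrt_principal[of "- z"] by (auto simp: u_def)
  have inv: "0 < Re (1 / w)" if "0 < Re w" for w
    using that by (auto simp: Re_divide add_pos_nonneg)
  have r: "0 < Re (sfrac c n k z / u)" for n k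
  proof (induction n arbitrary: k)
    case 0
    show ?case using inv[OF u] by simp
  next
    case (Suc n)
    have "sfrac c (Suc n) k z / u = 1 / u + of_real (c k) * (1 / (sfrac c n (Suc k) z / u))"
      using \<open>Re u \<noteq> 0\<close> by (cases "u = 0") (simp_all add: zu add_divide_distrib power2_eq_square)
    moreover have "0 < Re (of_real (c k) * (1 / (sfrac c n (Suc k) z / u)))"
      using inv[OF Suc[of "Suc k"]] c[of k] by (simp only: Re_complex_of_real Im_complex_of_real times_complex.sel) simp
    ultimately show ?case using inv[OF u] by (simp only: plus_complex.sel add_pos_pos)
  qed
  have nz: "sfrac c n k z \<noteq> 0" for n k using r[of n k] by auto
  show ?thesis
  proof (induction n arbitrary: k)
    case (Suc n)
    thus ?case using nz by (simp add: sden_Suc[OF nz])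
  qed simp
qed

text \<open>Both sequences obey the same recursion, hence so does the error. It starts where F is
  compared with the initial value 1, and each step costs at most a factor 1 + c |z|. The recursion
  preserves \<open>k + n\<close> and stops at n = 1 or n = 0, so \<open>m < k + n\<close> keeps
  every final index at least \<open>m\<close>.\<close>

lemma sden_approx:
  fixes F :: "nat \<Rightarrow> 'a::real_normed_field"
  assumes rec: "\<And>k. F k = F (Suc k) - of_real (c k) * z * F (Suc (Suc k))"
    and c: "\<And>k. 0 \<le> c k" and F: "\<And>j. j \<ge> m \<Longrightarrow> norm (F j - 1) \<le> E" and E: "0 \<le> E"
  shows "m < k + n \<Longrightarrow> norm (sden c n k z - F k) \<le> E * (\<Prod>j<n. 1 + c (k + j) * norm z)"
proof (induction n arbitrary: k rule: induct_nat_012)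
  case 0
  thus ?case using F[of k] by (simp add: norm_minus_commute)
next
  case 1
  have "norm (1 - F k) \<le> E * 1" using F[of k] 1 by (simp add: norm_minus_commute)
  also have "\<dots> \<le> E * (1 + c k * norm z)" using E c[of k] by (intro mult_left_mono) auto
  finally show ?case by simp
next
  case (ge2 n)
  define P where "P n k = (\<Prod>j<n. 1 + c (k + j) * norm z)" for n k
  have P: "P (Suc n) k = (1 + c k * norm z) * P n (Suc k)" for n k
    unfolding P_def prod.lessThan_Suc_shift by simp
  have P0: "0 \<le> P n k" for n k
    unfolding P_def using c by (intro prod_nonneg) auto
  have "norm (sden c (Suc (Suc n)) k z - F k) =
      norm ((sden c (Suc n) (Suc k) z - F (Suc k)) -
        of_real (c k) * z * (sden c n (Suc (Suc k)) z - F (Suc (Suc k))))"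
    by (subst rec) (simp add: algebra_simps)
  also have "\<dots> \<le> norm (sden c (Suc n) (Suc k) z - F (Suc k)) +
      c k * norm z * norm (sden c n (Suc (Suc k)) z - F (Suc (Suc k)))"
    using c[of k] by (intro order_trans[OF norm_triangle_ineq4]) (simp add: norm_mult)
  also have "\<dots> \<le> E * P (Suc n) (Suc k) + c k * norm z * (E * P (Suc n) (Suc k))"
  proof (intro add_mono mult_left_mono)
    show "norm (sden c (Suc n) (Suc k) z - F (Suc k)) \<le> E * P (Suc n) (Suc k)"
      unfolding P_def using ge2 by (intro ge2) auto
    have "norm (sden c n (Suc (Suc k)) z - F (Suc (Suc k))) \<le> E * P n (Suc (Suc k))"
      unfolding P_def using ge2 by (intro ge2) auto
    also have "\<dots> \<le> E * P (Suc n) (Suc k)"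
      unfolding P[of n "Suc k"]
      using mult_right_mono[of 1 "1 + c (Suc k) * norm z" "P n (Suc (Suc k))"] c P0 E
      by (intro mult_left_mono) auto
    finally show "norm (sden c n (Suc (Suc k)) z - F (Suc (Suc k))) \<le> E * P (Suc n) (Suc k)" .
  qed (use c in auto)
  also have "\<dots> = E * P (Suc (Suc n)) k" unfolding P[of "Suc n" k] by (simp add: algebra_simps)
  finally show ?case unfolding P_def .
qed

section \<open>Polynomials with positive zeros\<close>

text \<open>Vacuous for nonzero constants but false for the zero polynomial, hence the assumptions
  below that derivatives do not vanish.\<close>

definition roots_ge :: "real \<Rightarrow> complex poly \<Rightarrow> bool" where
  "roots_ge a p \<longleftrightarrow> (\<forall>z. poly p z = 0 \<longrightarrow> (\<exists>x\<ge>a. z = of_real x))"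

lemma pderiv_mult_linear:
  "pderiv ([:a, b:] * p) = smult b p + [:a, b:] * pderiv p"
  "pderiv (p * [:a, b:]) = smult b p + [:a, b:] * pderiv p"
proof -
  show "pderiv ([:a, b:] * p) = smult b p + [:a, b:] * pderiv p"
    by (simp add: pderiv_mult pderiv_pCons add.commute del: mult_pCons_left)
  thus "pderiv (p * [:a, b:]) = smult b p + [:a, b:] * pderiv p"
    by (simp only: mult.commute)
qed

lemma poly_pderiv_prod_linear:
  fixes r :: "nat \<Rightarrow> 'a::field"
  assumes "\<And>i. i < n \<Longrightarrow> z \<noteq> r i"
  shows "poly (pderiv (\<Prod>i<n. [:- r i, 1:])) z = poly (\<Prod>i<n. [:- r i, 1:]) z * (\<Sum>i<n. 1 / (z - r i))"
  using assms
proof (induction n)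
  case (Suc n)
  hence "z - r n \<noteq> 0" "z \<noteq> r n" by auto
  thus ?case using Suc
    by (simp add: pderiv_mult_linear field_simps del: mult_pCons_right mult_pCons_left)
qed simp

text \<open>Gauss--Lucas for real zeros, as a statement on p'/p: left of \<open>a\<close> on the
  real axis all terms are negative, and off the axis all imaginary parts have the sign opposite to
  that of Im z.\<close>

lemma sum_inverse_nz:
  fixes x :: "nat \<Rightarrow> real"
  assumes "n \<noteq> 0" and x: "\<And>i. i < n \<Longrightarrow> a \<le> x i" and z: "\<not> (\<exists>y\<ge>a. z = of_real y)"
  shows "(\<Sum>i<n. 1 / (z - of_real (x i))) \<noteq> (0::complex)"
proof (cases "Im z = 0")
  case True
  hence zr: "z = of_real (Re z)" by (simp add: complex_eq_iff)
  hence less: "Re z < a" using z by (metis not_le)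
  have "(\<Sum>i<n. 1 / (z - of_real (x i))) = of_real (\<Sum>i<n. 1 / (Re z - x i))"
    by (subst zr) (simp only: of_real_sum of_real_divide of_real_diff of_real_1)
  moreover have "(\<Sum>i<n. 1 / (Re z - x i)) < 0"
  proof -
    have "0 < (\<Sum>i<n. - (1 / (Re z - x i)))"
      using assms(1) x less by (intro sum_pos) (force simp: zero_less_divide_iff divide_less_0_iff)+
    thus ?thesis by (simp add: sum_negf)
  qed
  ultimately show ?thesis by (metis less_irrefl of_real_eq_0_iff)
next
  case False
  have "Im (1 / (z - of_real y)) = - Im z * (1 / (norm (z - of_real y)) ^ 2)" for y
    by (simp add: Im_divide cmod_power2)
  hence "Im (\<Sum>i<n. 1 / (z - of_real (x i))) = - Im z * (\<Sum>i<n. 1 / (norm (z - of_real (x i))) ^ 2)"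
    by (simp only: Im_sum sum_distrib_left)
  moreover have "0 < (\<Sum>i<n. 1 / (norm (z - of_real (x i))) ^ 2)"
    using assms(1) False by (intro sum_pos) (auto simp: complex_eq_iff)
  ultimately have "Im (\<Sum>i<n. 1 / (z - of_real (x i))) \<noteq> 0" using False by simp
  thus ?thesis by (metis zero_complex.simps(2))
qed

lemma roots_ge_pderiv:
  assumes "roots_ge a p" "pderiv p \<noteq> 0"
  shows "roots_ge a (pderiv p)"
  unfolding roots_ge_def
proof (intro allI impI, rule ccontr)
  fix z assume 0: "poly (pderiv p) z = 0" and z: "\<not> (\<exists>x\<ge>a. z = of_real x)"
  obtain r where r: "smult (lead_coeff p) (\<Prod>i<degree p. [:- r i, 1:]) = p"
    by (rule complex_poly_decompose')
  have "p \<noteq> 0" "degree p \<noteq> 0" using assms(2) by (auto simp: pderiv_eq_0_iff)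
  have "poly p (r i) = 0" if "i < degree p" for i
    by (subst r[symmetric]) (use that in \<open>auto simp: poly_prod\<close>)
  hence "\<forall>i. \<exists>y. i < degree p \<longrightarrow> a \<le> y \<and> r i = of_real y"
    using assms(1) unfolding roots_ge_def by blast
  then obtain x where x: "\<And>i. i < degree p \<Longrightarrow> a \<le> x i \<and> r i = of_real (x i)" by metis
  have nz: "poly p z \<noteq> 0" using assms(1) z unfolding roots_ge_def by blast
  have ne: "z \<noteq> r i" if "i < degree p" for i using x[OF that] z by blast
  have "poly (pderiv p) z = lead_coeff p * poly (pderiv (\<Prod>i<degree p. [:- r i, 1:])) z"
    by (subst r[symmetric]) (simp add: pderiv_smult)
  also have "\<dots> = lead_coeff p * poly (\<Prod>i<degree p. [:- r i, 1:]) z * (\<Sum>i<degree p. 1 / (z - r i))"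
    by (simp add: poly_pderiv_prod_linear[OF ne])
  also have "lead_coeff p * poly (\<Prod>i<degree p. [:- r i, 1:]) z = poly p z"
    by (subst (3) r[symmetric]) simp
  also have "(\<Sum>i<degree p. 1 / (z - r i)) = (\<Sum>i<degree p. 1 / (z - of_real (x i)))"
    using x by (intro sum.cong) auto
  finally show False
    using 0 nz sum_inverse_nz[of "degree p" a x z] \<open>degree p \<noteq> 0\<close> x z by simp
qed

lemma roots_ge_higher_pderiv:
  assumes "roots_ge a p" "(pderiv ^^ k) p \<noteq> 0"
  shows "roots_ge a ((pderiv ^^ k) p)"
  using assms(2)
proof (induction k)
  case (Suc k)
  hence "(pderiv ^^ k) p \<noteq> 0" by auto
  thus ?case using Suc roots_ge_pderiv[of a "(pderiv ^^ k) p"] by simp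
qed (use assms in simp)

lemma deriv_poly: "deriv (poly p) = poly (pderiv p)" for p :: "complex poly"
  by (rule ext) (rule DERIV_imp_deriv[OF poly_DERIV])

lemma higher_deriv_poly: "(deriv ^^ k) (poly p) = poly ((pderiv ^^ k) p)" for p :: "complex poly"
  by (induction k) (simp_all add: deriv_poly)

text \<open>The second derivative is twice the second elementary symmetric function, rewritten by
  Newton's identity in power sums.\<close>

lemma linear_prod_expansion:
  fixes x :: "nat \<Rightarrow> 'a::field_char_0"
  defines "P n \<equiv> (\<Prod>i<n. [:1, - x i:])"
  shows "poly (P n) 0 = 1" "poly (pderiv (P n)) 0 = - (\<Sum>i<n. x i)"
    "poly (pderiv (pderiv (P n))) 0 = (\<Sum>i<n. x i) ^ 2 - (\<Sum>i<n. x i ^ 2)"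
  unfolding P_def
  by (induction n)
     (simp_all add: pderiv_mult_linear pderiv_add pderiv_diff pderiv_smult algebra_simps power2_eq_square
        del: mult_pCons_right mult_pCons_left)

text \<open>The \<open>x i\<close> are the reciprocals of the zeros with multiplicity. In this
  normalization at 0 their power sums can be read off from the Taylor coefficients.\<close>

definition reciprocal_roots :: "complex poly \<Rightarrow> nat \<Rightarrow> (nat \<Rightarrow> real) \<Rightarrow> bool" where
  "reciprocal_roots p n x \<longleftrightarrow> (\<forall>i<n. 0 < x i \<and> poly p (of_real (1 / x i)) = 0) \<and>
     (\<forall>z. poly p z = poly p 0 * (\<Prod>i<n. 1 - of_real (x i) * z))"

lemma ex_reciprocal_roots:
  assumes "roots_ge a p" "0 \<le> a" "poly p 0 \<noteq> 0"
  shows "\<exists>n x. reciprocal_roots p n x"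
proof -
  obtain r where r: "smult (lead_coeff p) (\<Prod>i<degree p. [:- r i, 1:]) = p"
    by (rule complex_poly_decompose')
  define n where "n = degree p"
  have root: "poly p (r i) = 0" if "i < n" for i
    by (subst r[symmetric]) (use that in \<open>auto simp: poly_prod n_def\<close>)
  hence "\<forall>i. \<exists>y. i < n \<longrightarrow> a \<le> y \<and> r i = of_real y"
    using assms(1) unfolding roots_ge_def by blast
  then obtain y where y: "\<And>i. i < n \<Longrightarrow> a \<le> y i" "\<And>i. i < n \<Longrightarrow> r i = of_real (y i)" by metis
  have ypos: "0 < y i" if "i < n" for i
  proof -
    have "y i \<noteq> 0" using root[OF that] y(2)[OF that] assms(3) by auto
    thus ?thesis using y(1)[OF that] assms(2) by simp
  qed
  define x where "x i = 1 / y i" for i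
  define c where "c = lead_coeff p * (\<Prod>i<n. - r i)"
  have "(\<Prod>i<n. [:- r i, 1:]) = (\<Prod>i<n. smult (- r i) [:1, - of_real (x i):])"
    using y ypos by (intro prod.cong) (auto simp: x_def less_imp_neq[THEN not_sym])
  also have "\<dots> = smult (\<Prod>i<n. - r i) (\<Prod>i<n. [:1, - of_real (x i):])"
    by (rule prod_smult)
  finally have p: "p = smult c (\<Prod>i<n. [:1, - of_real (x i):])"
    using r by (simp add: c_def n_def)
  have "poly p 0 = c"
    by (subst p) (simp add: linear_prod_expansion[of "\<lambda>i. complex_of_real (x i)"])
  hence c: "c = poly p 0" ..
  have "0 < x i \<and> poly p (of_real (1 / x i)) = 0" if "i < n" for i
    using ypos[OF that] root[OF that] y(2)[OF that] by (simp add: x_def)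
  moreover have "poly p z = poly p 0 * (\<Prod>i<n. 1 - of_real (x i) * z)" for z
    unfolding c[symmetric] by (subst p) (simp add: poly_prod mult.commute)
  ultimately show ?thesis unfolding reciprocal_roots_def by blast
qed

lemma
  assumes "reciprocal_roots p n x"
  shows reciprocal_roots_pos: "i < n \<Longrightarrow> 0 < x i"
    and reciprocal_roots_le: "roots_ge a p \<Longrightarrow> i < n \<Longrightarrow> a * x i \<le> 1"
    and reciprocal_roots_ex: "poly p 0 \<noteq> 0 \<Longrightarrow> poly p z = 0 \<Longrightarrow> \<exists>i<n. z = of_real (1 / x i)"
    and reciprocal_roots_poly: "poly p z = poly p 0 * (\<Prod>i<n. 1 - of_real (x i) * z)"
    and reciprocal_roots_sum: "poly (pderiv p) 0 = - poly p 0 * of_real (\<Sum>i<n. x i)"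
    and reciprocal_roots_sum2:
      "poly (pderiv (pderiv p)) 0 = poly p 0 * of_real ((\<Sum>i<n. x i) ^ 2 - (\<Sum>i<n. x i ^ 2))"
proof -
  have root: "\<forall>i<n. 0 < x i \<and> poly p (of_real (1 / x i)) = 0"
    using assms unfolding reciprocal_roots_def by (rule conjunct1)
  have "\<forall>z. poly p z = poly p 0 * (\<Prod>i<n. 1 - of_real (x i) * z)"
    using assms unfolding reciprocal_roots_def by (rule conjunct2)
  thus eq: "poly p z = poly p 0 * (\<Prod>i<n. 1 - of_real (x i) * z)" for z
    by (rule spec)
  show pos: "0 < x i" if "i < n" for i using root that by simp
  show "a * x i \<le> 1" if "roots_ge a p" "i < n"
  proof -
    have "poly p (of_real (1 / x i)) = 0" using root that(2) by simp
    hence "a \<le> 1 / x i" using that(1) unfolding roots_ge_def by (metis of_real_eq_iff)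
    thus ?thesis using pos[OF that(2)] by (simp add: field_simps)
  qed
  show "\<exists>i<n. z = of_real (1 / x i)" if h: "poly p 0 \<noteq> 0" "poly p z = 0"
  proof -
    have "poly p 0 * (\<Prod>i<n. 1 - of_real (x i) * z) = 0" using h(2) by (subst (asm) eq)
    then obtain i where "i < n" "1 - of_real (x i) * z = 0" using h(1) by auto
    thus ?thesis using pos[of i] by (intro exI[of _ i]) (simp add: field_simps)
  qed
  note L = linear_prod_expansion[of "\<lambda>i. complex_of_real (x i)" n]
  have "poly p = poly (smult (poly p 0) (\<Prod>i<n. [:1, - of_real (x i):]))"
    by (rule ext, subst eq) (simp add: poly_prod mult.commute)
  hence p: "p = smult (poly p 0) (\<Prod>i<n. [:1, - of_real (x i):])"
    by (simp only: poly_eq_poly_eq_iff)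
  define c where "c = poly p 0"
  note p = p[folded c_def]
  show "poly (pderiv p) 0 = - poly p 0 * of_real (\<Sum>i<n. x i)"
    unfolding c_def[symmetric] by (subst p) (simp add: pderiv_smult L)
  show "poly (pderiv (pderiv p)) 0 = poly p 0 * of_real ((\<Sum>i<n. x i) ^ 2 - (\<Sum>i<n. x i ^ 2))"
    unfolding c_def[symmetric] by (subst p) (simp add: pderiv_smult L)
qed

section \<open>Arguments of products of factors 1 - x z\<close>

lemma pi_half_gt: "47 / 30 < pi / 2"
proof -
  \<comment> \<open>It suffices that 47/90 < pi/6, which follows from sin (47/90) < 1/2.\<close>
  have "\<bar>sin (47 / 90) - (\<Sum>k<5. sin_coeff k * (47 / 90) ^ k)\<bar> \<le> inverse (fact 5) * \<bar>47 / 90 :: real\<bar> ^ 5"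
    by (rule Maclaurin_sin_bound)
  moreover have "(\<Sum>k<5. sin_coeff k * (47 / 90) ^ k) = 47 / 90 - (47 / 90) ^ 3 / (6::real)"
    by (simp add: sin_coeff_def lessThan_nat_numeral fact_numeral)
  ultimately have "\<bar>sin (47 / 90) - (47 / 90 - (47 / 90) ^ 3 / 6)\<bar> \<le> (47 / 90 :: real) ^ 5 / 120"
    by (simp add: fact_numeral)
  moreover have "(47 / 90 - (47 / 90) ^ 3 / 6) + (47 / 90) ^ 5 / 120 < (1 / 2 :: real)"
    by (simp add: power_divide)
  ultimately have "sin (47 / 90 :: real) < 1 / 2" by linarith
  moreover have "1 / 2 \<le> sin (47 / 90 :: real)" if "pi / 6 \<le> 47 / 90"
    using that pi_ge_two unfolding sin_30[symmetric] by (intro sin_monotone_2pi_le) auto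
  ultimately show ?thesis by linarith
qed

text \<open>In other words arcsin x <= x + 3/20 x^2. The defect of the sine at y is at most y^3/6,
  and x (1 + 3x/20)^3 <= 9/10 on this interval makes it at most 3/20 x^2.\<close>

lemma sin_quadratic_ge:
  fixes x :: real
  assumes "0 \<le> x" "x \<le> 2 / 3"
  shows "x \<le> sin (x + 3 / 20 * x ^ 2)"
proof -
  define y where "y = x + 3 / 20 * x ^ 2"
  have y: "0 \<le> y" using assms by (simp add: y_def)
  have "\<bar>sin y - (\<Sum>k<3. sin_coeff k * y ^ k)\<bar> \<le> inverse (fact 3) * \<bar>y\<bar> ^ 3"
    by (rule Maclaurin_sin_bound)
  hence "\<bar>sin y - y\<bar> \<le> y ^ 3 / 6"
    using y by (simp add: sin_coeff_def lessThan_nat_numeral fact_numeral)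
  hence sin: "y - y ^ 3 / 6 \<le> sin y" by linarith
  have "x * (1 + 3 / 20 * x) ^ 3 \<le> (2 / 3) * (1 + 3 / 20 * (2 / 3)) ^ 3"
    using assms by (intro mult_mono power_mono add_mono) auto
  hence "x * (1 + 3 / 20 * x) ^ 3 \<le> 9 / 10" by (simp add: power3_eq_cube)
  hence "x ^ 2 * (x * (1 + 3 / 20 * x) ^ 3) \<le> x ^ 2 * (9 / 10)"
    by (intro mult_left_mono) auto
  moreover have "y ^ 3 = x ^ 2 * (x * (1 + 3 / 20 * x) ^ 3)" unfolding y_def by algebra
  ultimately show ?thesis using sin by (simp add: y_def)
qed

text \<open>The disc of radius x about 1 is seen from 0 under the half-angle arcsin x;
  \<open>sin_quadratic_ge\<close> bounds the arcsine.\<close>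

lemma Im_Ln_le:
  assumes "0 \<le> x" "x \<le> 2 / 3" "norm (z::complex) \<le> 1"
  shows "1 - of_real x * z \<noteq> 0" "\<bar>Im (Ln (1 - of_real x * z))\<bar> \<le> x + 3 / 20 * x ^ 2"
proof -
  define u where "u = of_real x * z"
  have u: "norm u \<le> x" using assms by (simp add: u_def norm_mult mult_left_le)
  have Re: "Re (1 - u) > 0" using abs_Re_le_cmod[of u] u assms by simp
  show nz: "1 - of_real x * z \<noteq> 0" using Re by (metis u_def less_irrefl zero_complex.simps(1))
  define t where "t = \<bar>Im (Ln (1 - u))\<bar>"
  have t: "t < pi / 2" "0 \<le> t" using Re Re_Ln_pos_lt[of "1 - u"] nz by (auto simp: t_def u_def)
  have "sin t \<le> x"
  proof -
    have "norm u ^ 2 \<le> x ^ 2" using u by (intro power_mono) auto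
    hence n: "Re u ^ 2 + Im u ^ 2 \<le> x ^ 2" by (simp add: cmod_power2)
    have x1: "0 \<le> 1 - x ^ 2" using assms power_le_one[of x 2] by simp
    have "(1 - x ^ 2) * (Re u ^ 2 + Im u ^ 2) \<le> (1 - x ^ 2) * x ^ 2"
      by (rule mult_left_mono[OF n x1])
    \<comment> \<open>x^2 |1 - u|^2 - (Im u)^2 is the sum of this square and (1 - x^2) (x^2 -
      |u|^2); the square vanishes at the points of tangency.\<close>
    moreover have "0 \<le> (x ^ 2 - Re u) ^ 2" by simp
    ultimately have "Im u ^ 2 \<le> x ^ 2 * ((1 - Re u) ^ 2 + Im u ^ 2)"
      by (simp add: power2_eq_square algebra_simps)
    hence "Im (1 - u) ^ 2 \<le> (x * norm (1 - u)) ^ 2"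
      by (simp add: power_mult_distrib cmod_power2)
    hence "\<bar>Im (1 - u)\<bar> \<le> \<bar>x * norm (1 - u)\<bar>" by (simp only: abs_le_square_iff)
    hence "\<bar>Im (1 - u)\<bar> \<le> x * norm (1 - u)" using assms(1) by (simp only: abs_mult abs_norm_cancel abs_of_nonneg)
    moreover have "Im (1 - u) = norm (1 - u) * sin (Im (Ln (1 - u)))"
    proof -
      have "Im (1 - u) = Im (exp (Ln (1 - u)))" using nz by (simp add: u_def)
      thus ?thesis using nz by (simp only: Im_exp) (simp add: u_def)
    qed
    moreover have "\<bar>sin (Im (Ln (1 - u)))\<bar> = sin t"
    proof -
      have "0 \<le> sin t" using t by (intro sin_ge_zero) auto
      moreover have "sin t = sin (Im (Ln (1 - u))) \<or> sin t = - sin (Im (Ln (1 - u)))"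
        by (auto simp: t_def abs_if)
      ultimately show ?thesis by auto
    qed
    ultimately have "norm (1 - u) * sin t \<le> x * norm (1 - u)"
      by (metis abs_mult abs_norm_cancel)
    moreover have "0 < norm (1 - u)" using nz by (simp add: u_def)
    ultimately show ?thesis by (simp only: mult.commute[of x] mult_le_cancel_left_pos)
  qed
  show "\<bar>Im (Ln (1 - of_real x * z))\<bar> \<le> x + 3 / 20 * x ^ 2"
  proof (rule ccontr)
    assume "\<not> ?thesis"
    hence "x + 3 / 20 * x ^ 2 < t" by (simp add: t_def u_def)
    moreover have "0 \<le> x + 3 / 20 * x ^ 2" using assms by simp
    ultimately have "sin (x + 3 / 20 * x ^ 2) < sin t"
      using t by (intro sin_monotone_2pi) auto
    thus False using sin_quadratic_ge[OF assms(1,2)] \<open>sin t \<le> x\<close> by simp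
  qed
qed

lemma Re_prod_pos:
  fixes x :: "nat \<Rightarrow> real"
  assumes "\<And>i. i < n \<Longrightarrow> 0 \<le> x i \<and> x i \<le> 2 / 3" "(\<Sum>i<n. x i + 3 / 20 * x i ^ 2) \<le> 47 / 30"
    and "norm (z::complex) \<le> 1"
  shows "0 < Re (\<Prod>i<n. 1 - of_real (x i) * z)"
proof -
  define s where "s = (\<Sum>i<n. Ln (1 - of_real (x i) * z))"
  have "exp s = (\<Prod>i<n. 1 - of_real (x i) * z)"
    unfolding s_def exp_sum[OF finite_lessThan]
    using Im_Ln_le(1)[OF _ _ assms(3)] assms(1) by (intro prod.cong) auto
  moreover have "\<bar>Im s\<bar> < pi / 2"
  proof -
    have "\<bar>Im s\<bar> \<le> (\<Sum>i<n. \<bar>Im (Ln (1 - of_real (x i) * z))\<bar>)"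
      unfolding s_def Im_sum by (rule sum_abs)
    also have "\<dots> \<le> (\<Sum>i<n. x i + 3 / 20 * x i ^ 2)"
      using assms(1,3) by (intro sum_mono Im_Ln_le) auto
    finally show ?thesis using assms(2) pi_half_gt by simp
  qed
  hence "0 < Re (exp s)" using cos_gt_zero_pi[of "Im s"] by (simp add: Re_exp abs_less_iff)
  ultimately show ?thesis by simp
qed

text \<open>Maximum principle for exp (-f), of modulus exp (-Re f) <= 1: if the value 1 were
  attained, exp (-f) would be constant, against Re f(0) > 0.\<close>

lemma Re_pos_of_nonneg:
  assumes "f holomorphic_on ball 0 1" "\<And>z. z \<in> ball 0 1 \<Longrightarrow> 0 \<le> Re (f z)" "0 < Re (f 0)"
    and z: "z \<in> ball (0::complex) 1"
  shows "0 < Re (f z)"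
proof (rule ccontr)
  assume "\<not> 0 < Re (f z)"
  hence 0: "Re (f z) = 0" using assms(2)[OF z] by simp
  have "(\<lambda>z. exp (- f z)) constant_on ball 0 1"
  proof (rule maximum_modulus_principle[of _ _ "ball 0 1" z])
    show "(\<lambda>z. exp (- f z)) holomorphic_on ball 0 1" by (intro holomorphic_intros assms(1))
    show "norm (exp (- f w)) \<le> norm (exp (- f z))" if "w \<in> ball 0 1" for w
      using assms(2)[OF that] 0 by simp
  qed (use z in auto)
  hence "exp (- f z) = exp (- f 0)" using z unfolding constant_on_def by auto
  hence "norm (exp (- f z)) = norm (exp (- f 0))" by (rule arg_cong)
  thus False using 0 assms(3) by simp
qed

text \<open>The case \<open>b = 4 (1 - q) / (5 - 4 q)\<close>, the largest \<open>b\<close> allowed in \<open>second_moment_bound\<close> below, with denominators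
  cleared.\<close>

lemma second_moment_poly_pos:
  fixes q :: real
  assumes "0 \<le> q" "q \<le> 1"
  defines "E \<equiv> 5 - 8 * q + 4 * q ^ 2" and "H \<equiv> 5 - 4 * q - 4 * q ^ 2 + 4 * q ^ 3"
    and "T \<equiv> 1 + q + q ^ 2"
  shows "0 < 4 * (1 + q) ^ 2 * E ^ 2 * (T * H) - 81 * q ^ 4 * (T * H) + 108 * q ^ 6 * (1 + q) * E"
    (is "0 < ?p")
proof (cases "q \<le> 7 / 8")
  case True
  \<comment> \<open>Bernstein form on [0, 7/8]\<close>
  have r: "0 \<le> 7 - 8 * q" using True by simp
  have "7 ^ 11 * ?p = 500 * (7 - 8 * q) ^ 11 + 40500 * q * (7 - 8 * q) ^ 10
      + 1429040 * q ^ 2 * (7 - 8 * q) ^ 9 + 28873668 * q ^ 3 * (7 - 8 * q) ^ 8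
      + 369190335 * q ^ 4 * (7 - 8 * q) ^ 7 + 3115621649 * q ^ 5 * (7 - 8 * q) ^ 6
      + 17526011951 * q ^ 6 * (7 - 8 * q) ^ 5 + 64012275400 * q ^ 7 * (7 - 8 * q) ^ 4
      + 137694104336 * q ^ 8 * (7 - 8 * q) ^ 3 + 142172741876 * q ^ 9 * (7 - 8 * q) ^ 2
      + 40756474176 * q ^ 10 * (7 - 8 * q) + 28541518848 * q ^ 11"
    unfolding E_def H_def T_def by algebra
  also have "\<dots> > 0"
  proof (cases "q = 0")
    case False
    hence "0 < q ^ 11" using assms(1) by simp
    thus ?thesis using assms(1) r by (intro add_nonneg_pos add_nonneg_nonneg mult_nonneg_nonneg) auto
  qed simp
  finally show ?thesis by (simp only: zero_less_mult_iff) auto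
next
  case False
  \<comment> \<open>On the remaining interval the expansion in t has only three negative
    coefficients, and the constant term exceeds the sum of their moduli.\<close>
  define t where "t = 8 * q - 7"
  have t: "0 \<le> t" "t \<le> 1" using False assms(2) by (auto simp: t_def)
  have "8 ^ 11 * ?p = 28541518848 - 1727869440 * t + 151190226176 * t ^ 2 + 4166582528 * t ^ 3
      - 1641935872 * t ^ 4 - 230803456 * t ^ 5 + 56133120 * t ^ 6 + 29562368 * t ^ 7 + 4810752 * t ^ 8
      + 385536 * t ^ 9 + 15616 * t ^ 10 + 256 * t ^ 11"
    unfolding E_def H_def T_def t_def by algebra
  moreover have "t ^ 4 \<le> 1" "t ^ 5 \<le> 1" using t by (auto intro: power_le_one)
  moreover have "0 \<le> t ^ k" for k using t by simp
  note this[of 2] this[of 3] this[of 6] this[of 7] this[of 8] this[of 9] this[of 10] this[of 11]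
  ultimately have "0 < 8 ^ 11 * ?p" using t by linarith
  thus ?thesis by (simp only: zero_less_mult_iff) auto
qed

text \<open>Here \<open>b\<close> stands for q^(\<nu>+1) and \<open>y\<close>, \<open>w\<close> for
  the later \<open>rho \<nu> 1\<close>, \<open>rho \<nu> 2\<close>; the left side is the limit of
  the sum of squares of the reciprocal zeros for the second derivative, and 4/9 = (2/3)^2. It equals
  y^2 (9 - 12 w/y). As b grows, y increases and w/y decreases, so the worst case is the largest
  admissible b, which is 4 (1 - q) / (5 - 4 q).\<close>

lemma second_moment_bound:
  fixes q b :: real
  assumes q: "0 < q" "q < 1" and b: "0 < b" "b < 1" "b \<le> 4 * (1 - q) * (1 - b)"
  defines "y \<equiv> b * q ^ 2 / (4 * (1 - q ^ 2) * (1 - b * q))"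
    and "w \<equiv> b * q ^ 4 / (4 * (1 - q ^ 3) * (1 - b * q ^ 2))"
  shows "9 * y ^ 2 - 12 * y * w < 4 / 9"
proof -
  \<comment> \<open>At the extreme b, \<open>E\<close> and \<open>H\<close> are 5 - 4 q times 1 - b
    q and 1 - b q^2; \<open>T\<close> is (1 - q^3) / (1 - q).\<close>
  define E where "E = 5 - 8 * q + 4 * q ^ 2"
  define H where "H = 5 - 4 * q - 4 * q ^ 2 + 4 * q ^ 3"
  define T where "T = 1 + q + q ^ 2"
  have "E = 1 + 4 * (1 - q) ^ 2" "H = 1 + 4 * (1 - q) ^ 2 * (1 + q)"
    unfolding E_def H_def by algebra+
  moreover have "0 \<le> 4 * (1 - q) ^ 2 * (1 + q)" using q by simp
  ultimately have EH: "0 < E" "0 < H" by (simp_all add: add_pos_nonneg)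
  have T: "0 < T" using q by (simp add: T_def add_pos_pos)
  have lt: "q ^ 2 < 1" "q ^ 3 < 1" "b * q < 1" "b * q ^ 2 < 1"
    using q b by (auto simp: power_less_one_iff power_le_one intro!: order.strict_trans1[OF mult_left_le b(2)])
  have b4: "b * (5 - 4 * q) \<le> 4 * (1 - q)" using b(3) by (simp add: algebra_simps)
  have "b * E \<le> 4 * (1 - q) * (1 - b * q)"
    using b4 unfolding E_def by (simp add: algebra_simps power2_eq_square)
  hence "b \<le> 4 * (1 - q) * (1 - b * q) / E"
    using EH by (intro mult_imp_le_div_pos)
  hence "b / (1 - b * q) \<le> 4 * (1 - q) / E"
    using lt by (intro mult_imp_div_pos_le) auto
  hence "q ^ 2 / (4 * (1 - q ^ 2)) * (b / (1 - b * q)) \<le> q ^ 2 / (4 * (1 - q ^ 2)) * (4 * (1 - q) / E)"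
    using lt by (intro mult_left_mono) auto
  also have "q ^ 2 / (4 * (1 - q ^ 2)) * (4 * (1 - q) / E) = q ^ 2 / ((1 + q) * E)"
  proof -
    have e: "1 - q ^ 2 = (1 - q) * (1 + q)" by algebra
    have "q ^ 2 / (4 * (r * u)) * (4 * r / E) = q ^ 2 / (u * E)" if "r \<noteq> 0" for r u
      using that by simp
    from this[of "1 - q" "1 + q"] show ?thesis unfolding e using q by simp
  qed
  finally have "y \<le> q ^ 2 / ((1 + q) * E)" by (simp add: y_def mult.commute)
  moreover have y: "0 < y" unfolding y_def using q b lt by simp
  ultimately have y2: "y ^ 2 \<le> (q ^ 2 / ((1 + q) * E)) ^ 2" by (intro power_mono) auto
  \<comment> \<open>The value of w/y at the extreme b.\<close>
  define K where "K = q ^ 2 * (1 + q) * E / (T * H)"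
  have "q * (1 - q) * (b * (5 - 4 * q)) \<le> q * (1 - q) * (4 * (1 - q))"
    using q b4 by (intro mult_left_mono) auto
  hence EH': "E * (1 - b * q ^ 2) \<le> (1 - b * q) * H"
    unfolding E_def H_def by (simp add: algebra_simps power2_eq_square power3_eq_cube)
  have "w / y = q ^ 2 * (1 + q) * (1 - b * q) / (T * (1 - b * q ^ 2))"
  proof -
    have e: "1 - q ^ 3 = (1 - q) * T" "1 - q ^ 2 = (1 - q) * (1 + q)" unfolding T_def by algebra+
    have "b * q ^ 4 / (4 * (r * T) * X) / (b * q ^ 2 / (4 * (r * u) * Y)) = q ^ 2 * u * Y / (T * X)"
      if "r \<noteq> 0" "u \<noteq> 0" "X \<noteq> 0" "Y \<noteq> 0" for r u X Y
      using that q b T by (simp add: field_simps eval_nat_numeral)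
    from this[of "1 - q" "1 + q" "1 - b * q ^ 2" "1 - b * q"] show ?thesis
      unfolding w_def y_def e using lt q by simp
  qed
  moreover have "K \<le> q ^ 2 * (1 + q) * (1 - b * q) / (T * (1 - b * q ^ 2))"
  proof -
    have "E \<le> (1 - b * q) * H / (1 - b * q ^ 2)"
      using EH' lt by (intro mult_imp_le_div_pos) auto
    hence "E / H \<le> (1 - b * q) / (1 - b * q ^ 2)"
      by (intro mult_imp_div_pos_le[OF EH(2)]) simp
    hence "q ^ 2 * (1 + q) / T * (E / H) \<le> q ^ 2 * (1 + q) / T * ((1 - b * q) / (1 - b * q ^ 2))"
      using q T by (intro mult_left_mono) auto
    thus ?thesis by (simp add: K_def)
  qed
  ultimately have "K \<le> w / y" by simp
  hence "K * y \<le> w" by (simp only: pos_le_divide_eq[OF y])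
  hence "12 * y * (K * y) \<le> 12 * y * w" using y by (intro mult_left_mono) auto
  hence "9 * y ^ 2 - 12 * y * w \<le> y ^ 2 * (9 - 12 * K)" by (simp add: algebra_simps power2_eq_square)
  also have "\<dots> < 4 / 9"
  proof (cases "9 - 12 * K \<le> 0")
    case True
    hence "y ^ 2 * (9 - 12 * K) \<le> 0" by (intro mult_nonneg_nonpos) auto
    thus ?thesis by simp
  next
    case False
    hence "y ^ 2 * (9 - 12 * K) \<le> (q ^ 2 / ((1 + q) * E)) ^ 2 * (9 - 12 * K)"
      by (intro mult_right_mono[OF y2]) auto
    also have "\<dots> < 4 / 9"
    proof -
      have "(q ^ 2 / ((1 + q) * E)) ^ 2 * (9 - 12 * K) =
          (9 * q ^ 4 * (T * H) - 12 * q ^ 6 * (1 + q) * E) / ((1 + q) ^ 2 * E ^ 2 * (T * H))"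
      proof -
        have "(q ^ 2 / (u * E)) ^ 2 * (9 - 12 * (q ^ 2 * u * E / (T * H))) =
            (9 * q ^ 4 * (T * H) - 12 * q ^ 6 * u * E) / (u ^ 2 * E ^ 2 * (T * H))" if "u \<noteq> 0" for u
          using that EH T by (simp add: field_simps eval_nat_numeral)
        from this[of "1 + q"] show ?thesis unfolding K_def using q by simp
      qed
      also have "\<dots> < 4 / 9"
      proof -
        have "0 < (1 + q) ^ 2 * E ^ 2 * (T * H)" using q EH T by simp
        thus ?thesis
          using second_moment_poly_pos[of q] q unfolding E_def[symmetric] H_def[symmetric] T_def[symmetric]
          by (subst divide_less_eq) auto
      qed
      finally show ?thesis .
    qed
    finally show ?thesis .
  qed
  finally show ?thesis .
qed

section \<open>The entire factor of the q-Bessel function\<close>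

lemma qpoch_Suc_shift: "qpoch a q (Suc n) = (1 - a) * qpoch (a * q) q n"
  unfolding qpoch_def prod.lessThan_Suc_shift by (simp add: mult_ac)

locale qbessel =
  fixes q :: real
  assumes q: "0 < q" "q < 1"
begin

text \<open>Polymorphic because signs are discussed at real arguments and moduli at complex
  ones.\<close>

definition F :: "real \<Rightarrow> 'a::{real_normed_field,banach} \<Rightarrow> 'a" where
  "F \<nu> z = (\<Sum>n. of_real (h2_coeff \<nu> q n) * z ^ n)"

definition dF :: "real \<Rightarrow> 'a::{real_normed_field,banach} \<Rightarrow> 'a" where
  "dF \<nu> z = (\<Sum>n. of_real (real (Suc n) * h2_coeff \<nu> q (Suc n)) * z ^ n)"

definition cf :: "real \<Rightarrow> real" where
  "cf \<nu> = q powr (\<nu> + 1) / (4 * (1 - q powr (\<nu> + 1)) * (1 - q powr (\<nu> + 2)))"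

lemma powr_bounds: "-1 < \<nu> \<Longrightarrow> 0 < q powr (\<nu> + 1)" "-1 < \<nu> \<Longrightarrow> q powr (\<nu> + 1) < 1"
  "-1 < \<nu> \<Longrightarrow> q powr (\<nu> + 2) < 1"
  using q by (auto simp: powr_def mult_less_0_iff)

lemma qpoch_pos': "-1 < \<nu> \<Longrightarrow> 0 < qpoch (q powr (\<nu> + 1)) q n" "0 < qpoch q q n"
  using q powr_bounds[of \<nu>] by (auto intro!: qpoch_pos)

lemma qpoch_mono:
  assumes "0 \<le> a" "a \<le> b" "b < 1"
  shows "qpoch b q n \<le> qpoch a q n"
  unfolding qpoch_def
proof (rule prod_mono)
  fix k assume "k \<in> {..<n}"
  have "b * q ^ k \<le> 1 * 1" using q assms by (intro mult_mono power_le_one) auto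
  moreover have "a * q ^ k \<le> b * q ^ k" using q assms by (intro mult_right_mono) auto
  ultimately show "0 \<le> 1 - b * q ^ k \<and> 1 - b * q ^ k \<le> 1 - a * q ^ k" by simp
qed

lemma abs_coeff:
  assumes "-1 < \<nu>"
  shows "\<bar>h2_coeff \<nu> q n\<bar> = q powr (real n * (real n + \<nu>)) /
     (4 ^ n * qpoch q q n * qpoch (q powr (\<nu> + 1)) q n)"
  using qpoch_pos'(1)[OF assms, of n] qpoch_pos'(2)[of n]
  by (simp add: h2_coeff_def abs_mult power_abs)

lemma coeff_nz: "-1 < \<nu> \<Longrightarrow> h2_coeff \<nu> q n \<noteq> 0"
  using qpoch_pos'(1)[of \<nu> n] qpoch_pos'(2)[of n] q by (simp add: h2_coeff_def)

lemma coeff_sign: "-1 < \<nu> \<Longrightarrow> h2_coeff \<nu> q n = (-1) ^ n * \<bar>h2_coeff \<nu> q n\<bar>"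
  by (simp add: abs_coeff) (simp add: h2_coeff_def)

lemma coeff_0 [simp]: "h2_coeff \<nu> q 0 = 1"
  using q by (simp add: h2_coeff_def qpoch_def)

lemma abs_coeff_le:
  assumes "-1 < \<nu>" "\<nu> \<le> \<nu>'"
  shows "\<bar>h2_coeff \<nu>' q n\<bar> \<le> (q powr (\<nu>' - \<nu>)) ^ n * \<bar>h2_coeff \<nu> q n\<bar>"
proof -
  have "(q powr (\<nu>' - \<nu>)) ^ n = q powr (real n * (\<nu>' - \<nu>))"
    using q by (simp add: powr_realpow [symmetric] powr_powr mult.commute)
  hence "q powr (real n * (real n + \<nu>')) = (q powr (\<nu>' - \<nu>)) ^ n * q powr (real n * (real n + \<nu>))"
    by (simp add: powr_add [symmetric] algebra_simps)
  moreover have "qpoch (q powr (\<nu> + 1)) q n \<le> qpoch (q powr (\<nu>' + 1)) q n"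
    using q assms powr_bounds[of \<nu>] by (intro qpoch_mono) (auto intro!: powr_mono')
  ultimately have "q powr (real n * (real n + \<nu>')) / (4 ^ n * qpoch q q n * qpoch (q powr (\<nu>' + 1)) q n)
    \<le> (q powr (\<nu>' - \<nu>)) ^ n * q powr (real n * (real n + \<nu>)) /
        (4 ^ n * qpoch q q n * qpoch (q powr (\<nu> + 1)) q n)"
    using assms qpoch_pos'(1)[of \<nu> n] qpoch_pos'(2)[of n] by (intro frac_le mult_left_mono) auto
  thus ?thesis using assms by (simp add: abs_coeff)
qed

text \<open>With b = q^(\<nu>+1) and x = q^(n+1) the two coefficients of index n + 1 differ by the
  factor (1 - b x) / (1 - b) - x = (1 - x) / (1 - b), up to common terms. The 1 - x cancels the last
  factor of (q;q)_(n+1), which leaves the n-th coefficient of order \<nu> + 2.\<close>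

lemma coeff_rec:
  assumes "-1 < \<nu>"
  shows "h2_coeff \<nu> q (Suc n) = h2_coeff (\<nu> + 1) q (Suc n) - cf \<nu> * h2_coeff (\<nu> + 2) q n"
proof -
  define b where "b = q powr (\<nu> + 1)"
  define W where "W = q powr (real n * (real n + (\<nu> + 2)))"
  define Q where "Q = qpoch q q n"
  define B where "B = qpoch (b * q * q) q n"
  define x where "x = q ^ Suc n"
  have b: "0 < b" "b < 1" using powr_bounds[OF assms] by (auto simp: b_def)
  have bq: "q powr (\<nu> + 2) = b * q" "q powr (\<nu> + 1 + 1) = b * q" "q powr (\<nu> + 2 + 1) = b * q * q"
    using q by (simp_all add: b_def powr_add powr_numeral power2_eq_square power3_eq_cube)
  have lt: "b * q ^ k < 1" for k
    using b q power_le_one[of q k] mult_left_le[of "q ^ k" b] by linarith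
  have "b * q < 1" using lt[of 1] by simp
  have "b * x < 1" "x < 1" using lt[of "Suc n"] q power_Suc_less_one[of q n] by (auto simp: x_def)
  have e: "qpoch b q (Suc n) * (1 - b * x) = (1 - b) * ((1 - b * q) * B)"
  proof -
    have "qpoch b q (Suc n) * (1 - b * x) = qpoch b q (Suc (Suc n))"
      by (simp add: qpoch_def x_def)
    thus ?thesis by (simp only: qpoch_Suc_shift B_def)
  qed
  have pos: "0 < qpoch b q (Suc n)" "0 < Q" "0 < B"
    using qpoch_pos'(1)[OF assms, of "Suc n"] qpoch_pos'(2)[of n] qpoch_pos'(1)[of "\<nu> + 2" n, unfolded bq] assms
    by (simp_all add: b_def Q_def B_def)
  have h1: "h2_coeff \<nu> q (Suc n) =
      (-1) ^ Suc n * (W * b) / (4 ^ Suc n * (Q * (1 - x)) * qpoch b q (Suc n))"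
  proof -
    have "real (Suc n) * (real (Suc n) + \<nu>) = real n * (real n + (\<nu> + 2)) + (\<nu> + 1)"
      by (simp add: algebra_simps)
    hence "q powr (real (Suc n) * (real (Suc n) + \<nu>)) = W * b"
      by (simp only: powr_add W_def b_def)
    thus ?thesis by (simp add: h2_coeff_def b_def Q_def x_def qpoch_def)
  qed
  have h2: "h2_coeff (\<nu> + 1) q (Suc n) =
      (-1) ^ Suc n * (W * b * x) / (4 ^ Suc n * (Q * (1 - x)) * ((1 - b * q) * B))"
  proof -
    have "real (Suc n) * (real (Suc n) + (\<nu> + 1)) = real n * (real n + (\<nu> + 2)) + (\<nu> + 1) + real (Suc n)"
      by (simp add: algebra_simps)
    hence "q powr (real (Suc n) * (real (Suc n) + (\<nu> + 1))) = W * b * x"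
      using q by (simp only: powr_add W_def b_def powr_realpow x_def)
    moreover have "qpoch q q (Suc n) = Q * (1 - x)" by (simp add: qpoch_def Q_def x_def)
    ultimately show ?thesis unfolding h2_coeff_def bq qpoch_Suc_shift[of "b * q"] B_def by simp
  qed
  have h3: "h2_coeff (\<nu> + 2) q n = (-1) ^ n * W / (4 ^ n * Q * B)"
    unfolding h2_coeff_def bq W_def Q_def B_def ..
  define Y where "Y = (1 - b * q) * B"
  define Z where "Z = 4 ^ Suc n * (Q * (1 - x))"
  have YZ: "0 < Y" "0 < Z" using \<open>b * q < 1\<close> pos \<open>x < 1\<close> by (simp_all add: Y_def Z_def)
  have P: "1 / qpoch b q (Suc n) = (1 - b * x) / ((1 - b) * Y)"
    using e[folded Y_def] pos b YZ by (subst frac_eq_eq) (simp_all add: mult.commute)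
  have "h2_coeff \<nu> q (Suc n) - h2_coeff (\<nu> + 1) q (Suc n) =
      (-1) ^ Suc n * W * b / Z * (1 / qpoch b q (Suc n)) - (-1) ^ Suc n * W * b / Z * (x / Y)"
    unfolding h1 h2 Y_def Z_def by simp
  also have "\<dots> = (-1) ^ Suc n * W * b / Z * ((1 - b * x) / ((1 - b) * Y) - x / Y)"
    unfolding P by (simp only: right_diff_distrib)
  also have "(1 - b * x) / ((1 - b) * Y) - x / Y = ((1 - b * x) - x * (1 - b)) / ((1 - b) * Y)"
    using b YZ by (simp add: divide_simps)
  also have "(1 - b * x) - x * (1 - b) = 1 - x" by (simp add: algebra_simps)
  also have "(-1) ^ Suc n * W * b / Z * ((1 - x) / ((1 - b) * Y)) = - cf \<nu> * h2_coeff (\<nu> + 2) q n"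
    unfolding h3 cf_def bq b_def[symmetric] Y_def Z_def
    using \<open>b * q < 1\<close> b pos \<open>x < 1\<close> by (simp add: divide_simps)
  finally show ?thesis by simp
qed

section \<open>Convergence, termwise differentiation and the contiguous relation\<close>

lemma summable_abs_coeff:
  assumes "-1 < \<nu>"
  shows "summable (\<lambda>n. \<bar>h2_coeff \<nu> q n\<bar> * R ^ n)"
proof -
  have "summable (\<lambda>n. norm (complex_of_real (h2_coeff \<nu> q n) * of_real R ^ n))"
    by (rule powser_insidea[of _ "of_real (\<bar>R\<bar> + 1)"]) (use summable_h2[OF q assms] in auto)
  hence "summable (\<lambda>n. norm (h2_coeff \<nu> q n * R ^ n))"
    by (simp add: norm_mult norm_power abs_mult power_abs)
  hence "summable (\<lambda>n. (\<bar>h2_coeff \<nu> q n\<bar> * \<bar>R\<bar> ^ n))"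
    by (simp add: abs_mult power_abs)
  thus ?thesis
    by (rule summable_comparison_test'[where N = 0]) (simp add: abs_mult power_abs)
qed

lemma summable_coeff:
  assumes "-1 < \<nu>"
  shows "summable (\<lambda>n. of_real (h2_coeff \<nu> q n) * z ^ n :: 'a::{real_normed_field,banach})"
  by (rule summable_comparison_test'[OF summable_abs_coeff[OF assms, of "norm z"], of 0])
     (simp add: norm_mult norm_power)

lemma dF_eq: "dF \<nu> z = (\<Sum>n. diffs (\<lambda>n. of_real (h2_coeff \<nu> q n)) n * z ^ n)"
  by (simp add: dF_def diffs_def)

lemma summable_abs_dcoeff:
  assumes "-1 < \<nu>"
  shows "summable (\<lambda>n. real (Suc n) * \<bar>h2_coeff \<nu> q (Suc n)\<bar> * R ^ n)"
proof -
  have "summable (\<lambda>n. diffs (\<lambda>n. \<bar>h2_coeff \<nu> q n\<bar>) n * R ^ n)"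
    using summable_abs_coeff[OF assms] by (intro termdiff_converges_all) auto
  thus ?thesis by (simp add: diffs_def)
qed

lemma summable_dcoeff:
  assumes "-1 < \<nu>"
  shows "summable (\<lambda>n. of_real (real (Suc n) * h2_coeff \<nu> q (Suc n)) * z ^ n
      :: 'a::{real_normed_field,banach})"
  by (rule summable_comparison_test'[OF summable_abs_dcoeff[OF assms, of "norm z"], of 0])
     (simp add: norm_mult norm_power abs_mult del: of_real_mult of_real_add)

lemma has_field_derivative_F:
  fixes z :: "'a::{real_normed_field,banach}"
  assumes "-1 < \<nu>"
  shows "(F \<nu> has_field_derivative dF \<nu> z) (at z)"
  unfolding F_def[abs_def] dF_eq
  by (rule termdiffs_strong_converges_everywhere) (rule summable_coeff[OF assms])

lemma continuous_on_F: "-1 < \<nu> \<Longrightarrow> continuous_on S (F \<nu>)"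
  by (meson DERIV_continuous has_field_derivative_F continuous_at_imp_continuous_on)

lemma F_of_real: "-1 < \<nu> \<Longrightarrow> F \<nu> (of_real x) = of_real (F \<nu> x)"
  unfolding F_def by (subst suminf_of_real) (use summable_coeff[of \<nu> x] in simp_all)

lemma dF_of_real: "-1 < \<nu> \<Longrightarrow> dF \<nu> (of_real x) = of_real (dF \<nu> x)"
  unfolding dF_def
  by (subst suminf_of_real) (use summable_dcoeff[of \<nu> x] in \<open>simp_all del: of_nat_Suc\<close>)

lemma F_0 [simp]: "F \<nu> 0 = 1"
  by (simp add: F_def)

lemma dF_0 [simp]: "dF \<nu> 0 = of_real (h2_coeff \<nu> q 1)"
  by (simp add: dF_def)

lemma F_rec:
  assumes "-1 < \<nu>"
  shows "F \<nu> z = F (\<nu> + 1) z - of_real (cf \<nu>) * z * F (\<nu> + 2) z"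
proof -
  have *: "F \<mu> z = 1 + (\<Sum>n. of_real (h2_coeff \<mu> q (Suc n)) * z ^ Suc n)" if "-1 < \<mu>" for \<mu>
    unfolding F_def using suminf_split_head[OF summable_coeff[OF that, of z]] by simp
  have s: "summable (\<lambda>n. of_real (h2_coeff \<mu> q (Suc n)) * z ^ Suc n)" if "-1 < \<mu>" for \<mu>
    using summable_Suc_iff[of "\<lambda>n. of_real (h2_coeff \<mu> q n) * z ^ n"] summable_coeff[OF that, of z] by simp
  have "(\<Sum>n. of_real (h2_coeff \<nu> q (Suc n)) * z ^ Suc n) =
      (\<Sum>n. of_real (h2_coeff (\<nu> + 1) q (Suc n)) * z ^ Suc n
         - of_real (cf \<nu>) * z * (of_real (h2_coeff (\<nu> + 2) q n) * z ^ n))"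
    by (simp add: coeff_rec[OF assms] algebra_simps)
  also have "\<dots> = (\<Sum>n. of_real (h2_coeff (\<nu> + 1) q (Suc n)) * z ^ Suc n)
         - (\<Sum>n. of_real (cf \<nu>) * z * (of_real (h2_coeff (\<nu> + 2) q n) * z ^ n))"
    using assms by (intro suminf_diff[symmetric] s summable_mult summable_coeff) auto
  also have "(\<Sum>n. of_real (cf \<nu>) * z * (of_real (h2_coeff (\<nu> + 2) q n) * z ^ n)) =
      of_real (cf \<nu>) * z * F (\<nu> + 2) z"
    unfolding F_def using assms by (intro suminf_mult summable_coeff) auto
  finally show ?thesis using assms by (simp add: *)
qed

lemma dF_rec:
  fixes z :: "'a::{real_normed_field,banach}"
  assumes "-1 < \<nu>"
  shows "dF \<nu> z = dF (\<nu> + 1) z - of_real (cf \<nu>) * (F (\<nu> + 2) z + z * dF (\<nu> + 2) z)"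
proof (rule DERIV_unique[OF has_field_derivative_F[OF assms]])
  have "((\<lambda>z. F (\<nu> + 1) z - of_real (cf \<nu>) * z * F (\<nu> + 2) z) has_field_derivative
      dF (\<nu> + 1) z - of_real (cf \<nu>) * (F (\<nu> + 2) z + z * dF (\<nu> + 2) z)) (at z)"
    using assms by (auto intro!: derivative_eq_intros has_field_derivative_F simp: algebra_simps)
  moreover have "F \<nu> = (\<lambda>z::'a. F (\<nu> + 1) z - of_real (cf \<nu>) * z * F (\<nu> + 2) z)"
    by (rule ext) (rule F_rec[OF assms])
  ultimately show "(F \<nu> has_field_derivative dF (\<nu> + 1) z
      - of_real (cf \<nu>) * (F (\<nu> + 2) z + z * dF (\<nu> + 2) z)) (at z)"
    by simp
qed

section \<open>Decay in the order, and convergence of the denominators\<close>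

lemma cf_pos: "-1 < \<nu> \<Longrightarrow> 0 < cf \<nu>"
  using powr_bounds[of \<nu>] by (simp add: cf_def)

text \<open>The power of q is the exact quotient of the numerators, and the denominators grow with
  the order. This power becomes \<open>\<sigma>\<close> in the comparison of fractions.\<close>

lemma cf_le:
  assumes "-1 < \<nu>" "\<nu> \<le> \<nu>'"
  shows "cf \<nu>' \<le> q powr (\<nu>' - \<nu>) * cf \<nu>"
proof -
  have "q powr (\<nu>' + 1) = q powr (\<nu>' - \<nu>) * q powr (\<nu> + 1)"
    by (simp flip: powr_add)
  moreover have "q powr (\<nu>' + 1) \<le> q powr (\<nu> + 1)" "q powr (\<nu>' + 2) \<le> q powr (\<nu> + 2)"
    using assms q by (auto intro!: powr_mono')
  moreover have "q powr (\<nu> + 1) < 1" "q powr (\<nu> + 2) < 1"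
    using assms powr_bounds[of \<nu>] by auto
  ultimately have "q powr (\<nu>' + 1) / (4 * (1 - q powr (\<nu>' + 1)) * (1 - q powr (\<nu>' + 2)))
    \<le> q powr (\<nu>' - \<nu>) * q powr (\<nu> + 1) / (4 * (1 - q powr (\<nu> + 1)) * (1 - q powr (\<nu> + 2)))"
    by (intro frac_le mult_mono) auto
  thus ?thesis by (simp add: cf_def)
qed

lemma powr_diff_le_1: "\<nu> \<le> \<nu>' \<Longrightarrow> q powr (\<nu>' - \<nu>) \<le> 1"
  using q powr_le1[of "\<nu>' - \<nu>" q] by auto

lemma cf_nat_le: "-1 < \<nu> \<Longrightarrow> cf (\<nu> + real k) \<le> q ^ k * cf \<nu>"
  using cf_le[of \<nu> "\<nu> + real k"] q by (simp add: powr_realpow)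

lemma abs_coeff_nat_le:
  assumes "-1 < \<nu>" "1 \<le> n"
  shows "\<bar>h2_coeff (\<nu> + real k) q n\<bar> \<le> q ^ k * \<bar>h2_coeff \<nu> q n\<bar>"
proof -
  have "\<bar>h2_coeff (\<nu> + real k) q n\<bar> \<le> (q ^ k) ^ n * \<bar>h2_coeff \<nu> q n\<bar>"
    using abs_coeff_le[of \<nu> "\<nu> + real k" n] assms q by (simp add: powr_realpow)
  also have "(q ^ k) ^ n \<le> (q ^ k) ^ 1"
    using q assms by (intro power_decreasing) (auto intro: power_le_one)
  finally show ?thesis by (simp add: mult_right_mono)
qed

text \<open>Raising the order by k shrinks every coefficient but the constant one at least by q^k.
  Hence F at high orders approaches 1, the initial value of the continuants, at a geometric
  rate.\<close>

lemma F_near_1: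
  assumes "-1 < \<nu>"
  obtains M where "M \<ge> 0" "\<And>k z. norm (z::'a::{real_normed_field,banach}) \<le> R \<Longrightarrow> norm (F (\<nu> + real k) z - 1) \<le> q ^ k * M"
    "\<And>k z. norm (z::'a) \<le> R \<Longrightarrow> norm (dF (\<nu> + real k) z) \<le> q ^ k * M"
proof -
  define M1 where "M1 = (\<Sum>n. \<bar>h2_coeff \<nu> q (Suc n)\<bar> * \<bar>R\<bar> ^ Suc n)"
  define M2 where "M2 = (\<Sum>n. real (Suc n) * \<bar>h2_coeff \<nu> q (Suc n)\<bar> * \<bar>R\<bar> ^ n)"
  have s1: "summable (\<lambda>n. \<bar>h2_coeff \<nu> q (Suc n)\<bar> * \<bar>R\<bar> ^ Suc n)"
    using summable_Suc_iff[of "\<lambda>n. \<bar>h2_coeff \<nu> q n\<bar> * \<bar>R\<bar> ^ n"] summable_abs_coeff[OF assms] by simp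
  have s2: "summable (\<lambda>n. real (Suc n) * \<bar>h2_coeff \<nu> q (Suc n)\<bar> * \<bar>R\<bar> ^ n)"
    by (rule summable_abs_dcoeff[OF assms])
  have M: "0 \<le> M1" "0 \<le> M2"
    unfolding M1_def M2_def by (intro suminf_nonneg s1 s2; simp)+
  show ?thesis
  proof (rule that[of "M1 + M2"])
    fix k and z :: 'a assume z: "norm z \<le> R"
    have \<nu>k: "-1 < \<nu> + real k" using assms by simp
    have qk: "0 \<le> q ^ k" using q by simp
    have "F (\<nu> + real k) z - 1 = (\<Sum>n. of_real (h2_coeff (\<nu> + real k) q (Suc n)) * z ^ Suc n)"
      unfolding F_def using suminf_split_head[OF summable_coeff[OF \<nu>k, of z]] by simp
    also have "norm \<dots> \<le> (\<Sum>n. q ^ k * (\<bar>h2_coeff \<nu> q (Suc n)\<bar> * \<bar>R\<bar> ^ Suc n))"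
    proof (rule norm_suminf_le)
      fix n
      have "norm z ^ Suc n \<le> \<bar>R\<bar> ^ Suc n" using z by (intro power_mono) auto
      hence "\<bar>h2_coeff (\<nu> + real k) q (Suc n)\<bar> * norm z ^ Suc n \<le>
          (q ^ k * \<bar>h2_coeff \<nu> q (Suc n)\<bar>) * \<bar>R\<bar> ^ Suc n"
        using qk by (intro mult_mono abs_coeff_nat_le assms) auto
      thus "norm (of_real (h2_coeff (\<nu> + real k) q (Suc n)) * z ^ Suc n) \<le>
          q ^ k * (\<bar>h2_coeff \<nu> q (Suc n)\<bar> * \<bar>R\<bar> ^ Suc n)"
        by (simp only: norm_mult norm_power norm_of_real mult.assoc)
    qed (rule summable_mult[OF s1])
    also have "\<dots> = q ^ k * M1" unfolding M1_def by (rule suminf_mult[OF s1])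
    also have "\<dots> \<le> q ^ k * (M1 + M2)" using M qk by (intro mult_left_mono) auto
    finally show "norm (F (\<nu> + real k) z - 1) \<le> q ^ k * (M1 + M2)" .
    have "norm (dF (\<nu> + real k) z) \<le> (\<Sum>n. q ^ k * (real (Suc n) * \<bar>h2_coeff \<nu> q (Suc n)\<bar> * \<bar>R\<bar> ^ n))"
      unfolding dF_def
    proof (rule norm_suminf_le)
      fix n
      have "norm z ^ n \<le> \<bar>R\<bar> ^ n" using z by (intro power_mono) auto
      hence "(real (Suc n) * \<bar>h2_coeff (\<nu> + real k) q (Suc n)\<bar>) * norm z ^ n \<le>
          (real (Suc n) * (q ^ k * \<bar>h2_coeff \<nu> q (Suc n)\<bar>)) * \<bar>R\<bar> ^ n"
        using qk by (intro mult_mono abs_coeff_nat_le assms mult_left_mono) auto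
      thus "norm (of_real (real (Suc n) * h2_coeff (\<nu> + real k) q (Suc n)) * z ^ n) \<le>
          q ^ k * (real (Suc n) * \<bar>h2_coeff \<nu> q (Suc n)\<bar> * \<bar>R\<bar> ^ n)"
        by (simp only: norm_mult norm_power norm_of_real abs_mult abs_of_nat) (simp only: mult_ac)
    qed (rule summable_mult[OF s2])
    also have "\<dots> = q ^ k * M2" unfolding M2_def by (rule suminf_mult[OF s2])
    also have "\<dots> \<le> q ^ k * (M1 + M2)" using M qk by (intro mult_left_mono) auto
    finally show "norm (dF (\<nu> + real k) z) \<le> q ^ k * (M1 + M2)" .
  qed (use M in simp)
qed

lemma sden_uniform_limit:
  assumes "-1 < \<nu>"
  shows "uniform_limit (cball 0 R) (\<lambda>n. sden (\<lambda>j. cf (\<nu> + real j)) n k)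
    (F (\<nu> + real k) :: 'a::{real_normed_field,banach} \<Rightarrow> 'a) sequentially"
proof -
  let ?c = "\<lambda>j. cf (\<nu> + real j)"
  obtain M where M: "M \<ge> 0"
    "\<And>k z. norm (z::'a) \<le> R \<Longrightarrow> norm (F (\<nu> + real k) z - 1) \<le> q ^ k * M"
    by (rule F_near_1[OF assms, of R, where ?'a = 'a]) blast
  \<comment> \<open>Bounds the product in \<open>sden_approx\<close> for all n at once: its factors
    are at most the exponentials of the terms of a geometric series.\<close>
  define B where "B = exp (cf \<nu> * \<bar>R\<bar> / (1 - q))"
  have bound: "norm (sden ?c (Suc n) k z - F (\<nu> + real k) z) \<le> q ^ n * (M * B)"
    if z: "norm z \<le> R" for n and z :: 'a
  proof -
    have c0: "0 \<le> ?c j" for j using cf_pos[of "\<nu> + real j"] assms by simp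
    have "(\<Prod>j<Suc n. 1 + ?c (k + j) * norm z) \<le> (\<Prod>j<Suc n. exp (q ^ j * (cf \<nu> * \<bar>R\<bar>)))"
    proof (rule prod_mono, intro conjI)
      fix j
      show "0 \<le> 1 + ?c (k + j) * norm z" using c0[of "k + j"] by simp
      have "?c (k + j) \<le> q ^ (k + j) * cf \<nu>" by (rule cf_nat_le[OF assms])
      also have "\<dots> \<le> q ^ j * cf \<nu>"
        using q cf_pos[OF assms] by (intro mult_right_mono power_decreasing) auto
      finally have "?c (k + j) * norm z \<le> q ^ j * cf \<nu> * \<bar>R\<bar>"
        using z c0[of "k + j"] cf_pos[OF assms] q by (intro mult_mono) auto
      thus "1 + ?c (k + j) * norm z \<le> exp (q ^ j * (cf \<nu> * \<bar>R\<bar>))"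
        using exp_ge_add_one_self[of "q ^ j * (cf \<nu> * \<bar>R\<bar>)"]
        by (simp only: mult.assoc)
    qed
    also have "\<dots> = exp ((\<Sum>j<Suc n. q ^ j) * (cf \<nu> * \<bar>R\<bar>))"
      by (simp only: exp_sum[OF finite_lessThan, symmetric] sum_distrib_right)
    also have "\<dots> \<le> B"
    proof -
      have "(\<Sum>j<Suc n. q ^ j) \<le> (\<Sum>j. q ^ j)"
        using q by (intro sum_le_suminf summable_geometric) auto
      also have "\<dots> = 1 / (1 - q)" using q by (intro suminf_geometric) auto
      finally have "(\<Sum>j<Suc n. q ^ j) * (cf \<nu> * \<bar>R\<bar>) \<le> 1 / (1 - q) * (cf \<nu> * \<bar>R\<bar>)"
        using cf_pos[OF assms] by (intro mult_right_mono) auto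
      thus ?thesis by (simp add: B_def)
    qed
    finally have P: "(\<Prod>j<Suc n. 1 + ?c (k + j) * norm z) \<le> B" .
    have "norm (sden ?c (Suc n) k z - F (\<nu> + real k) z) \<le>
        (q ^ n * M) * (\<Prod>j<Suc n. 1 + ?c (k + j) * norm z)"
    proof (rule sden_approx[where m = n and F = "\<lambda>k. F (\<nu> + real k) z"])
      show "F (\<nu> + real k) z = F (\<nu> + real (Suc k)) z
          - of_real (cf (\<nu> + real k)) * z * F (\<nu> + real (Suc (Suc k))) z" for k
        using F_rec[of "\<nu> + real k" z] assms by (simp add: add_ac)
      show "norm (F (\<nu> + real j) z - 1) \<le> q ^ n * M" if "n \<le> j" for j
      proof -
        have "q ^ j * M \<le> q ^ n * M" using that q M(1) by (intro mult_right_mono power_decreasing) auto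
        thus ?thesis using M(2)[OF z, of j] by simp
      qed
    qed (use c0 M q in auto)
    also have "\<dots> \<le> (q ^ n * M) * B" using P M q by (intro mult_left_mono) auto
    finally show ?thesis by (simp add: mult_ac)
  qed
  have "(\<lambda>n. q ^ n * (M * B)) \<longlonglongrightarrow> 0 * (M * B)"
    using q by (intro tendsto_intros LIMSEQ_power_zero) auto
  hence lim: "(\<lambda>n. q ^ n * (M * B)) \<longlonglongrightarrow> 0" by simp
  have "uniform_limit (cball 0 R) (\<lambda>n. sden ?c (Suc n) k) (F (\<nu> + real k) :: 'a \<Rightarrow> 'a) sequentially"
    unfolding uniform_limit_iff
  proof (intro allI impI)
    fix e :: real assume "0 < e"
    hence "\<forall>\<^sub>F n in sequentially. q ^ n * (M * B) < e" using lim by (rule order_tendstoD(2)[rotated])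
    thus "\<forall>\<^sub>F n in sequentially. \<forall>z\<in>cball 0 R. dist (sden ?c (Suc n) k z) (F (\<nu> + real k) z :: 'a) < e"
      by eventually_elim (auto simp: dist_norm intro: order.strict_trans1[OF bound])
  qed
  thus ?thesis by (subst (asm) filterlim_sequentially_Suc)
qed

lemma sden_tendsto:
  assumes "-1 < \<nu>"
  shows "(\<lambda>n. sden (\<lambda>j. cf (\<nu> + real j)) n k z) \<longlonglongrightarrow> (F (\<nu> + real k) z :: 'a::{real_normed_field,banach})"
  by (rule tendsto_uniform_limitI[OF sden_uniform_limit[OF assms, where R = "norm z"]]) simp

text \<open>Locally uniform convergence of holomorphic functions passes to the derivatives; the real
  case is then read off at real points.\<close>

lemma sden_deriv_tendsto_complex:
  assumes "-1 < \<nu>"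
  shows "(\<lambda>n. sden_deriv (\<lambda>j. cf (\<nu> + real j)) n k z) \<longlonglongrightarrow> (dF (\<nu> + real k) z :: complex)"
proof -
  let ?c = "\<lambda>j. cf (\<nu> + real j)"
  have "(\<lambda>n. deriv (sden ?c n k) z) \<longlonglongrightarrow> deriv (F (\<nu> + real k)) z"
  proof (rule deriv_complex_uniform_limit)
    show "uniform_limit (ball 0 (norm z + 1)) (\<lambda>n. sden ?c n k) (F (\<nu> + real k)) sequentially"
      by (rule uniform_limit_on_subset[OF sden_uniform_limit[OF assms, where R = "norm z + 1"]]) auto
    show "\<forall>\<^sub>F n in sequentially. sden ?c n k holomorphic_on ball 0 (norm z + 1)"
      by (rule always_eventually)
         (meson has_field_derivative_sden field_differentiable_def holomorphic_on_def
            field_differentiable_at_within)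
  qed auto
  moreover have "deriv (sden ?c n k) z = sden_deriv ?c n k z" for n
    by (rule DERIV_imp_deriv[OF has_field_derivative_sden])
  moreover have "deriv (F (\<nu> + real k)) z = dF (\<nu> + real k) z"
    using assms by (intro DERIV_imp_deriv has_field_derivative_F) auto
  ultimately show ?thesis by simp
qed

lemma sden_deriv_tendsto_real:
  assumes "-1 < \<nu>"
  shows "(\<lambda>n. sden_deriv (\<lambda>j. cf (\<nu> + real j)) n k x) \<longlonglongrightarrow> (dF (\<nu> + real k) x :: real)"
  using sden_deriv_tendsto_complex[OF assms, of k "of_real x"] assms
  by (simp add: dF_of_real tendsto_of_real_iff flip: of_real_sden_deriv)

text \<open>For x >= 0 this amounts to positivity of \<open>F \<nu>\<close> on [0, x]
  (\<open>good_of_pos\<close>, \<open>good_mono\<close>), but in this form it can be used at a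
  single point along the recursion in the order.\<close>

definition good :: "real \<Rightarrow> real \<Rightarrow> bool" where
  "good \<nu> x \<longleftrightarrow> (\<forall>k. 0 < F (\<nu> + real k) x)"

lemma good_pos: "good \<nu> x \<Longrightarrow> 0 < F (\<nu> + real k) x"
  by (simp add: good_def)

lemma good_pos0: "good \<nu> x \<Longrightarrow> 0 < F \<nu> x"
  using good_pos[of \<nu> x 0] by simp

lemma good_nat: "good \<nu> x \<Longrightarrow> good (\<nu> + real k) x"
  unfolding good_def by (metis add.assoc of_nat_add)

lemma good_Suc: "good \<nu> x \<Longrightarrow> good (\<nu> + 1) x"
  using good_nat[of \<nu> x 1] by simp

lemma good_step: "good (\<nu> + 1) x \<Longrightarrow> 0 < F \<nu> x \<Longrightarrow> good \<nu> x"
  unfolding good_def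
proof
  fix k assume "\<forall>k. 0 < F (\<nu> + 1 + real k) x" "0 < F \<nu> x"
  thus "0 < F (\<nu> + real k) x" by (cases k) (auto simp: add_ac)
qed

lemma F_le_Suc:
  assumes "-1 < \<nu>" "good \<nu> x" "0 \<le> x"
  shows "F (\<nu> + real k) x \<le> F (\<nu> + real (Suc k)) x"
proof -
  have "0 \<le> cf (\<nu> + real k) * x * F (\<nu> + real k + 2) x"
    using assms cf_pos[of "\<nu> + real k"] good_pos[OF assms(2), of "k + 2"]
    by (intro mult_nonneg_nonneg) (auto simp: add_ac)
  thus ?thesis using F_rec[of "\<nu> + real k" x] assms by (simp add: add_ac)
qed

text \<open>The convergents lie above the quotient of neighbouring orders: truncation replaces a
  tail, at most 1 by \<open>F_le_Suc\<close>, by 1, and each level increases with its tail.\<close>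

lemma sfrac_pos:
  assumes "-1 < \<nu>" "good \<nu> x" "0 \<le> x"
  shows "0 < sfrac (\<lambda>j. cf (\<nu> + real j)) n k x"
proof -
  have "F (\<nu> + real k) x / F (\<nu> + real (Suc k)) x \<le> sfrac (\<lambda>j. cf (\<nu> + real j)) n k x"
  proof (induction n arbitrary: k)
    case 0
    show ?case using F_le_Suc[OF assms, of k] good_pos[OF assms(2), of "Suc k"] by simp
  next
    case (Suc n)
    let ?r = "F (\<nu> + real (Suc k)) x / F (\<nu> + real (Suc (Suc k))) x"
    have r: "0 < ?r" by (intro divide_pos_pos good_pos[OF assms(2)])
    have "cf (\<nu> + real k) * x / sfrac (\<lambda>j. cf (\<nu> + real j)) n (Suc k) x \<le> cf (\<nu> + real k) * x / ?r"
      using Suc[of "Suc k"] r assms cf_pos[of "\<nu> + real k"]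
      by (intro divide_left_mono mult_pos_pos mult_nonneg_nonneg) auto
    moreover have "F (\<nu> + real k) x / F (\<nu> + real (Suc k)) x = 1 - cf (\<nu> + real k) * x / ?r"
      using F_rec[of "\<nu> + real k" x] assms good_pos[OF assms(2), of "Suc k"]
      by (simp add: field_simps add_ac)
    ultimately show ?case by simp
  qed
  moreover have "0 < F (\<nu> + real k) x / F (\<nu> + real (Suc k)) x"
    by (intro divide_pos_pos good_pos[OF assms(2)])
  ultimately show ?thesis by linarith
qed

lemma comparison:
  assumes "-1 < \<nu>" "good \<nu> x" "\<nu> \<le> \<nu>'" "norm (z::complex) \<le> x"
  shows "sfrac_comparison (\<lambda>j. cf (\<nu>' + real j)) (\<lambda>j. cf (\<nu> + real j)) (q powr (\<nu>' - \<nu>)) x z"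
proof
  have x: "0 \<le> x" using assms(4) norm_ge_zero order_trans by blast
  show "cf (\<nu>' + real k) \<le> q powr (\<nu>' - \<nu>) * cf (\<nu> + real k)" for k
    using cf_le[of "\<nu> + real k" "\<nu>' + real k"] assms by simp
  show "0 < sfrac (\<lambda>j. cf (\<nu> + real j)) n k x" for n k
    by (rule sfrac_pos[OF assms(1,2) x])
  show "0 \<le> cf (\<nu>' + real k)" "0 \<le> cf (\<nu> + real k)" for k
    using cf_pos[of "\<nu>' + real k"] cf_pos[of "\<nu> + real k"] assms by auto
qed (use assms powr_diff_le_1 in auto)

lemma F_comparison:
  assumes "-1 < \<nu>" "good \<nu> x" "\<nu> \<le> \<nu>'" "norm (z::complex) \<le> x"
  shows "F \<nu> x \<le> norm (F \<nu>' z)"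
proof -
  interpret sfrac_comparison "\<lambda>j. cf (\<nu>' + real j)" "\<lambda>j. cf (\<nu> + real j)" "q powr (\<nu>' - \<nu>)" x z
    by (rule comparison[OF assms])
  show ?thesis
    using assms
    by (intro LIMSEQ_le[OF sden_tendsto[of \<nu> 0 x, simplified] tendsto_norm[OF sden_tendsto[of \<nu>' 0 z, simplified]]])
       (auto intro!: sden_le)
qed

lemma F_ratio_comparison:
  assumes "-1 < \<nu>" "good \<nu> x" "\<nu> \<le> \<nu>'" "norm (z::complex) \<le> x"
  shows "F \<nu> x * norm (F (\<nu>' + 1) z) \<le> norm (F \<nu>' z) * F (\<nu> + 1) x"
proof -
  interpret sfrac_comparison "\<lambda>j. cf (\<nu>' + real j)" "\<lambda>j. cf (\<nu> + real j)" "q powr (\<nu>' - \<nu>)" x z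
    by (rule comparison[OF assms])
  have \<nu>': "-1 < \<nu>'" using assms by simp
  have lim: "(\<lambda>n. sden (\<lambda>j. cf (\<mu> + real j)) (Suc n) 0 y) \<longlonglongrightarrow> F \<mu> y"
    if "-1 < \<mu>" for \<mu> and y :: "'a::{real_normed_field,banach}"
    using LIMSEQ_Suc[OF sden_tendsto[OF that, of 0 y]] by simp
  have lim': "(\<lambda>n. sden (\<lambda>j. cf (\<mu> + real j)) n (Suc 0) y) \<longlonglongrightarrow> F (\<mu> + 1) y"
    if "-1 < \<mu>" for \<mu> and y :: "'a::{real_normed_field,banach}"
    using sden_tendsto[OF that, of "Suc 0" y] by simp
  show ?thesis
    by (rule LIMSEQ_le[OF tendsto_mult[OF lim tendsto_norm[OF lim']] tendsto_mult[OF tendsto_norm[OF lim] lim']])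
       (use assms \<nu>' sden_ratio_le[of _ 0] in auto)
qed

lemma dF_comparison:
  assumes "-1 < \<nu>" "good \<nu> x" "\<nu> \<le> \<nu>'" "norm (z::complex) \<le> x"
  shows "norm (dF \<nu>' z) * F \<nu> x \<le> q powr (\<nu>' - \<nu>) * (- dF \<nu> x) * norm (F \<nu>' z)"
proof -
  interpret sfrac_comparison "\<lambda>j. cf (\<nu>' + real j)" "\<lambda>j. cf (\<nu> + real j)" "q powr (\<nu>' - \<nu>)" x z
    by (rule comparison[OF assms])
  have \<nu>': "-1 < \<nu>'" using assms by simp
  note l = sden_tendsto[OF assms(1), of 0 x, simplified] sden_tendsto[OF \<nu>', of 0 z, simplified]
    sden_deriv_tendsto_real[OF assms(1), of 0 x, simplified]
    sden_deriv_tendsto_complex[OF \<nu>', of 0 z, simplified]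
  show ?thesis
    by (rule LIMSEQ_le[OF tendsto_mult[OF tendsto_norm[OF l(4)] l(1)]
          tendsto_mult[OF tendsto_mult[OF tendsto_const tendsto_minus[OF l(3)]] tendsto_norm[OF l(2)]]])
       (use sden_deriv_le[of _ 0] in auto)
qed

section \<open>Zeros and the two thresholds\<close>

lemma F_pos_near_infinity:
  assumes "-1 < \<nu>"
  obtains K where "\<And>k x. K \<le> k \<Longrightarrow> \<bar>x\<bar> \<le> X \<Longrightarrow> 1 / 2 < F (\<nu> + real k) x \<and> \<bar>dF (\<nu> + real k) x\<bar> < (1 / 2 :: real)"
proof -
  obtain M where M: "M \<ge> 0" "\<And>k z::real. norm z \<le> X \<Longrightarrow> norm (F (\<nu> + real k) z - 1) \<le> q ^ k * M"
    "\<And>k z::real. norm z \<le> X \<Longrightarrow> norm (dF (\<nu> + real k) z) \<le> q ^ k * M"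
    by (rule F_near_1[OF assms, of X]) blast
  have "(\<lambda>k. q ^ k * M) \<longlonglongrightarrow> 0 * M"
    using q by (intro tendsto_intros LIMSEQ_power_zero) auto
  hence "\<forall>\<^sub>F k in sequentially. q ^ k * M < 1 / 2"
    by (intro order_tendstoD(2)) auto
  then obtain K where K: "\<And>k. K \<le> k \<Longrightarrow> q ^ k * M < 1 / 2"
    by (auto simp: eventually_sequentially)
  show ?thesis
  proof (rule that[of K])
    fix k and x :: real assume kx: "K \<le> k" "\<bar>x\<bar> \<le> X"
    show "1 / 2 < F (\<nu> + real k) x \<and> \<bar>dF (\<nu> + real k) x\<bar> < 1 / 2"
      using M(2)[of x k] M(3)[of x k] K[OF kx(1)] kx(2) by (auto simp: abs_le_iff)
  qed
qed

lemma F_pos_of_nz: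
  fixes x :: real
  assumes "-1 < \<nu>" "0 \<le> x" "\<And>t. 0 \<le> t \<Longrightarrow> t \<le> x \<Longrightarrow> F \<nu> t \<noteq> 0"
  shows "0 < F \<nu> x"
proof (rule ccontr)
  assume "\<not> 0 < F \<nu> x"
  hence "\<exists>t\<ge>0. t \<le> x \<and> F \<nu> t = 0"
    using assms(2) by (intro IVT2' continuous_on_F assms(1)) auto
  thus False using assms(3) by auto
qed

lemma F_pos_Suc:
  assumes "-1 < \<nu>" "\<And>x. 0 \<le> x \<Longrightarrow> x \<le> X \<Longrightarrow> 0 < F \<nu> x" "0 \<le> x" "x \<le> X"
  shows "0 < F (\<nu> + 1) (x::real)"
proof (rule ccontr)
  \<comment> \<open>Descent: a zero of F (nu + j + 1) below X forces one of F (nu + j + 2) further left, for all j.\<close>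
  define Q where "Q j \<longleftrightarrow> (\<exists>y. 0 \<le> y \<and> y \<le> X \<and> (\<forall>t. 0 \<le> t \<and> t \<le> y \<longrightarrow> 0 < F (\<nu> + real j) t) \<and>
      F (\<nu> + real (Suc j)) y \<le> 0)" for j
  assume "\<not> 0 < F (\<nu> + 1) x"
  hence "Q 0" unfolding Q_def using assms by (intro exI[of _ x]) auto
  have Q: "Q j" for j
  proof (induction j)
    case (Suc j)
    then obtain y where y: "0 \<le> y" "y \<le> X" "\<And>t. 0 \<le> t \<Longrightarrow> t \<le> y \<Longrightarrow> 0 < F (\<nu> + real j) t"
      "F (\<nu> + real (Suc j)) y \<le> 0"
      unfolding Q_def by blast
    let ?f = "F (\<nu> + real (Suc j)) :: real \<Rightarrow> real" and ?g = "F (\<nu> + real (Suc (Suc j))) :: real \<Rightarrow> real"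
    have cont: "continuous_on A ?f" "isCont ?g t" for A t
      using assms(1) continuous_on_F[of "\<nu> + real (Suc (Suc j))" UNIV]
      by (auto intro!: continuous_on_F simp: continuous_on_eq_continuous_at)
    have "compact {t\<in>{0..y}. ?f t \<le> 0}"
    proof (rule compact_Int_closed[of "{0..y}" "{t. ?f t \<le> 0}", unfolded Int_def mem_Collect_eq])
      show "closed {t. ?f t \<le> 0}"
        using cont(1) by (intro closed_Collect_le) auto
    qed auto
    moreover have "{t\<in>{0..y}. ?f t \<le> 0} \<noteq> {}" using y by auto
    ultimately obtain x0 where x0: "0 \<le> x0" "x0 \<le> y" "?f x0 \<le> 0"
      "\<And>t. 0 \<le> t \<Longrightarrow> t \<le> y \<Longrightarrow> ?f t \<le> 0 \<Longrightarrow> x0 \<le> t"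
      by (auto dest!: compact_attains_inf)
    have "x0 \<noteq> 0" using x0(3) by auto
    hence "0 < x0" using x0(1) by simp
    \<comment> \<open>At the leftmost point \<open>x0\<close> where \<open>?f\<close> is not
      positive, the relation makes \<open>?g\<close> negative. By continuity it is negative slightly
      further left, where \<open>?f\<close> is still positive.\<close>
    have "0 < F (\<nu> + real j) x0" using y(3) x0 by auto
    also have "\<dots> = ?f x0 - cf (\<nu> + real j) * x0 * ?g x0"
      using F_rec[of "\<nu> + real j" x0] assms(1) by (simp add: add_ac)
    finally have "cf (\<nu> + real j) * x0 * ?g x0 < 0" using x0(3) by simp
    hence "?g x0 < 0"
      using cf_pos[of "\<nu> + real j"] assms(1) \<open>0 < x0\<close> by (simp add: mult_less_0_iff zero_less_mult_iff)
    hence "\<forall>\<^sub>F t in at x0. ?g t < 0"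
      using cont(2)[of x0] unfolding isCont_def by (rule order_tendstoD(2)[rotated])
    then obtain d where d: "0 < d" "\<And>t. t \<noteq> x0 \<Longrightarrow> \<bar>t - x0\<bar> < d \<Longrightarrow> ?g t < 0"
      unfolding eventually_at dist_real_def by blast
    define t where "t = max (x0 / 2) (x0 - d / 2)"
    have t: "0 \<le> t" "t < x0" "\<bar>t - x0\<bar> < d" using \<open>0 < x0\<close> d(1) by (auto simp: t_def max_def)
    have "0 < ?f s" if "0 \<le> s" "s \<le> t" for s
      using that t x0(2) x0(4)[of s] by (meson not_le order_trans less_imp_le)
    moreover have "?g t \<le> 0" using d(2)[of t] t by auto
    moreover have "t \<le> X" using t x0(2) y(2) by linarith
    ultimately show ?case unfolding Q_def using t(1) by blast
  qed (rule \<open>Q 0\<close>)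
  \<comment> \<open>The descent passes through all orders, whereas at high orders F exceeds 1/2 on
    the whole interval.\<close>
  obtain K where K: "\<And>k x. K \<le> k \<Longrightarrow> \<bar>x\<bar> \<le> X \<Longrightarrow> 1 / 2 < F (\<nu> + real k) x \<and> \<bar>dF (\<nu> + real k) x\<bar> < (1 / 2 :: real)"
    using F_pos_near_infinity[OF assms(1), of X] by blast
  from Q[of K] obtain y where "0 \<le> y" "y \<le> X" "F (\<nu> + real (Suc K)) y \<le> 0" unfolding Q_def by blast
  thus False using K[of "Suc K" y] by simp
qed

lemma good_of_pos:
  assumes "-1 < \<nu>" "\<And>x. 0 \<le> x \<Longrightarrow> x \<le> X \<Longrightarrow> 0 < F \<nu> x" "0 \<le> x" "x \<le> X"
  shows "good \<nu> x"
  unfolding good_def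
proof
  fix k
  have "\<forall>x. 0 \<le> x \<and> x \<le> X \<longrightarrow> 0 < F (\<nu> + real k) x"
  proof (induction k)
    case (Suc k)
    have "0 < F (\<nu> + real k + 1) x" if "0 \<le> x" "x \<le> X" for x
      by (rule F_pos_Suc[of _ X]) (use Suc assms(1) that in auto)
    thus ?case by (simp add: add_ac)
  qed (use assms in auto)
  thus "0 < F (\<nu> + real k) x" using assms by simp
qed

text \<open>The comparison bounds the modulus of every higher order from below by a positive number
  on [0, y], so no zero occurs there, and the value at 0 is 1.\<close>

lemma good_mono:
  assumes "-1 < \<nu>" "good \<nu> x" "\<nu> \<le> \<nu>'" "0 \<le> y" "y \<le> x"
  shows "good \<nu>' y"
  unfolding good_def
proof
  fix k
  show "0 < F (\<nu>' + real k) y"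
  proof (rule F_pos_of_nz)
    fix t assume t: "0 \<le> t" "t \<le> y"
    have "F (\<nu> + real k) x \<le> norm (F (\<nu>' + real k) (complex_of_real t))"
      using assms t by (intro F_comparison good_nat) auto
    thus "F (\<nu>' + real k) t \<noteq> 0"
      using good_pos[OF assms(2), of k] assms by (simp add: F_of_real)
  qed (use assms in auto)
qed

lemma F_ratio_comparison_real:
  assumes "-1 < \<nu>" "good \<nu> x" "\<nu> \<le> \<nu>'" "0 \<le> y" "y \<le> x"
  shows "F \<nu> x * F (\<nu>' + 1) y \<le> F \<nu>' y * F (\<nu> + 1) x"
  using F_ratio_comparison[OF assms(1-3), of "of_real y"] good_mono[OF assms]
    good_pos0[of \<nu>' y] good_pos0[of "\<nu>' + 1" y] good_Suc[of \<nu>' y] assms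
  by (simp add: F_of_real)

lemma dF_comparison_real:
  assumes "-1 < \<nu>" "good \<nu> x" "\<nu> \<le> \<nu>'" "0 \<le> y" "y \<le> x"
  shows "\<bar>dF \<nu>' y\<bar> * F \<nu> x \<le> q powr (\<nu>' - \<nu>) * (- dF \<nu> x) * F \<nu>' y"
  using dF_comparison[OF assms(1-3), of "of_real y"] good_mono[OF assms] good_pos0[of \<nu>' y] assms
  by (simp add: F_of_real dF_of_real)

text \<open>Comparison of an order with itself, at the points 0 and x: -F'/F at 0 is at most its
  value at x.\<close>

lemma coeff_1_le:
  assumes "-1 < \<nu>" "good \<nu> x" "0 \<le> x"
  shows "\<bar>h2_coeff \<nu> q 1\<bar> * F \<nu> x \<le> - dF \<nu> x"
  using dF_comparison_real[OF assms(1,2), of \<nu> 0] assms(3) q by simp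

lemma dF_neg:
  assumes "-1 < \<nu>" "good \<nu> x" "0 \<le> x"
  shows "dF \<nu> x < 0"
proof -
  have "0 < \<bar>h2_coeff \<nu> q 1\<bar> * F \<nu> x"
    using coeff_nz[OF assms(1), of 1] good_pos0[OF assms(2)] by simp
  thus ?thesis using coeff_1_le[OF assms] by simp
qed

lemma log_deriv_strict_mono:
  assumes "-1 < \<nu>" "good \<nu> 1" "\<nu> < \<nu>'"
  shows "- dF \<nu>' 1 / F \<nu>' 1 < - dF \<nu> 1 / F \<nu> (1::real)"
proof -
  have pos: "0 < F \<nu> (1::real)" "0 < F \<nu>' (1::real)"
    using assms good_mono[of \<nu> 1 \<nu>' 1] good_pos0 by auto
  have "q powr (\<nu>' - \<nu>) < 1" using assms q by (simp add: powr_def mult_less_0_iff)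
  hence "q powr (\<nu>' - \<nu>) * (- dF \<nu> 1) < 1 * (- dF \<nu> (1::real))"
    using dF_neg[OF assms(1,2)] by (intro mult_strict_right_mono) auto
  hence "q powr (\<nu>' - \<nu>) * (- dF \<nu> 1) * F \<nu>' 1 < 1 * (- dF \<nu> 1) * F \<nu>' (1::real)"
    using pos(2) by (rule mult_strict_right_mono)
  moreover have "\<bar>dF \<nu>' 1\<bar> * F \<nu> 1 \<le> q powr (\<nu>' - \<nu>) * (- dF \<nu> 1) * F \<nu>' (1::real)"
    using assms by (intro dF_comparison_real) auto
  moreover have "- dF \<nu>' 1 * F \<nu> 1 \<le> \<bar>dF \<nu>' 1\<bar> * F \<nu> (1::real)"
    using pos by (intro mult_right_mono) auto
  ultimately have "- dF \<nu>' 1 * F \<nu> 1 < - dF \<nu> 1 * F \<nu>' (1::real)" by linarith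
  thus ?thesis using pos by (simp add: field_simps)
qed

text \<open>In 0 < F \<nu> = F (\<nu> + 1) - cf \<nu> x F (\<nu> + 2) the first term is at most F
  (\<nu> + 2). So F must vanish no later than at 1 / cf \<nu>, and large \<open>cf\<close> excludes
  \<open>good\<close>.\<close>

lemma good_imp_cf_less:
  assumes "-1 < \<nu>" "good \<nu> x" "0 \<le> x"
  shows "cf \<nu> * x < 1"
proof -
  have "cf \<nu> * x * F (\<nu> + 2) x < F (\<nu> + 2) x"
    using F_rec[OF assms(1), of x] F_le_Suc[OF assms, of 1] good_pos0[OF assms(2)] by (simp add: add_ac)
  thus ?thesis using good_pos[OF assms(2), of 2] by simp
qed

lemma ex_zero:
  assumes "-1 < \<nu>"
  shows "\<exists>x>0. F \<nu> x = (0::real)"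
proof (rule ccontr)
  assume no: "\<not> (\<exists>x>0. F \<nu> x = (0::real))"
  have "F \<nu> x \<noteq> 0" if "0 \<le> x" for x :: real
    using no that by (cases "x = 0") auto
  hence "0 < F \<nu> x" if "0 \<le> x" for x :: real
    using that assms by (intro F_pos_of_nz) auto
  hence "good \<nu> (1 / cf \<nu>)"
    using assms cf_pos[OF assms] by (intro good_of_pos[of _ "1 / cf \<nu>"]) auto
  thus False using good_imp_cf_less[OF assms, of "1 / cf \<nu>"] cf_pos[OF assms] by simp
qed

section \<open>Translation between \<open>F\<close>, \<open>h2\<close> and the first zero\<close>

lemma h2_eq:
  assumes "-1 < \<nu>"
  shows "h2 \<nu> q z = z * F \<nu> z"
proof -
  have "(\<lambda>n. of_real (h2_coeff \<nu> q n) * z ^ n) sums F \<nu> z"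
    unfolding F_def using summable_h2[OF q assms] by (rule summable_sums)
  from sums_mult[OF this, of z] have "(\<lambda>n. of_real (h2_coeff \<nu> q n) * z ^ (n + 1)) sums (z * F \<nu> z)"
    by (simp add: mult_ac)
  thus ?thesis using h2_series[OF q assms, of z] sums_unique2 by blast
qed

lemma jackson_zero_iff:
  assumes "-1 < \<nu>" "0 < x"
  shows "jackson_J2 \<nu> q (of_real x) = 0 \<longleftrightarrow> F \<nu> (x ^ 2) = (0::real)"
proof -
  have "qpoch_inf q q > 0" "qpoch_inf (q powr (\<nu> + 1)) q > 0"
    using q powr_bounds[OF assms(1)] by (auto intro!: qpoch_inf_pos)
  moreover have "csqrt (of_real (x ^ 2)) = of_real x"
    using assms by (subst of_real_sqrt[symmetric]) auto
  ultimately have "h2 \<nu> q (of_real (x ^ 2)) = 0 \<longleftrightarrow> jackson_J2 \<nu> q (of_real x) = 0"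
    using assms unfolding h2_def by (simp add: powr_def)
  moreover have "h2 \<nu> q (of_real (x ^ 2)) = of_real (x ^ 2) * of_real (F \<nu> (x ^ 2))"
    unfolding h2_eq[OF assms(1)] by (simp only: F_of_real[OF assms(1)])
  ultimately show ?thesis using assms by (simp flip: of_real_mult of_real_power)
qed

text \<open>\<open>LEAST\<close> over the reals is informative only once a minimum exists. It does:
  the zeros t of F (t^2) up to a known one form a compact set that does not contain 0. Squaring
  fixes the point 1.\<close>

lemma jackson_j1_eq_1_iff:
  assumes "-1 < \<nu>"
  shows "jackson_j1 \<nu> q = 1 \<longleftrightarrow> F \<nu> 1 = (0::real) \<and> (\<forall>x. 0 \<le> x \<and> x < 1 \<longrightarrow> 0 < F \<nu> (x::real))"
proof -
  define Z where "Z x \<longleftrightarrow> 0 < x \<and> jackson_J2 \<nu> q (of_real x) = 0" for x :: real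
  have Z: "Z x \<longleftrightarrow> 0 < x \<and> F \<nu> (x ^ 2) = (0::real)" for x
    unfolding Z_def using jackson_zero_iff[OF assms] by blast
  obtain a where a: "0 < a" "F \<nu> a = (0::real)" using ex_zero[OF assms] by blast
  let ?C = "{t\<in>{0..sqrt a}. F \<nu> (t ^ 2) = (0::real)}"
  have "compact ?C"
  proof (rule compact_Int_closed[of "{0..sqrt a}" "{t. F \<nu> (t ^ 2) = (0::real)}", unfolded Int_def mem_Collect_eq])
    show "closed {t. F \<nu> (t ^ 2) = (0::real)}"
      by (intro closed_Collect_eq continuous_on_const continuous_on_compose2[OF continuous_on_F[OF assms, of UNIV]]
            continuous_intros) auto
  qed auto
  moreover have "sqrt a \<in> ?C" using a by auto
  ultimately obtain m where m: "m \<in> ?C" "\<And>t. t \<in> ?C \<Longrightarrow> m \<le> t"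
    using compact_attains_inf[of ?C] by blast
  have "m \<noteq> 0" using m(1) by auto
  hence Zm: "Z m" unfolding Z using m(1) by auto
  have least: "m \<le> t" if "Z t" for t
  proof (cases "t \<le> sqrt a")
    case True
    thus ?thesis using that m(2)[of t] by (auto simp: Z)
  next
    case False
    thus ?thesis using m(1) by auto
  qed
  have j1: "jackson_j1 \<nu> q = m"
    unfolding jackson_j1_def Z_def[symmetric] by (rule Least_equality) (use Zm least in auto)
  show ?thesis
  proof
    assume "jackson_j1 \<nu> q = 1"
    hence "m = 1" using j1 by simp
    have "F \<nu> t \<noteq> 0" if "0 \<le> t" "t < 1" for t :: real
    proof
      assume "F \<nu> t = 0"
      moreover have "t \<noteq> 0" using \<open>F \<nu> t = 0\<close> by auto
      ultimately have "Z (sqrt t)" unfolding Z using that by auto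
      hence "1 \<le> sqrt t" using least[of "sqrt t"] \<open>m = 1\<close> by simp
      thus False using that by simp
    qed
    hence "\<forall>x. 0 \<le> x \<and> x < 1 \<longrightarrow> 0 < F \<nu> (x::real)"
      by (auto intro!: F_pos_of_nz assms)
    thus "F \<nu> 1 = (0::real) \<and> (\<forall>x. 0 \<le> x \<and> x < 1 \<longrightarrow> 0 < F \<nu> (x::real))"
      using Zm \<open>m = 1\<close> by (simp add: Z)
  next
    assume R: "F \<nu> 1 = (0::real) \<and> (\<forall>x. 0 \<le> x \<and> x < 1 \<longrightarrow> 0 < F \<nu> (x::real))"
    hence "m \<le> 1" using least[of 1] by (simp add: Z)
    moreover have "\<not> m < 1"
    proof
      assume "m < 1"
      hence "0 \<le> m ^ 2 \<and> m ^ 2 < 1" using Zm by (simp add: Z power_less_one_iff)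
      hence "0 < F \<nu> (m ^ 2)" using R by blast
      thus False using Zm unfolding Z by simp
    qed
    ultimately show "jackson_j1 \<nu> q = 1" using j1 by simp
  qed
qed

section \<open>Continuity in the order at the point 1\<close>

lemma continuous_on_coeff: "continuous_on {-1<..} (\<lambda>\<nu>. h2_coeff \<nu> q n)"
proof -
  have "qpoch (q powr (\<nu> + 1)) q n \<noteq> 0" if "-1 < \<nu>" for \<nu>
    using qpoch_pos'(1)[OF that, of n] by simp
  moreover have "continuous_on {-1<..} (\<lambda>\<nu>. qpoch (q powr (\<nu> + 1)) q n)"
    unfolding qpoch_def using q by (intro continuous_intros) auto
  ultimately show ?thesis
    unfolding h2_coeff_def using q qpoch_pos'(2)[of n] by (intro continuous_intros) auto
qed

lemma abs_coeff_le':
  assumes "-1 < a" "a \<le> \<nu>"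
  shows "\<bar>h2_coeff \<nu> q n\<bar> \<le> \<bar>h2_coeff a q n\<bar>"
proof -
  have "(q powr (\<nu> - a)) ^ n \<le> 1" using powr_diff_le_1[OF assms(2)] by (intro power_le_one) auto
  hence "(q powr (\<nu> - a)) ^ n * \<bar>h2_coeff a q n\<bar> \<le> 1 * \<bar>h2_coeff a q n\<bar>"
    by (intro mult_right_mono) auto
  thus ?thesis using abs_coeff_le[OF assms, of n] by simp
qed

lemma isCont_series:
  assumes "\<And>n. continuous_on {-1<..} (f n)"
    and "\<And>a \<nu> n. -1 < a \<Longrightarrow> a \<le> \<nu> \<Longrightarrow> \<bar>f n \<nu>\<bar> \<le> M a n" "\<And>a. -1 < a \<Longrightarrow> summable (M a)" and "-1 < \<nu>"
  shows "isCont (\<lambda>\<nu>::real. \<Sum>n. f n \<nu> :: real) \<nu>"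
proof -
  \<comment> \<open>The midpoint of -1 and \<open>\<nu>\<close>: the majorant of order
    \<open>a\<close> serves a whole neighbourhood of \<open>\<nu>\<close>.\<close>
  define a where "a = (\<nu> - 1) / 2"
  have a: "-1 < a" "a < \<nu>" using assms(4) by (auto simp: a_def)
  have "uniform_limit {a<..} (\<lambda>n \<nu>. \<Sum>i<n. f i \<nu>) (\<lambda>\<nu>. \<Sum>i. f i \<nu>) sequentially"
    using a assms(3)[OF a(1)] by (intro Weierstrass_m_test[where M = "M a"]) (auto intro!: assms(2))
  moreover have "continuous_on {a<..} (\<lambda>\<nu>. \<Sum>i<n. f i \<nu>)" for n
    using a by (intro continuous_on_sum continuous_on_subset[OF assms(1)]) auto
  ultimately have "continuous_on {a<..} (\<lambda>\<nu>. \<Sum>i. f i \<nu>)"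
    by (intro uniform_limit_theorem[where F = sequentially]) auto
  thus ?thesis using a by (simp add: continuous_on_eq_continuous_at)
qed

lemma isCont_F_order:
  assumes "-1 < \<nu>"
  shows "isCont (\<lambda>\<nu>. F \<nu> (1::real)) \<nu>" and "isCont (\<lambda>\<nu>. dF \<nu> (1::real)) \<nu>"
proof -
  have "isCont (\<lambda>\<nu>. \<Sum>n. h2_coeff \<nu> q n) \<nu>"
    by (rule isCont_series[where M = "\<lambda>a n. \<bar>h2_coeff a q n\<bar>"])
       (use assms continuous_on_coeff abs_coeff_le' summable_abs_coeff[where R = 1] in auto)
  thus "isCont (\<lambda>\<nu>. F \<nu> (1::real)) \<nu>" by (simp add: F_def)
  have "isCont (\<lambda>\<nu>. \<Sum>n. real (Suc n) * h2_coeff \<nu> q (Suc n)) \<nu>"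
  proof (rule isCont_series[where M = "\<lambda>a n. real (Suc n) * \<bar>h2_coeff a q (Suc n)\<bar>"])
    show "continuous_on {-1<..} (\<lambda>\<nu>. real (Suc n) * h2_coeff \<nu> q (Suc n))" for n
      by (intro continuous_on_mult continuous_on_const continuous_on_coeff)
    show "\<bar>real (Suc n) * h2_coeff \<nu> q (Suc n)\<bar> \<le> real (Suc n) * \<bar>h2_coeff a q (Suc n)\<bar>"
      if "-1 < a" "a \<le> \<nu>" for a \<nu> n
      using abs_coeff_le'[OF that, of "Suc n"] by (simp only: abs_mult abs_of_nat mult_left_mono of_nat_0_le_iff)
    show "summable (\<lambda>n. real (Suc n) * \<bar>h2_coeff a q (Suc n)\<bar>)" if "-1 < a" for a
      using summable_abs_dcoeff[OF that, of 1] by simp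
  qed (rule assms)
  thus "isCont (\<lambda>\<nu>. dF \<nu> (1::real)) \<nu>" by (simp add: dF_def del: of_nat_Suc)
qed

section \<open>The two thresholds\<close>

lemma cf_strict_mono: "-1 < \<nu> \<Longrightarrow> \<nu> < \<nu>' \<Longrightarrow> cf \<nu>' < cf \<nu>"
proof -
  assume \<nu>: "-1 < \<nu>" "\<nu> < \<nu>'"
  have "q powr (\<nu>' - \<nu>) < 1" using \<nu> q by (simp add: powr_def mult_less_0_iff)
  hence "q powr (\<nu>' - \<nu>) * cf \<nu> < 1 * cf \<nu>" using cf_pos[OF \<nu>(1)] by (intro mult_strict_right_mono) auto
  thus ?thesis using cf_le[of \<nu> \<nu>'] \<nu> by simp
qed

lemma ex_threshold:
  obtains \<nu>s where "-1 < \<nu>s" "F \<nu>s 1 = (0::real)" "\<And>\<nu>. -1 < \<nu> \<Longrightarrow> good \<nu> 1 \<longleftrightarrow> \<nu>s < \<nu>"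
proof -
  define S where "S = {\<nu>. -1 < \<nu> \<and> good \<nu> 1}"
  define \<nu>s where "\<nu>s = Inf S"
  obtain K where K: "\<And>k x. K \<le> k \<Longrightarrow> \<bar>x\<bar> \<le> 1 \<Longrightarrow> 1 / 2 < F (real k) x \<and> \<bar>dF (real k) x\<bar> < (1 / 2 :: real)"
    using F_pos_near_infinity[of 0 1] by auto
  have "good (real K) 1" unfolding good_def
  proof
    fix k
    show "0 < F (real K + real k) (1::real)"
      using K[of "K + k" 1] by simp
  qed
  hence "real K \<in> S" by (simp add: S_def)
  \<comment> \<open>Chosen with b = q^(a+1) = 4/5, so that b / (4 (1 - b)) = 1 and cf a >= 1. By
    \<open>good_imp_cf_less\<close> no order up to \<open>a\<close> is good, which keeps the infimum
    away from -1.\<close>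
  define a where "a = ln (4 / 5) / ln q - 1"
  have lnq: "ln q < 0" using q by simp
  have a: "-1 < a" using lnq by (simp add: a_def divide_neg_neg)
  have b: "q powr (a + 1) = 4 / 5" using q lnq by (simp add: a_def powr_def)
  have "0 < 1 - q powr (a + 2)" "1 - q powr (a + 2) \<le> 1" using powr_bounds[OF a] by auto
  moreover have "(4 / 5) / (4 * (1 - 4 / 5) * u) = 1 / u" for u :: real by simp
  hence "cf a = 1 / (1 - q powr (a + 2))" unfolding cf_def b .
  ultimately have ca: "1 \<le> cf a" by simp
  have Sa: "a \<le> \<nu>" if "\<nu> \<in> S" for \<nu>
  proof (rule ccontr)
    assume "\<not> a \<le> \<nu>"
    hence "cf a < cf \<nu>" using that by (intro cf_strict_mono) (auto simp: S_def)
    thus False using ca good_imp_cf_less[of \<nu> 1] that by (auto simp: S_def)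
  qed
  have bdd: "bdd_below S" using Sa by (auto simp: bdd_below_def)
  have \<nu>s: "-1 < \<nu>s" unfolding \<nu>s_def using a Sa \<open>real K \<in> S\<close> by (intro less_le_trans[OF a] cInf_greatest) auto
  have up: "good \<nu> 1" if "\<nu>s < \<nu>" for \<nu>
  proof -
    have "\<exists>\<mu>\<in>S. \<mu> < \<nu>"
      by (rule cInf_lessD) (use that \<open>real K \<in> S\<close> in \<open>auto simp: \<nu>s_def\<close>)
    then obtain \<mu> where "\<mu> \<in> S" "\<mu> < \<nu>" ..
    thus ?thesis using good_mono[of \<mu> 1 \<nu> 1] by (auto simp: S_def)
  qed
  have ge: "0 \<le> F \<nu>s (1::real)"
  proof (rule tendsto_lowerbound)
    show "((\<lambda>\<nu>. F \<nu> 1) \<longlongrightarrow> F \<nu>s (1::real)) (at_right \<nu>s)"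
      using isCont_F_order(1)[OF \<nu>s] unfolding isCont_def by (rule filterlim_at_split[THEN iffD1, THEN conjunct2])
    show "\<forall>\<^sub>F \<nu> in at_right \<nu>s. 0 \<le> F \<nu> (1::real)"
      by (rule eventually_mono[OF eventually_at_right_less]) (auto intro: less_imp_le good_pos0 up)
  qed simp
  have "\<not> 0 < F \<nu>s (1::real)"
  proof
    assume pos: "0 < F \<nu>s (1::real)"
    have g: "good \<nu>s 1" by (rule good_step[OF up pos]) simp
    have "\<forall>\<^sub>F \<nu> in at \<nu>s. 0 < F \<nu> (1::real)"
      using isCont_F_order(1)[OF \<nu>s] pos unfolding isCont_def by (intro order_tendstoD(1))
    then obtain d where d: "0 < d" "\<And>\<nu>. \<nu> \<noteq> \<nu>s \<Longrightarrow> \<bar>\<nu> - \<nu>s\<bar> < d \<Longrightarrow> 0 < F \<nu> (1::real)"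
      unfolding eventually_at dist_real_def by blast
    \<comment> \<open>With e < 1 the order \<open>\<nu>s - e + 1\<close> is above
      \<open>\<nu>s\<close>, hence good, and one step of the recursion makes
      \<open>\<nu>s - e\<close> good, against the infimum.\<close>
    define e where "e = min (d / 2) (min (1 / 2) ((\<nu>s + 1) / 2))"
    have e: "0 < e" "e < d" "e < 1" "e < \<nu>s + 1" using d(1) \<nu>s by (auto simp: e_def min_def)
    have "good (\<nu>s - e + 1) 1" using good_mono[OF \<nu>s g, of "\<nu>s - e + 1" 1] e by simp
    hence "good (\<nu>s - e) 1" using d(2)[of "\<nu>s - e"] e by (intro good_step[of "\<nu>s - e"]) auto
    hence "\<nu>s - e \<in> S" using e by (simp add: S_def)
    hence "\<nu>s \<le> \<nu>s - e" unfolding \<nu>s_def using bdd by (rule cInf_lower)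
    thus False using e by simp
  qed
  with ge have F0: "F \<nu>s 1 = (0::real)" by simp
  show ?thesis
  proof (rule that[OF \<nu>s F0])
    fix \<nu> :: real assume \<nu>: "-1 < \<nu>"
    have "\<nu>s < \<nu>" if "good \<nu> 1"
    proof -
      have "\<nu>s \<le> \<nu>" unfolding \<nu>s_def using that \<nu> by (intro cInf_lower bdd) (simp add: S_def)
      moreover have "\<nu> \<noteq> \<nu>s" using F0 good_pos0[OF that] by auto
      ultimately show ?thesis by simp
    qed
    thus "good \<nu> 1 \<longleftrightarrow> \<nu>s < \<nu>" using up by blast
  qed
qed

text \<open>Needed at the threshold itself, where \<open>good \<nu> 1\<close> fails. The quotient F
  (\<nu> + 1) / F (\<nu> + 2) at x is at least its value at 1, which is cf \<nu> as F \<nu> vanishes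
  there; for x < 1 the relation leaves a positive remainder.\<close>

lemma F_pos_of_F_1_zero:
  assumes "-1 < \<nu>" "F \<nu> 1 = (0::real)" "good (\<nu> + 1) 1" "0 \<le> x" "x < 1"
  shows "0 < F \<nu> (x::real)"
proof -
  have g: "good (\<nu> + 1) x" using good_mono[OF _ assms(3), of "\<nu> + 1" x] assms by simp
  have pos: "0 < F (\<nu> + 1) (1::real)" "0 < F (\<nu> + 2) (1::real)" "0 < F (\<nu> + 2) x"
    using good_pos[OF assms(3), of 0] good_pos[OF assms(3), of 1] good_pos[OF g, of 1] by (auto simp: add_ac)
  have "F (\<nu> + 1) 1 * F (\<nu> + 2) x \<le> F (\<nu> + 1) x * F (\<nu> + 2) (1::real)"
    using F_ratio_comparison_real[OF _ assms(3), of "\<nu> + 1" x] assms by (simp add: add_ac)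
  moreover have "F (\<nu> + 1) 1 = cf \<nu> * F (\<nu> + 2) (1::real)" using F_rec[OF assms(1), of "1::real"] assms(2) by simp
  ultimately have "(cf \<nu> * F (\<nu> + 2) x) * F (\<nu> + 2) 1 \<le> F (\<nu> + 1) x * F (\<nu> + 2) (1::real)"
    by (simp add: mult_ac)
  hence "cf \<nu> * F (\<nu> + 2) x \<le> F (\<nu> + 1) x" using pos(2) by (simp only: mult_le_cancel_right_pos)
  moreover have "x * (cf \<nu> * F (\<nu> + 2) x) < 1 * (cf \<nu> * F (\<nu> + 2) x)"
    using pos cf_pos[OF assms(1)] assms by (intro mult_strict_right_mono mult_pos_pos) auto
  ultimately show ?thesis using F_rec[OF assms(1), of x] by (simp add: mult_ac)
qed

lemma jackson_j1_unique:
  assumes "-1 < \<nu>s" "F \<nu>s 1 = (0::real)" "\<And>\<nu>. -1 < \<nu> \<Longrightarrow> good \<nu> 1 \<longleftrightarrow> \<nu>s < \<nu>"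
  shows "jackson_j1 \<nu>s q = 1" and "-1 < \<nu> \<Longrightarrow> jackson_j1 \<nu> q = 1 \<Longrightarrow> \<nu> = \<nu>s"
proof -
  have gs: "good (\<nu>s + 1) 1" using assms(3)[of "\<nu>s + 1"] assms(1) by simp
  show "jackson_j1 \<nu>s q = 1"
    using jackson_j1_eq_1_iff[OF assms(1)] F_pos_of_F_1_zero[OF assms(1,2) gs] assms(2) by blast
  show "\<nu> = \<nu>s" if \<nu>: "-1 < \<nu>" and j: "jackson_j1 \<nu> q = 1"
  proof -
    have F: "F \<nu> 1 = (0::real)" "\<And>x. 0 \<le> x \<Longrightarrow> x < 1 \<Longrightarrow> 0 < F \<nu> (x::real)"
      using j jackson_j1_eq_1_iff[OF \<nu>] by auto
    have "\<not> \<nu>s < \<nu>" using assms(3)[OF \<nu>] good_pos0[of \<nu> 1] F(1) by auto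
    moreover have "\<not> \<nu> < \<nu>s"
    proof
      assume less: "\<nu> < \<nu>s"
      have rec: "F (\<nu> + real k) 1 = F (\<nu> + real (Suc k)) 1
          - cf (\<nu> + real k) * F (\<nu> + real (Suc (Suc k))) (1::real)" for k
        using F_rec[of "\<nu> + real k" "1::real"] \<nu> by (simp add: add_ac)
      \<comment> \<open>Two neighbouring orders vanishing at 1 would make all higher orders vanish
        there, although these tend to 1.\<close>
      have "F (\<nu> + 1) 1 \<noteq> (0::real)"
      proof
        assume 0: "F (\<nu> + 1) 1 = (0::real)"
        have z: "F (\<nu> + real k) 1 = (0::real) \<and> F (\<nu> + real (Suc k)) 1 = (0::real)" for k
        proof (induction k)
          case (Suc k)
          thus ?case using rec[of k] cf_pos[of "\<nu> + real k"] \<nu> by auto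
        qed (use F(1) 0 in auto)
        obtain K where "\<And>k x. K \<le> k \<Longrightarrow> \<bar>x\<bar> \<le> 1 \<Longrightarrow> 1 / 2 < F (\<nu> + real k) x \<and> \<bar>dF (\<nu> + real k) x\<bar> < (1 / 2 :: real)"
          using F_pos_near_infinity[OF \<nu>, of 1] by auto
        from this[of K 1] show False using z[of K] by simp
      qed
      have gx: "good (\<nu> + 1) x" if "0 \<le> x" "x < 1" for x
        by (rule good_Suc, rule good_of_pos[of _ x]) (use F that \<nu> in auto)
      have "F (\<nu> + 1) t \<noteq> (0::real)" if "0 \<le> t" "t \<le> 1" for t
        using \<open>F (\<nu> + 1) 1 \<noteq> 0\<close> good_pos0[OF gx[of t]] that by (cases "t = 1") auto
      hence "0 < F (\<nu> + 1) x" if "0 \<le> x" "x \<le> 1" for x :: real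
        using that \<nu> by (intro F_pos_of_nz) auto
      hence g1: "good (\<nu> + 1) 1" using \<nu> by (intro good_of_pos[of _ 1]) auto
      have pos: "0 < F (\<nu> + 2) (1::real)" "0 < F (\<nu>s + 2) (1::real)"
        using good_pos[OF g1, of 1] good_pos[OF gs, of 1] by (auto simp: add_ac)
      \<comment> \<open>At an order where F vanishes at 1, the quotient of the next two orders at 1
        equals \<open>cf\<close>. That quotient does not decrease with the order while
        \<open>cf\<close> strictly decreases, so there cannot be two such orders.\<close>
      have "F (\<nu> + 1) 1 * F (\<nu>s + 2) 1 \<le> F (\<nu>s + 1) 1 * F (\<nu> + 2) (1::real)"
        using F_ratio_comparison_real[OF _ g1, of "\<nu>s + 1" 1] less \<nu> by (simp add: add_ac)
      moreover have "F (\<nu> + 1) 1 = cf \<nu> * F (\<nu> + 2) (1::real)"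
        using F_rec[OF \<nu>, of "1::real"] F(1) by simp
      moreover have "F (\<nu>s + 1) 1 = cf \<nu>s * F (\<nu>s + 2) (1::real)"
        using F_rec[OF assms(1), of "1::real"] assms(2) by simp
      ultimately have "cf \<nu> * (F (\<nu> + 2) 1 * F (\<nu>s + 2) 1) \<le> cf \<nu>s * (F (\<nu> + 2) 1 * F (\<nu>s + 2) (1::real))"
        by (simp add: mult_ac)
      hence "cf \<nu> \<le> cf \<nu>s" using pos by (simp only: mult_le_cancel_right_pos mult_pos_pos)
      thus False using cf_strict_mono[OF \<nu> less] by simp
    qed
    ultimately show ?thesis by simp
  qed
qed

text \<open>\<open>F \<nu> 1 + dF \<nu> 1\<close> is the value at 1 of the derivative of \<open>z * F \<nu> z\<close>.\<close>

lemma ex_threshold_deriv: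
  assumes "-1 < \<nu>s" "F \<nu>s 1 = (0::real)" "\<And>\<nu>. -1 < \<nu> \<Longrightarrow> good \<nu> 1 \<longleftrightarrow> \<nu>s < \<nu>"
  obtains \<nu>0 where "\<nu>s < \<nu>0" "F \<nu>0 1 + dF \<nu>0 1 = (0::real)"
    "\<And>\<nu>. \<nu>s \<le> \<nu> \<Longrightarrow> F \<nu> 1 + dF \<nu> 1 = (0::real) \<Longrightarrow> \<nu> = \<nu>0"
    "\<And>\<nu>. \<nu>s < \<nu> \<Longrightarrow> 0 \<le> F \<nu> 1 + dF \<nu> (1::real) \<longleftrightarrow> \<nu>0 \<le> \<nu>"
proof -
  define g where "g \<nu> = F \<nu> 1 + dF \<nu> (1::real)" for \<nu>
  have gs: "good (\<nu>s + 1) 1" using assms(3)[of "\<nu>s + 1"] assms(1) by simp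
  have pos: "0 < F (\<nu>s + 1) (1::real)" "0 < F (\<nu>s + 2) (1::real)"
    using good_pos[OF gs, of 0] good_pos[OF gs, of 1] by (auto simp: add_ac)
  have neg: "g \<nu>s < 0"
  proof -
    have a: "F (\<nu>s + 1) 1 = cf \<nu>s * F (\<nu>s + 2) (1::real)"
      using F_rec[OF assms(1), of "1::real"] assms(2) by simp
    have "\<bar>dF (\<nu>s + 2) 1\<bar> * F (\<nu>s + 1) 1 \<le> q powr 1 * (- dF (\<nu>s + 1) 1) * F (\<nu>s + 2) (1::real)"
      using dF_comparison_real[OF _ gs, of "\<nu>s + 2" 1] assms(1) by simp
    also have "\<dots> \<le> (- dF (\<nu>s + 1) 1) * F (\<nu>s + 2) (1::real)"
      using dF_neg[OF _ gs] assms(1) q pos mult_right_mono[of q 1 "- dF (\<nu>s + 1) 1"]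
      by (intro mult_right_mono) auto
    finally have "(cf \<nu>s * \<bar>dF (\<nu>s + 2) 1\<bar>) * F (\<nu>s + 2) 1 \<le> (- dF (\<nu>s + 1) 1) * F (\<nu>s + 2) (1::real)"
      unfolding a by (simp add: mult_ac)
    hence "cf \<nu>s * \<bar>dF (\<nu>s + 2) 1\<bar> \<le> - dF (\<nu>s + 1) (1::real)"
      using pos(2) by (simp only: mult_le_cancel_right_pos)
    moreover have "cf \<nu>s * (- dF (\<nu>s + 2) 1) \<le> cf \<nu>s * \<bar>dF (\<nu>s + 2) (1::real)\<bar>"
      using cf_pos[OF assms(1)] by (intro mult_left_mono) auto
    ultimately have "dF \<nu>s 1 \<le> - F (\<nu>s + 1) (1::real)"
      using dF_rec[OF assms(1), of "1::real"] a by (simp add: algebra_simps)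
    thus ?thesis using pos assms(2) by (simp add: g_def)
  qed
  obtain K where K: "\<And>k x. K \<le> k \<Longrightarrow> \<bar>x\<bar> \<le> 1 \<Longrightarrow> 1 / 2 < F (real k) x \<and> \<bar>dF (real k) x\<bar> < (1 / 2 :: real)"
    using F_pos_near_infinity[of 0 1] by auto
  obtain k where k: "\<nu>s \<le> real k" "K \<le> k"
    by (metis max.cobounded1 max.cobounded2 of_nat_le_iff order_trans real_arch_simple)
  have "0 < g (real k)" using K[OF k(2), of 1] by (auto simp: g_def abs_less_iff)
  moreover have "isCont g \<nu>" if "-1 < \<nu>" for \<nu>
    unfolding g_def by (intro continuous_intros isCont_F_order that)
  ultimately have "\<exists>\<nu>\<ge>\<nu>s. \<nu> \<le> real k \<and> g \<nu> = 0"
    using neg k assms(1) by (intro IVT) auto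
  then obtain \<nu>0 where \<nu>0: "\<nu>s \<le> \<nu>0" "g \<nu>0 = 0" by blast
  have less: "\<nu>s < \<nu>0" using \<nu>0 neg by (cases "\<nu>s = \<nu>0") auto
  have g: "good \<nu> 1" "-1 < \<nu>" if "\<nu>s < \<nu>" for \<nu> using assms(3)[of \<nu>] assms(1) that by auto
  \<comment> \<open>Above \<open>\<nu>s\<close> the sign of g is that of 1 - (-F'/F), and -F'/F
    strictly decreases in the order; so g changes sign exactly once.\<close>
  have eq: "g \<nu> = F \<nu> 1 * (1 - (- dF \<nu> 1 / F \<nu> (1::real)))" if "\<nu>s < \<nu>" for \<nu>
    using good_pos0[OF g(1)[OF that]] by (simp add: g_def field_simps)
  have w0: "- dF \<nu>0 1 / F \<nu>0 (1::real) = 1" using eq[OF less] \<nu>0(2) good_pos0[OF g(1)[OF less]] by simp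
  have gt: "0 < g \<nu>" if "\<nu>0 < \<nu>" for \<nu>
  proof -
    have \<nu>: "\<nu>s < \<nu>" using that less by simp
    show ?thesis
      unfolding eq[OF \<nu>]
      using log_deriv_strict_mono[OF g(2)[OF less] g(1)[OF less] that] w0 good_pos0[OF g(1)[OF \<nu>]]
      by (intro mult_pos_pos) auto
  qed
  have lt: "g \<nu> < 0" if "\<nu>s < \<nu>" "\<nu> < \<nu>0" for \<nu>
    unfolding eq[OF that(1)]
    using log_deriv_strict_mono[OF g(2)[OF that(1)] g(1)[OF that(1)] that(2)] w0 good_pos0[OF g(1)[OF that(1)]]
    by (intro mult_pos_neg) auto
  show ?thesis
  proof (rule that[OF less])
    show "F \<nu>0 1 + dF \<nu>0 1 = (0::real)" using \<nu>0(2) by (simp add: g_def)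
    fix \<nu>
    show "\<nu> = \<nu>0" if "\<nu>s \<le> \<nu>" "F \<nu> 1 + dF \<nu> 1 = (0::real)"
      using that gt[of \<nu>] lt[of \<nu>] neg unfolding g_def by (metis less_irrefl linorder_neqE_linordered_idom order_le_less)
    show "0 \<le> F \<nu> 1 + dF \<nu> (1::real) \<longleftrightarrow> \<nu>0 \<le> \<nu>" if "\<nu>s < \<nu>"
      using that gt[of \<nu>] lt[of \<nu>] \<nu>0(2) unfolding g_def[symmetric]
      by (metis less_irrefl linorder_neqE_linordered_idom not_le order_le_less)
  qed
qed

section \<open>Starlikeness\<close>

lemma holomorphic_F: "-1 < \<nu> \<Longrightarrow> F \<nu> holomorphic_on S"
  by (meson has_field_derivative_F field_differentiable_def field_differentiable_at_within holomorphic_on_def)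

lemma h2_eq': "-1 < \<nu> \<Longrightarrow> h2 \<nu> q = (\<lambda>z. z * F \<nu> z)"
  by (rule ext) (rule h2_eq)

lemma deriv_h2:
  assumes "-1 < \<nu>"
  shows "deriv (h2 \<nu> q) z = F \<nu> z + z * dF \<nu> z"
  unfolding h2_eq'[OF assms]
  by (rule DERIV_imp_deriv) (auto intro!: derivative_eq_intros has_field_derivative_F assms)

lemma deriv_h2_1_eq_0_iff:
  assumes "-1 < \<nu>"
  shows "deriv (h2 \<nu> q) 1 = 0 \<longleftrightarrow> F \<nu> 1 + dF \<nu> 1 = (0::real)"
proof -
  have "deriv (h2 \<nu> q) 1 = of_real (F \<nu> 1 + dF \<nu> 1)"
    using F_of_real[OF assms, of 1, where 'a = complex] dF_of_real[OF assms, of 1, where 'a = complex]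
    by (simp add: deriv_h2[OF assms])
  thus ?thesis by (simp only: of_real_eq_0_iff)
qed

lemma isCont_dF_real:
  assumes "-1 < \<nu>"
  shows "isCont (dF \<nu> :: real \<Rightarrow> real) x"
  unfolding dF_def[abs_def] using summable_dcoeff[OF assms, where 'a = real]
  by (intro isCont_powser_converges_everywhere) simp

lemma F_nz:
  assumes "-1 < \<nu>" "good \<nu> 1" "norm (z::complex) \<le> 1"
  shows "F \<nu> z \<noteq> 0"
  using F_comparison[OF assms(1,2) order_refl assms(3)] good_pos0[OF assms(2)] by auto

text \<open>Nonnegativity of h'(1) says that -F'/F is at most 1 at 1, and this value dominates
  |F'/F| on the closed disc.\<close>

lemma dF_le_F:
  assumes "-1 < \<nu>" "good \<nu> 1" "0 \<le> F \<nu> 1 + dF \<nu> (1::real)" "norm (z::complex) \<le> 1"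
  shows "norm (dF \<nu> z) \<le> norm (F \<nu> z)"
proof -
  have "norm (dF \<nu> z) * F \<nu> 1 \<le> (- dF \<nu> 1) * norm (F \<nu> z)"
    using dF_comparison[OF assms(1,2) order_refl assms(4)] q by simp
  also have "\<dots> \<le> F \<nu> 1 * norm (F \<nu> z)"
    using assms(3) by (intro mult_right_mono) auto
  finally show ?thesis using good_pos0[OF assms(2)] by (simp add: mult.commute)
qed

lemma inj_on_h2:
  assumes "-1 < \<nu>" "good \<nu> 1" "0 \<le> F \<nu> 1 + dF \<nu> (1::real)"
  shows "inj_on (h2 \<nu> q) (ball 0 1)"
proof (rule inj_onI)
  fix z1 z2 :: complex
  assume z: "z1 \<in> ball 0 1" "z2 \<in> ball 0 1" and eq: "h2 \<nu> q z1 = h2 \<nu> q z2"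
  have nz: "F \<nu> z \<noteq> 0" if "z \<in> ball 0 1" for z :: complex
    using F_nz[OF assms(1,2), of z] that by auto
  have eq: "z1 * F \<nu> z1 = z2 * F \<nu> z2" using eq by (simp add: h2_eq[OF assms(1)])
  show "z1 = z2"
  proof (cases "z1 = 0 \<or> z2 = 0")
    case True
    thus ?thesis using eq nz z by auto
  next
    case False
    \<comment> \<open>With z = e^w and F = e^g, h becomes the exponential of w + g(e^w), and g(e^w) is a contraction.\<close>
    obtain g where g: "g holomorphic_on ball 0 1" "\<And>z. z \<in> ball 0 1 \<Longrightarrow> F \<nu> z = exp (g z)"
      using holomorphic_logarithm_exists[OF convex_ball open_ball holomorphic_F[OF assms(1)] nz centre_in_ball[THEN iffD2, OF zero_less_one]]
      by metis
    have g': "(g has_field_derivative dF \<nu> z / F \<nu> z) (at z)" if z: "z \<in> ball 0 1" for z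
    proof -
      have gd: "(g has_field_derivative deriv g z) (at z)"
        using g(1) z by (intro holomorphic_derivI) auto
      hence "((\<lambda>z. exp (g z)) has_field_derivative deriv g z * exp (g z)) (at z)"
        by (auto intro!: derivative_eq_intros)
      hence "(F \<nu> has_field_derivative deriv g z * exp (g z)) (at z)"
        by (rule has_field_derivative_transform_within_open[OF _ open_ball z]) (simp add: g(2))
      hence "deriv g z * F \<nu> z = dF \<nu> z"
        using DERIV_unique has_field_derivative_F[OF assms(1)] g(2)[OF z] by metis
      hence "dF \<nu> z / F \<nu> z = deriv g z" using nz[OF z] by (simp add: field_simps)
      thus ?thesis using gd by simp
    qed
    have "exp (Ln z1 + g z1) = exp (Ln z2 + g z2)"
      using eq False g(2) z by (simp add: exp_add)
    then obtain n :: int where n: "Ln z1 + g z1 = Ln z2 + g z2 + of_int (2 * n) * (of_real pi * \<i>)"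
      unfolding exp_eq by (auto simp: mult_ac)
    define w1 where "w1 = Ln z1"
    \<comment> \<open>The multiple of 2 pi i is the one for which w + g (exp w) takes equal values
      at \<open>w1\<close> and \<open>w2\<close>, not merely equal exponentials.\<close>
    define w2 where "w2 = Ln z2 + of_int (2 * n) * (of_real pi * \<i>)"
    have ew: "exp w1 = z1" "exp w2 = z2"
      using False exp_eq[of w2 "Ln z2"] by (auto simp: w1_def w2_def mult_ac)
    define r where "r = max (norm z1) (norm z2)"
    have r: "0 < r" "r < 1" using z False by (auto simp: r_def less_max_iff_disj)
    let ?S = "{w::complex. Re w \<le> ln r}"
    have inS: "w1 \<in> ?S" "w2 \<in> ?S"
      using False r(1) by (auto simp: w1_def w2_def r_def intro!: ln_mono)
    have exp_r: "norm (exp w) \<le> r" if "w \<in> ?S" for w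
      using that r ln_ge_iff[of r "Re w"] by (simp add: norm_exp)
    \<comment> \<open>Mean value inequality on the convex half-plane Re w <= ln r: there |exp w| <=
      r, so the derivative exp w * F'/F has modulus at most r < 1.\<close>
    have "norm (g (exp w1) - g (exp w2)) \<le> r * norm (w1 - w2)"
    proof (rule field_differentiable_bound[of ?S])
      show "convex ?S" by (simp add: convex_halfspace_Re_le)
      fix w assume w: "w \<in> ?S"
      have wb: "exp w \<in> ball 0 1" using exp_r[OF w] r(2) by (simp only: mem_ball dist_0_norm)
      show "((\<lambda>w. g (exp w)) has_field_derivative (dF \<nu> (exp w) / F \<nu> (exp w)) * exp w) (at w within ?S)"
        by (rule has_field_derivative_at_within, rule DERIV_chain'[OF DERIV_exp g'[OF wb]])
      have "norm (dF \<nu> (exp w) / F \<nu> (exp w)) \<le> 1"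
        using dF_le_F[OF assms, of "exp w"] wb by (simp add: norm_divide divide_le_eq_1)
      hence "norm (dF \<nu> (exp w) / F \<nu> (exp w)) * norm (exp w) \<le> 1 * r"
        using exp_r[OF w] by (intro mult_mono) auto
      thus "norm ((dF \<nu> (exp w) / F \<nu> (exp w)) * exp w) \<le> r" by (simp only: norm_mult mult_1)
    qed (use inS in auto)
    moreover have "g (exp w1) - g (exp w2) = - (w1 - w2)"
      unfolding ew using n by (simp add: w1_def w2_def algebra_simps)
    ultimately have "norm (w1 - w2) \<le> r * norm (w1 - w2)" by (simp only: norm_minus_cancel)
    hence "norm (w1 - w2) = 0"
      using r mult_less_cancel_right2[of r "norm (w1 - w2)"] by fastforce
    thus ?thesis using ew by simp
  qed
qed

lemma starlike_h2:
  assumes "-1 < \<nu>" "good \<nu> 1" "0 \<le> F \<nu> 1 + dF \<nu> (1::real)"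
  shows "starlike_in_disc (h2 \<nu> q)"
  unfolding starlike_in_disc_def
proof (intro conjI ballI)
  show "h2 \<nu> q holomorphic_on ball 0 1"
    unfolding h2_eq'[OF assms(1)] by (intro holomorphic_intros holomorphic_F assms)
  show "h2 \<nu> q 0 = 0" "deriv (h2 \<nu> q) 0 = 1"
    using assms(1) by (auto simp: deriv_h2 h2_eq)
  show "inj_on (h2 \<nu> q) (ball 0 1)" by (rule inj_on_h2[OF assms])
  fix z :: complex assume z: "z \<in> ball 0 1 - {0}"
  have nz: "F \<nu> z \<noteq> 0" using F_nz[OF assms(1,2)] z by auto
  have "norm (z * dF \<nu> z / F \<nu> z) \<le> norm z"
    using dF_le_F[OF assms, of z] z nz by (simp add: norm_mult norm_divide field_simps mult_left_mono)
  hence "norm (z * dF \<nu> z / F \<nu> z) < 1" using z by auto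
  hence "0 < Re (1 + z * dF \<nu> z / F \<nu> z)"
    using abs_Re_le_cmod[of "z * dF \<nu> z / F \<nu> z"] by simp
  also have "1 + z * dF \<nu> z / F \<nu> z = z * deriv (h2 \<nu> q) z / h2 \<nu> q z"
    using z nz by (simp add: deriv_h2[OF assms(1)] h2_eq[OF assms(1)] field_simps)
  finally show "0 < Re (z * deriv (h2 \<nu> q) z / h2 \<nu> q z)" .
qed

text \<open>On the positive radius the starlikeness quotient is the real number (F + x F') / F. Its
  positivity excludes zeros of F on [0, 1) and makes x F(x) increasing, which carries positivity of
  F over to the end point 1.\<close>

lemma starlike_h2D:
  assumes "-1 < \<nu>" "starlike_in_disc (h2 \<nu> q)"
  shows "good \<nu> 1" "0 \<le> F \<nu> 1 + dF \<nu> (1::real)"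
proof -
  have quot: "0 < (F \<nu> x + x * dF \<nu> x) / F \<nu> x" if x: "0 < x" "x < 1" for x :: real
  proof -
    have "of_real x * deriv (h2 \<nu> q) (of_real x) / h2 \<nu> q (of_real x) =
        complex_of_real (x * (F \<nu> x + x * dF \<nu> x) / (x * F \<nu> x))"
      by (simp add: deriv_h2[OF assms(1)] h2_eq[OF assms(1)] F_of_real[OF assms(1)] dF_of_real[OF assms(1)])
    moreover have "0 < Re (of_real x * deriv (h2 \<nu> q) (of_real x) / h2 \<nu> q (of_real x))"
      using assms(2) x unfolding starlike_in_disc_def by auto
    ultimately have "0 < x * (F \<nu> x + x * dF \<nu> x) / (x * F \<nu> x)" by (simp only: Re_complex_of_real)
    thus ?thesis using x by (simp only: mult_divide_mult_cancel_left)
  qed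
  \<comment> \<open>At a zero of F the quotient would be 0, as division by zero yields 0, against
    its strict positivity.\<close>
  have nz: "F \<nu> x \<noteq> 0" if "0 \<le> x" "x < 1" for x :: real
    using quot[of x] that by (cases "x = 0") auto
  have pos: "0 < F \<nu> x" if "0 \<le> x" "x < 1" for x :: real
    using that nz by (intro F_pos_of_nz assms(1)) auto
  have d: "0 < F \<nu> x + x * dF \<nu> x" if "0 < x" "x < 1" for x :: real
    using quot[of x] pos[of x] that by (simp add: zero_less_divide_iff)
  have contF: "isCont (F \<nu> :: real \<Rightarrow> real) x" for x
    using has_field_derivative_F[OF assms(1)] DERIV_isCont by blast
  show g1: "0 \<le> F \<nu> 1 + dF \<nu> (1::real)"
  proof (rule tendsto_lowerbound)
    have "isCont (\<lambda>x. F \<nu> x + x * dF \<nu> x) (1::real)"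
      by (intro continuous_intros contF isCont_dF_real assms(1))
    hence "(\<lambda>x. F \<nu> x + x * dF \<nu> x) \<midarrow>1\<rightarrow> F \<nu> 1 + dF \<nu> (1::real)"
      unfolding isCont_def by simp
    thus "((\<lambda>x. F \<nu> x + x * dF \<nu> x) \<longlongrightarrow> F \<nu> 1 + dF \<nu> (1::real)) (at_left 1)"
      by (rule filterlim_at_split[THEN iffD1, THEN conjunct1])
    show "\<forall>\<^sub>F x in at_left 1. 0 \<le> F \<nu> x + x * dF \<nu> (x::real)"
      using eventually_at_left_real[of 0 "1::real"]
      by (auto elim!: eventually_mono intro!: less_imp_le d)
  qed simp
  have "(1 / 2) * F \<nu> (1 / 2) \<le> 1 * F \<nu> (1::real)"
  proof (rule DERIV_nonneg_imp_nondecreasing[of "1 / 2" 1])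
    fix x :: real assume "1 / 2 \<le> x" "x \<le> 1"
    moreover have "((\<lambda>x. x * F \<nu> x) has_field_derivative F \<nu> x + x * dF \<nu> x) (at x)"
      by (auto intro!: derivative_eq_intros has_field_derivative_F assms(1))
    ultimately show "\<exists>y. ((\<lambda>x. x * F \<nu> x) has_field_derivative y) (at x) \<and> 0 \<le> y"
      using d[of x] g1 by (cases "x = 1") (auto intro!: exI[of _ "F \<nu> x + x * dF \<nu> x"])
  qed simp
  hence "0 < F \<nu> (1::real)" using pos[of "1 / 2"] by simp
  hence "0 < F \<nu> x" if "0 \<le> x" "x \<le> 1" for x :: real
    using pos[of x] that by (cases "x = 1") auto
  thus "good \<nu> 1" using assms(1) by (intro good_of_pos[of _ 1]) auto
qed

section \<open>Close-to-convexity of the derivatives\<close>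

definition hpoly :: "real \<Rightarrow> nat \<Rightarrow> complex poly" where
  "hpoly \<nu> n = pCons 0 (sden_poly (\<lambda>j. cf (\<nu> + real j)) n 0)"

lemma roots_ge_hpoly:
  assumes "-1 < \<nu>"
  shows "roots_ge 0 (hpoly \<nu> n)"
  unfolding roots_ge_def
proof (intro allI impI)
  fix z assume 0: "poly (hpoly \<nu> n) z = 0"
  show "\<exists>x\<ge>0. z = of_real x"
  proof (rule ccontr)
    assume z: "\<not> ?thesis"
    hence "sden (\<lambda>j. cf (\<nu> + real j)) n 0 z \<noteq> 0"
      using assms by (intro sden_nz cf_pos) auto
    moreover have "z \<noteq> 0" using z by force
    ultimately show False using 0 by (simp add: hpoly_def poly_sden_poly)
  qed
qed

lemma higher_pderiv_hpoly_tendsto: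
  assumes "-1 < \<nu>"
  shows "(\<lambda>n. poly ((pderiv ^^ m) (hpoly \<nu> n)) z) \<longlonglongrightarrow> (deriv ^^ m) (h2 \<nu> q) z"
proof -
  let ?c = "\<lambda>j. cf (\<nu> + real j)"
  define R where "R = norm z + 1"
  have b1: "bounded ((\<lambda>w::complex. w) ` cball 0 R)" by simp
  have b2: "bounded ((F (\<nu> + real 0) :: complex \<Rightarrow> complex) ` cball 0 R)"
    using assms by (intro compact_imp_bounded compact_continuous_image continuous_on_F) auto
  have "uniform_limit (cball 0 R) (\<lambda>n w::complex. w * sden ?c n 0 w) (\<lambda>w. w * F (\<nu> + real 0) w) sequentially"
    by (rule uniform_lim_mult[OF uniform_limit_const sden_uniform_limit[OF assms] b1 b2])
  moreover have "(\<lambda>n w. w * sden ?c n 0 w) = (\<lambda>n. poly (hpoly \<nu> n))"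
    by (simp add: fun_eq_iff hpoly_def poly_sden_poly)
  moreover have "(\<lambda>w. w * F (\<nu> + real 0) w) = h2 \<nu> q"
    by (simp add: h2_eq'[OF assms])
  ultimately have "uniform_limit (cball 0 R) (\<lambda>n. poly (hpoly \<nu> n)) (h2 \<nu> q) sequentially"
    by simp
  hence "uniform_limit (ball 0 R) (\<lambda>n. poly (hpoly \<nu> n)) (h2 \<nu> q) sequentially"
    by (rule uniform_limit_on_subset) auto
  hence "(\<lambda>n. (deriv ^^ m) (poly (hpoly \<nu> n)) z) \<longlonglongrightarrow> (deriv ^^ m) (h2 \<nu> q) z"
    by (rule higher_deriv_complex_uniform_limit) (auto simp: R_def intro!: always_eventually holomorphic_intros)
  thus ?thesis by (simp add: higher_deriv_poly)
qed

lemma higher_deriv_h2_0: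
  assumes "-1 < \<nu>"
  shows "(deriv ^^ Suc k) (h2 \<nu> q) 0 = of_real (fact (Suc k) * h2_coeff \<nu> q k)"
proof -
  define a where "a n = (case n of 0 \<Rightarrow> 0 | Suc n \<Rightarrow> complex_of_real (h2_coeff \<nu> q n))" for n
  have "(\<lambda>n. a n * z ^ n) sums h2 \<nu> q z" for z
    using h2_series[OF q assms, of z] sums_Suc_iff[of "\<lambda>n. a n * z ^ n" "h2 \<nu> q z"]
    by (simp add: a_def)
  hence "h2 \<nu> q has_fps_expansion Abs_fps a"
    by (intro has_fps_expansionI always_eventually allI) simp
  from fps_nth_fps_expansion[OF this, of "Suc k"] show ?thesis
    by (simp add: a_def field_simps del: fact_Suc)
qed

text \<open>(k + 2) * rho \<nu> k is minus the logarithmic derivative at 0 of the derivative of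
  order k + 1 of \<open>h2\<close>, hence the limit of the sums of reciprocal zeros of the
  corresponding polynomials.\<close>

definition rho :: "real \<Rightarrow> nat \<Rightarrow> real" where
  "rho \<nu> k = - h2_coeff \<nu> q (Suc k) / h2_coeff \<nu> q k"

lemma rho_eq:
  assumes "-1 < \<nu>"
  shows "rho \<nu> k = q powr (\<nu> + 1) * q ^ (2 * k) / (4 * (1 - q ^ Suc k) * (1 - q powr (\<nu> + 1) * q ^ k))"
proof -
  have "q powr (2 * real k + 1 + \<nu>) = q powr ((\<nu> + 1) + real (2 * k))" by (simp add: add_ac)
  also have "\<dots> = q powr (\<nu> + 1) * q ^ (2 * k)"
    using q by (simp only: powr_add powr_realpow)
  finally show ?thesis
    using coeff_nz[OF assms, of k] by (simp add: rho_def h2_coeff_Suc[OF q(1)])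
qed

text \<open>The threshold condition gives -F'/F <= 1 at 1, hence also at 0, where it is the modulus
  of the first coefficient. In this form the thresholds enter all estimates for the higher
  derivatives.\<close>

lemma param_bound:
  assumes "-1 < \<nu>" "good \<nu> 1" "0 \<le> F \<nu> 1 + dF \<nu> (1::real)"
  shows "q powr (\<nu> + 1) \<le> 4 * (1 - q) * (1 - q powr (\<nu> + 1))"
proof -
  have F: "0 < F \<nu> (1::real)" by (rule good_pos0[OF assms(2)])
  have "\<bar>h2_coeff \<nu> q 1\<bar> * F \<nu> 1 \<le> 1 * F \<nu> (1::real)"
    using coeff_1_le[OF assms(1,2)] assms(3) by simp
  hence "\<bar>h2_coeff \<nu> q 1\<bar> \<le> 1" using F by (simp only: mult_le_cancel_right_pos)
  hence "rho \<nu> 0 \<le> 1" by (simp add: rho_def)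
  moreover have "rho \<nu> 0 = q powr (\<nu> + 1) / (4 * (1 - q) * (1 - q powr (\<nu> + 1)))"
    by (simp add: rho_eq[OF assms(1)])
  moreover have "0 < 4 * (1 - q) * (1 - q powr (\<nu> + 1))" using q powr_bounds[OF assms(1)] by simp
  ultimately show ?thesis by (simp only: pos_divide_le_eq mult_1)
qed

text \<open>\<open>param_bound\<close> replaces b by 4 (1 - q) (1 - b), and (k + 1) q^k <= 1 + q +
  ... + q^k bounds 1 - q^(k+1) from below by (1 - q) (k + 1) q^k. What remains is q^k / (k +
  1).\<close>

lemma rho_less:
  assumes "-1 < \<nu>" "good \<nu> 1" "0 \<le> F \<nu> 1 + dF \<nu> (1::real)" "1 \<le> k"
  shows "rho \<nu> k < 1 / real (Suc k)"
proof -
  define b where "b = q powr (\<nu> + 1)"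
  have b: "0 < b" "b < 1" "b \<le> 4 * (1 - q) * (1 - b)"
    using powr_bounds[OF assms(1)] param_bound[OF assms(1-3)] by (auto simp: b_def)
  have "b * q ^ k \<le> b" using q b by (intro mult_left_le) (auto intro: power_le_one)
  hence bk: "1 - b \<le> 1 - b * q ^ k" "0 < 1 - b * q ^ k" using b by linarith+
  have "real (Suc k) * q ^ k = (\<Sum>i<Suc k. q ^ k)" by simp
  also have "\<dots> \<le> (\<Sum>i<Suc k. q ^ i)"
    using q by (intro sum_mono power_decreasing) auto
  finally have "(1 - q) * (real (Suc k) * q ^ k) \<le> (1 - q) * (\<Sum>i<Suc k. q ^ i)"
    using q by (intro mult_left_mono) auto
  also have "\<dots> = 1 - q ^ Suc k" by (rule one_diff_power_eq[symmetric])
  finally have g: "(1 - q) * (real (Suc k) * q ^ k) \<le> 1 - q ^ Suc k" .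
  have g0: "0 < (1 - q) * (real (Suc k) * q ^ k)" using q by simp
  have "b * q ^ (2 * k) / (4 * (1 - q ^ Suc k) * (1 - b * q ^ k)) \<le>
      (4 * (1 - q) * (1 - b)) * q ^ (2 * k) / (4 * ((1 - q) * (real (Suc k) * q ^ k)) * (1 - b))"
    using b bk g g0 q power_le_one[of q "Suc k"]
    by (intro frac_le mult_mono mult_right_mono mult_pos_pos mult_nonneg_nonneg) auto
  also have "\<dots> = q ^ k / real (Suc k)"
  proof -
    have "(4 * r * s) * q ^ (2 * k) / (4 * (r * (m * q ^ k)) * s) = q ^ k / m"
      if "r \<noteq> 0" "s \<noteq> 0" "m \<noteq> 0" for r s m
      using that q by (simp add: mult_2 power_add)
    from this[of "1 - q" "1 - b" "real (Suc k)"] show ?thesis using q b by simp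
  qed
  also have "\<dots> < 1 / real (Suc k)"
    using q assms(4) by (intro divide_strict_right_mono) (auto simp: power_less_one_iff)
  finally show ?thesis by (simp only: rho_eq[OF assms(1)] b_def)
qed

lemma rho_moment_less:
  assumes "-1 < \<nu>" "good \<nu> 1" "0 \<le> F \<nu> 1 + dF \<nu> (1::real)"
  shows "9 * rho \<nu> 1 ^ 2 - 12 * rho \<nu> 1 * rho \<nu> 2 < 4 / 9"
proof -
  have "rho \<nu> 1 = q powr (\<nu> + 1) * q ^ 2 / (4 * (1 - q ^ 2) * (1 - q powr (\<nu> + 1) * q))"
    "rho \<nu> 2 = q powr (\<nu> + 1) * q ^ 4 / (4 * (1 - q ^ 3) * (1 - q powr (\<nu> + 1) * q ^ 2))"
    using rho_eq[OF assms(1), of 1] rho_eq[OF assms(1), of 2] by (simp_all add: numeral_eq_Suc)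
  thus ?thesis
    using second_moment_bound[OF q powr_bounds(1,2)[OF assms(1)] param_bound[OF assms]] by simp
qed

text \<open>For almost all approximating polynomials the reciprocal zeros of the derivative of order
  k + 1 are at most 2/3 and sum to less than (k + 2) / (k + 1), so \<open>Re_prod_pos\<close>
  applies. The factor (-1)^k is the sign of the value at 0.\<close>

lemma Re_higher_deriv_h2_pos:
  assumes "-1 < \<nu>" "good \<nu> 1" "0 \<le> F \<nu> 1 + dF \<nu> (1::real)" "1 \<le> k" "z \<in> ball 0 1"
  shows "0 < Re ((-1) ^ k * (deriv ^^ Suc k) (h2 \<nu> q) z)"
proof -
  define P where "P k n = (pderiv ^^ Suc k) (hpoly \<nu> n)" for k n
  define V where "V k = (deriv ^^ Suc k) (h2 \<nu> q) 0" for k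
  have V: "V k = of_real (fact (Suc k) * h2_coeff \<nu> q k)" for k
    unfolding V_def by (rule higher_deriv_h2_0[OF assms(1)])
  have Vnz: "V k \<noteq> 0" for k unfolding V using coeff_nz[OF assms(1), of k] by (simp del: fact_Suc)
  have lim: "(\<lambda>n. poly (P k n) z) \<longlonglongrightarrow> (deriv ^^ Suc k) (h2 \<nu> q) z" for k z
    unfolding P_def by (rule higher_pderiv_hpoly_tendsto[OF assms(1)])
  have lim0: "(\<lambda>n. poly (P k n) 0) \<longlonglongrightarrow> V k" for k
    using lim[of k 0] by (simp add: V_def)
  have pderiv_P: "pderiv (P k n) = P (Suc k) n" for k n by (simp add: P_def)
  have nz: "\<forall>\<^sub>F n in sequentially. poly (P k n) 0 \<noteq> 0" for k
    using tendsto_imp_eventually_ne[OF lim0 Vnz] .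
  have Vquot: "V (Suc k) / V k = - of_real (real (k + 2) * rho \<nu> k)" for k
  proof -
    have "fact (Suc (Suc k)) = real (k + 2) * (fact (Suc k) :: real)" by simp
    hence "V (Suc k) / V k = of_real (real (k + 2) * fact (Suc k) * h2_coeff \<nu> q (Suc k) / (fact (Suc k) * h2_coeff \<nu> q k))"
      unfolding V by (simp only: of_real_divide)
    also have "real (k + 2) * fact (Suc k) * h2_coeff \<nu> q (Suc k) / (fact (Suc k) * h2_coeff \<nu> q k) =
        - (real (k + 2) * rho \<nu> k)"
      by (simp add: rho_def del: fact_Suc)
    finally show ?thesis by (simp only: of_real_minus)
  qed
  have V31: "V 3 / V 1 = of_real (12 * rho \<nu> 1 * rho \<nu> 2)"
  proof -
    have "V 3 / V 1 = (V (Suc 2) / V 2) * (V (Suc 1) / V 1)"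
      using Vnz[of 2] by (simp add: numeral_eq_Suc)
    also have "\<dots> = of_real (12 * rho \<nu> 1 * rho \<nu> 2)" unfolding Vquot by simp
    finally show ?thesis .
  qed
  have S: "\<forall>\<^sub>F n in sequentially. Re (- poly (P (Suc k) n) 0 / poly (P k n) 0) < real (k + 2) / real (k + 1)"
    if "1 \<le> k" for k
  proof -
    have "(\<lambda>n. Re (- poly (P (Suc k) n) 0 / poly (P k n) 0)) \<longlonglongrightarrow> Re (- V (Suc k) / V k)"
      by (intro tendsto_intros lim0 Vnz)
    moreover have "Re (- V (Suc k) / V k) = real (k + 2) * rho \<nu> k"
      using Vquot[of k] by simp
    moreover have "real (k + 2) * rho \<nu> k < real (k + 2) * (1 / real (Suc k))"
      by (intro mult_strict_left_mono rho_less assms that) auto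
    ultimately show ?thesis by (intro order_tendstoD(2)) (auto simp: add_ac)
  qed
  have T: "\<forall>\<^sub>F n in sequentially.
      Re ((poly (P 2 n) 0 / poly (P 1 n) 0) ^ 2 - poly (P 3 n) 0 / poly (P 1 n) 0) < 4 / 9"
  proof -
    have "(\<lambda>n. Re ((poly (P 2 n) 0 / poly (P 1 n) 0) ^ 2 - poly (P 3 n) 0 / poly (P 1 n) 0))
        \<longlonglongrightarrow> Re ((V (Suc 1) / V 1) ^ 2 - V 3 / V 1)"
      unfolding Suc_1 by (intro tendsto_intros lim0 Vnz)
    moreover have "(V (Suc 1) / V 1) ^ 2 - V 3 / V 1 = of_real (9 * rho \<nu> 1 ^ 2 - 12 * rho \<nu> 1 * rho \<nu> 2)"
      unfolding Vquot V31 by (simp add: power_mult_distrib)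
    ultimately show ?thesis
      using rho_moment_less[OF assms(1-3)] by (intro order_tendstoD(2)) (auto simp only: Re_complex_of_real)
  qed
  have roots0: "roots_ge 0 (P k n)" if "poly (P k n) 0 \<noteq> 0" for k n
    unfolding P_def by (rule roots_ge_higher_pderiv[OF roots_ge_hpoly[OF assms(1)]]) (use that in \<open>auto simp: P_def\<close>)
  \<comment> \<open>The second moment of the reciprocal zeros of the second derivative keeps these zeros off \<open>[0, 3/2)\<close>,
    and by Gauss--Lucas the zeros of the higher derivatives too.\<close>
  have moments: "roots_ge (3 / 2) (P 1 n)"
    if n: "poly (P 1 n) 0 \<noteq> 0"
      "Re ((poly (P 2 n) 0 / poly (P 1 n) 0) ^ 2 - poly (P 3 n) 0 / poly (P 1 n) 0) < 4 / 9" for n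
  proof -
    obtain N x where x: "reciprocal_roots (P 1 n) N x"
      using ex_reciprocal_roots[OF roots0[OF n(1)] order_refl n(1)] by blast
    have "poly (P 2 n) 0 / poly (P 1 n) 0 = - of_real (\<Sum>i<N. x i)"
      "poly (P 3 n) 0 / poly (P 1 n) 0 = of_real ((\<Sum>i<N. x i) ^ 2 - (\<Sum>i<N. x i ^ 2))"
      using reciprocal_roots_sum[OF x] reciprocal_roots_sum2[OF x] n(1) by (simp_all add: pderiv_P numeral_eq_Suc field_simps)
    hence "(poly (P 2 n) 0 / poly (P 1 n) 0) ^ 2 - poly (P 3 n) 0 / poly (P 1 n) 0 =
        of_real (\<Sum>i<N. x i ^ 2)" by (simp only: power2_minus) simp
    hence sq: "(\<Sum>i<N. x i ^ 2) < 4 / 9" using n(2) by (simp only: Re_complex_of_real)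
    show ?thesis unfolding roots_ge_def
    proof (intro allI impI)
      fix z assume "poly (P 1 n) z = 0"
      then obtain i where i: "i < N" "z = of_real (1 / x i)" using reciprocal_roots_ex[OF x n(1)] by blast
      have "x i ^ 2 \<le> (\<Sum>i<N. x i ^ 2)" using i(1) by (intro member_le_sum) auto
      hence "x i ^ 2 \<le> (2 / 3) ^ 2" using sq by (simp add: power2_eq_square)
      hence "x i \<le> 2 / 3" by (rule power2_le_imp_le) simp
      hence "3 / 2 \<le> 1 / x i" using reciprocal_roots_pos[OF x i(1)] by (simp add: field_simps)
      thus "\<exists>x\<ge>3 / 2. z = of_real x" using i(2) by blast
    qed
  qed
  have Re_pos: "\<forall>\<^sub>F n in sequentially. 0 < Re (poly (P k n) w / poly (P k n) 0)"
    if k: "1 \<le> k" and w: "w \<in> ball 0 1" for k w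
    using nz[of 1] nz[of k] T S[OF k]
  proof eventually_elim
    case (elim n)
    have r1: "roots_ge (3 / 2) (P 1 n)" by (rule moments[OF elim(1) elim(3)])
    have "(pderiv ^^ (k - 1)) (P 1 n) = P k n"
      using k unfolding P_def by (metis Suc_eq_plus1 add_Suc_right comp_apply funpow_add le_add_diff_inverse2 plus_1_eq_Suc)
    hence rk: "roots_ge (3 / 2) (P k n)"
    proof -
      have "P k n \<noteq> 0" using elim(2) by force
      thus ?thesis
        using roots_ge_higher_pderiv[OF r1, of "k - 1"] \<open>(pderiv ^^ (k - 1)) (P 1 n) = P k n\<close> by simp
    qed
    obtain N x where x: "reciprocal_roots (P k n) N x"
      using ex_reciprocal_roots[OF rk _ elim(2)] by auto
    have q1: "- poly (P (Suc k) n) 0 / poly (P k n) 0 = of_real (\<Sum>i<N. x i)"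
      using reciprocal_roots_sum[OF x] elim(2) by (simp add: pderiv_P)
    hence S: "(\<Sum>i<N. x i) < real (k + 2) / real (k + 1)"
      using elim(4) by (simp only: Re_complex_of_real)
    have x23: "x i \<le> 2 / 3" if "i < N" for i using reciprocal_roots_le[OF x rk that] by simp
    \<comment> \<open>For k = 1 the two moments give 3/2 + (3/20)(4/9) = 47/30. For k >= 2 the bound
      x <= 2/3 costs only the factor 1 + (3/20)(2/3) = 11/10, and (11/10)(4/3) = 22/15 <
      47/30.\<close>
    have "(\<Sum>i<N. x i + 3 / 20 * x i ^ 2) \<le> 47 / 30"
    proof (cases "k = 1")
      case True
      have "poly (P 2 n) 0 / poly (P 1 n) 0 = - of_real (\<Sum>i<N. x i)"
        "poly (P 3 n) 0 / poly (P 1 n) 0 = of_real ((\<Sum>i<N. x i) ^ 2 - (\<Sum>i<N. x i ^ 2))"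
        using reciprocal_roots_sum[OF x] reciprocal_roots_sum2[OF x] elim(1) True by (simp_all add: pderiv_P numeral_eq_Suc field_simps)
      hence "(poly (P 2 n) 0 / poly (P 1 n) 0) ^ 2 - poly (P 3 n) 0 / poly (P 1 n) 0 =
          of_real (\<Sum>i<N. x i ^ 2)" by (simp only: power2_minus) simp
      hence "(\<Sum>i<N. x i ^ 2) < 4 / 9" using elim(3) by (simp only: Re_complex_of_real)
      moreover have "(\<Sum>i<N. x i + 3 / 20 * x i ^ 2) = (\<Sum>i<N. x i) + 3 / 20 * (\<Sum>i<N. x i ^ 2)"
        by (simp only: sum.distrib sum_distrib_left)
      moreover have "(\<Sum>i<N. x i) < 3 / 2" using S True by simp
      ultimately show ?thesis by simp
    next
      case False
      have "real (k + 2) / real (k + 1) \<le> 4 / 3" using k False by (simp add: field_simps)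
      moreover have "(\<Sum>i<N. x i + 3 / 20 * x i ^ 2) \<le> 11 / 10 * (\<Sum>i<N. x i)"
        unfolding sum_distrib_left
      proof (rule sum_mono)
        fix i assume "i \<in> {..<N}"
        hence "x i * x i \<le> 2 / 3 * x i" using x23[of i] reciprocal_roots_pos[OF x, of i] by (intro mult_right_mono) auto
        thus "x i + 3 / 20 * x i ^ 2 \<le> 11 / 10 * x i" by (simp add: power2_eq_square)
      qed
      ultimately show ?thesis using S by linarith
    qed
    hence "0 < Re (\<Prod>i<N. 1 - of_real (x i) * w)"
      using reciprocal_roots_pos[OF x] x23 w by (intro Re_prod_pos) (auto intro: less_imp_le)
    moreover have "poly (P k n) w / poly (P k n) 0 = (\<Prod>i<N. 1 - of_real (x i) * w)"
      using elim(2) by (subst reciprocal_roots_poly[OF x]) simp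
    ultimately show ?case by simp
  qed
  \<comment> \<open>The limit of the polynomials only gives a nonnegative real part; the value 1 at
    the centre makes it strictly positive.\<close>
  have "0 < Re ((deriv ^^ Suc k) (h2 \<nu> q) z / V k)"
  proof (rule Re_pos_of_nonneg[OF _ _ _ assms(5)])
    have hol: "h2 \<nu> q holomorphic_on ball 0 1"
      unfolding h2_eq'[OF assms(1)] by (intro holomorphic_intros holomorphic_F assms)
    show "(\<lambda>z. (deriv ^^ Suc k) (h2 \<nu> q) z / V k) holomorphic_on ball 0 1"
      by (intro holomorphic_intros holomorphic_higher_deriv hol Vnz) auto
    show "0 < Re ((deriv ^^ Suc k) (h2 \<nu> q) 0 / V k)"
      unfolding V_def[symmetric] using Vnz[of k] by simp
    show "0 \<le> Re ((deriv ^^ Suc k) (h2 \<nu> q) w / V k)" if "w \<in> ball 0 1" for w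
    proof (rule tendsto_lowerbound)
      show "(\<lambda>n. Re (poly (P k n) w / poly (P k n) 0)) \<longlonglongrightarrow> Re ((deriv ^^ Suc k) (h2 \<nu> q) w / V k)"
        by (intro tendsto_intros lim lim0 Vnz)
      show "\<forall>\<^sub>F n in sequentially. 0 \<le> Re (poly (P k n) w / poly (P k n) 0)"
        using Re_pos[OF assms(4) that] by (auto elim: eventually_mono)
    qed simp
  qed
  moreover have "(-1) ^ k * (deriv ^^ Suc k) (h2 \<nu> q) z =
      of_real (fact (Suc k) * \<bar>h2_coeff \<nu> q k\<bar>) * ((deriv ^^ Suc k) (h2 \<nu> q) z / V k)"
  proof -
    have "V k = (-1) ^ k * of_real (fact (Suc k) * \<bar>h2_coeff \<nu> q k\<bar>)"
      unfolding V by (subst coeff_sign[OF assms(1)]) (simp del: fact_Suc)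
    hence e: "(-1) ^ k * V k = of_real (fact (Suc k) * \<bar>h2_coeff \<nu> q k\<bar>)"
      by (simp flip: mult.assoc power_mult_distrib)
    show ?thesis unfolding e[symmetric] using Vnz[of k] by simp
  qed
  moreover have "0 < fact (Suc k) * \<bar>h2_coeff \<nu> q k\<bar>"
    using coeff_nz[OF assms(1), of k] by (simp del: fact_Suc)
  ultimately show ?thesis
    by (simp only: times_complex.sel Re_complex_of_real Im_complex_of_real mult_zero_left diff_zero mult_pos_pos)
qed

text \<open>The condition on the n-th derivative concerns the derivative of order n + 1, so n = 1
  leads to the second derivative.\<close>

lemma close_to_convex_higher_deriv_h2:
  assumes "-1 < \<nu>" "good \<nu> 1" "0 \<le> F \<nu> 1 + dF \<nu> (1::real)" "1 \<le> n"
  shows "close_to_convex_in_disc ((deriv ^^ n) (h2 \<nu> q))"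
proof -
  define \<phi> where "\<phi> = (\<lambda>z::complex. (-1) ^ n * z)"
  have s: "(-1) ^ n * ((-1) ^ n * z) = z" for z :: complex
    by (simp flip: mult.assoc power_mult_distrib)
  have "\<phi> ` ball 0 1 = ball 0 1"
  proof (intro equalityI subsetI)
    fix z :: complex assume "z \<in> ball 0 1"
    thus "z \<in> \<phi> ` ball 0 1"
      by (intro image_eqI[of _ _ "(-1) ^ n * z"]) (auto simp: \<phi>_def s norm_mult norm_power)
  qed (auto simp: \<phi>_def norm_mult norm_power)
  moreover have "\<phi> holomorphic_on ball 0 1" unfolding \<phi>_def by (intro holomorphic_intros)
  moreover have "inj_on \<phi> (ball 0 1)" by (auto simp: \<phi>_def inj_on_def)
  ultimately have \<phi>: "convex_univalent_in_disc \<phi>" by (simp add: convex_univalent_in_disc_def)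
  have "deriv \<phi> z = (-1) ^ n" for z
    unfolding \<phi>_def by (rule DERIV_imp_deriv) (auto intro!: derivative_eq_intros)
  hence "deriv ((deriv ^^ n) (h2 \<nu> q)) z / deriv \<phi> z = (-1) ^ n * (deriv ^^ Suc n) (h2 \<nu> q) z" for z
    using s[of "deriv ((deriv ^^ n) (h2 \<nu> q)) z"] by (simp add: divide_eq_eq mult_ac)
  moreover have "(deriv ^^ n) (h2 \<nu> q) holomorphic_on ball 0 1"
    unfolding h2_eq'[OF assms(1)]
    by (intro holomorphic_higher_deriv holomorphic_intros holomorphic_F assms open_ball)
  ultimately show ?thesis
    unfolding close_to_convex_in_disc_def using \<phi> Re_higher_deriv_h2_pos[OF assms] by metis
qed

end

theorem theorem3:
  fixes q :: real
  assumes "0 < q" and "q < 1"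
  shows "\<exists>\<nu>\<^sub>s \<nu>\<^sub>0.
    (-1 < \<nu>\<^sub>s \<and> jackson_j1 \<nu>\<^sub>s q = 1 \<and>
      (\<forall>\<nu>. -1 < \<nu> \<and> jackson_j1 \<nu> q = 1 \<longrightarrow> \<nu> = \<nu>\<^sub>s)) \<and>
    (\<nu>\<^sub>s \<le> \<nu>\<^sub>0 \<and> deriv (h2 \<nu>\<^sub>0 q) 1 = 0 \<and>
      (\<forall>\<nu>. \<nu>\<^sub>s \<le> \<nu> \<and> deriv (h2 \<nu> q) 1 = 0 \<longrightarrow> \<nu> = \<nu>\<^sub>0)) \<and>
    (\<forall>\<nu>. -1 < \<nu> \<longrightarrow>
      (starlike_in_disc (h2 \<nu> q) \<and>
         (\<forall>n\<ge>1. close_to_convex_in_disc ((deriv ^^ n) (h2 \<nu> q)))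
       \<longleftrightarrow> \<nu> \<ge> max \<nu>\<^sub>0 \<nu>\<^sub>s))"
proof -
  interpret qbessel q by unfold_locales (rule assms)+
  obtain \<nu>s where s: "-1 < \<nu>s" "F \<nu>s 1 = (0::real)" "\<And>\<nu>. -1 < \<nu> \<Longrightarrow> good \<nu> 1 \<longleftrightarrow> \<nu>s < \<nu>"
    by (rule ex_threshold) blast
  obtain \<nu>0 where o: "\<nu>s < \<nu>0" "F \<nu>0 1 + dF \<nu>0 1 = (0::real)"
    "\<And>\<nu>. \<nu>s \<le> \<nu> \<Longrightarrow> F \<nu> 1 + dF \<nu> 1 = (0::real) \<Longrightarrow> \<nu> = \<nu>0"
    "\<And>\<nu>. \<nu>s < \<nu> \<Longrightarrow> 0 \<le> F \<nu> 1 + dF \<nu> (1::real) \<longleftrightarrow> \<nu>0 \<le> \<nu>"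
    by (rule ex_threshold_deriv[OF s]) blast+
  \<comment> \<open>Both sides are matched with \<open>good \<nu> 1\<close>, that is
    \<open>\<nu>s < \<nu>\<close>, and h'(1) >= 0, which means \<open>\<nu>0 \<le> \<nu>\<close>
    once \<open>\<nu>s < \<nu>\<close>. The bound by the maximum yields the strict inequality
    because \<open>\<nu>s < \<nu>0\<close>.\<close>
  have iff: "starlike_in_disc (h2 \<nu> q) \<and> (\<forall>n\<ge>1. close_to_convex_in_disc ((deriv ^^ n) (h2 \<nu> q)))
       \<longleftrightarrow> \<nu> \<ge> max \<nu>0 \<nu>s" if \<nu>: "-1 < \<nu>" for \<nu>
  proof
    assume "starlike_in_disc (h2 \<nu> q) \<and> (\<forall>n\<ge>1. close_to_convex_in_disc ((deriv ^^ n) (h2 \<nu> q)))"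
    hence "good \<nu> 1" "0 \<le> F \<nu> 1 + dF \<nu> (1::real)" using starlike_h2D[OF \<nu>] by auto
    thus "\<nu> \<ge> max \<nu>0 \<nu>s" using s(3)[OF \<nu>] o(4) by auto
  next
    assume "\<nu> \<ge> max \<nu>0 \<nu>s"
    hence "\<nu>s < \<nu>" "\<nu>0 \<le> \<nu>" using o(1) by auto
    hence "good \<nu> 1" "0 \<le> F \<nu> 1 + dF \<nu> (1::real)" using s(3)[OF \<nu>] o(4) by auto
    thus "starlike_in_disc (h2 \<nu> q) \<and> (\<forall>n\<ge>1. close_to_convex_in_disc ((deriv ^^ n) (h2 \<nu> q)))"
      using starlike_h2 close_to_convex_higher_deriv_h2 \<nu> by blast
  qed
  show ?thesis
  proof (rule exI[of _ \<nu>s], rule exI[of _ \<nu>0], intro conjI allI impI)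
    show "jackson_j1 \<nu>s q = 1" by (rule jackson_j1_unique(1)[OF s])
    show "\<nu> = \<nu>s" if "-1 < \<nu> \<and> jackson_j1 \<nu> q = 1" for \<nu>
      by (rule jackson_j1_unique(2)[OF s]) (use that in auto)
    show "deriv (h2 \<nu>0 q) 1 = 0"
      using deriv_h2_1_eq_0_iff[of \<nu>0] o(1,2) s(1) by simp
    show "\<nu> = \<nu>0" if "\<nu>s \<le> \<nu> \<and> deriv (h2 \<nu> q) 1 = 0" for \<nu>
      using deriv_h2_1_eq_0_iff[of \<nu>] o(3)[of \<nu>] s(1) that by simp
  qed (use s(1) o(1) iff in simp_all)
qed

end
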